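(* Let $m\ge1$, $n\ge m+3$ and $1<p<p_*:=\frac{n-m}{n-m-2}$. Let $M_0\subset\mathbb{R}^n$, $I$, $F$, $M_t=F_t(M_0)$ be as in the context, let $F$ be $B$-bounded on $I$ for some constant $B>0$, and let $\Omega\subset\mathbb{R}^n$ be a domain with $M_t\subset\Omega$ for all $t\in\overline I$. Suppose that a nonnegative function $u\in C^{2,1}(Q_{\Omega,I}\setminus M_I)$ satisfies $\partial_tu-\Delta u=-u^p$ in $Q_{\Omega,I}\setminus M_I$ and that, for any bounded interval $I'$ with $\overline{I'}\subset I$, $$\lim_{x\to M_t}d(x,M_t)^{n-m-2}u(x,t)=0\quad\text{uniformly for }t\in I'.$$ Then $u\in C^{2,1}(Q_{\Omega,I})$ (i.e. $u$ extends across $M_I$ to such a function) and $u$ is a solution of $\partial_tu-\Delta u=-u^p$ in $Q_{\Omega,I}$.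
   Context: Setting. $M_0\subset\mathbb{R}^n$ is a connected compact $m$-dimensional smooth embedded submanifold without boundary, $I$ is an open interval with $0\in I$, and $F\in C^\infty(\mathbb{R}^n\times I;\mathbb{R}^n)$ is a one parameter family of diffeomorphisms of $\mathbb{R}^n$: each $F_t:=F(\cdot,t)$ is a diffeomorphism and $F_0=\mathrm{id}$. Moreover $F$ extends to a smooth one parameter family of diffeomorphisms $\tilde F\in C^\infty(\mathbb{R}^n\times J;\mathbb{R}^n)$ for some open interval $J\supset\overline I$. Put $M_t:=F_t(M_0)$ for $t\in I$ and $M_t:=\tilde F_t(M_0)$ for $t\in J\setminus I$. $B$-bounded: $F$ is called $B$-bounded on $I$ if $$\sup_{s\in I}\sup_{p\in M_0}|\partial_tF(p,s)|+\sum_{i}\|\partial_{x_i}F\|_{L^\infty(\mathbb{R}^n\times I)}+\sum_i\|\partial_t\partial_{x_i}F\|_{L^\infty(\mathbb{R}^n\times I)}+\sum_{i,j}\|\partial_{x_i}\partial_{x_j}F\|_{L^\infty(\mathbb{R}^n\times I)}\le B$$ and $|F_t(p)-F_t(q)|\ge B^{-1}|p-q|$ for all $p,q\in M_0$ and $t\in I$. Notation. $Q_{\Omega,I'}:=\Omega\times I'$, $M_{I'}:=\{(x,t)\in\mathbb{R}^n\times I': x\in M_t\}$. $C^{2,1}$: twice continuously differentiable in $x$, once in $t$. $d(x,M):=\inf_{y\in M}|x-y|$, $M^\delta:=\{x:d(x,M)<\delta\}$. "$\lim_{x\to M_t}g(x,t)=a$ uniformly for $t\in I'$" means: for every $\varepsilon>0$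 there is $\delta>0$ independent of $t$ with $|g(x,t)-a|\le\varepsilon$ for all $x\in M_t^\delta\setminus M_t$, $t\in I'$. *)

theory Defs
  imports "HOL-Analysis.Analysis" "HOL-Probability.Essential_Supremum"
begin

section \<open>Smooth maps, diffeomorphisms, submanifolds\<close>

text \<open>All of the following is intended for open sets \<open>S\<close>.\<close>

fun Ck_on :: "nat \<Rightarrow> 'a::real_normed_vector set \<Rightarrow> ('a \<Rightarrow> 'b::real_normed_vector) \<Rightarrow> bool" where
  "Ck_on 0 S f \<longleftrightarrow> continuous_on S f"
| "Ck_on (Suc k) S f \<longleftrightarrow>
     (\<forall>x\<in>S. f differentiable (at x)) \<and>
     (\<forall>v. Ck_on k S (\<lambda>x. frechet_derivative f (at x) v))"

definition smooth_on :: "'a::real_normed_vector set \<Rightarrow> ('a \<Rightarrow> 'b::real_normed_vector) \<Rightarrow> bool" where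
  "smooth_on S f \<longleftrightarrow> (\<forall>k. Ck_on k S f)"

definition diffeomorphism_between ::
  "'a::real_normed_vector set \<Rightarrow> 'b::real_normed_vector set \<Rightarrow> ('a \<Rightarrow> 'b) \<Rightarrow> bool" where
  "diffeomorphism_between U V f \<longleftrightarrow>
     smooth_on U f \<and> (\<exists>g. smooth_on V g \<and> homeomorphism U V f g)"

text \<open>The slice \<open>{y. \<forall>i. i \<notin> K \<longrightarrow> y $ i = 0}\<close> is \<open>\<real>\<^sup>m \<times> {0}\<close> up to a choice of the \<open>m\<close>
  free coordinates, the index type \<open>'n\<close> being unordered.\<close>

definition embedded_submanifold :: "nat \<Rightarrow> (real ^ 'n::finite) set \<Rightarrow> bool" where
  "embedded_submanifold m M \<longleftrightarrow>
     (\<forall>p\<in>M. \<exists>U V (\<phi> :: real ^ 'n \<Rightarrow> real ^ 'n) (K :: 'n set).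
        open U \<and> p \<in> U \<and> open V \<and> diffeomorphism_between U V \<phi> \<and> card K = m \<and>
        \<phi> ` (U \<inter> M) = V \<inter> {y. \<forall>i. i \<notin> K \<longrightarrow> y $ i = 0})"

section \<open>One parameter families of diffeomorphisms\<close>

definition diffeo_family :: "((real ^ 'n::finite) \<times> real \<Rightarrow> real ^ 'n) \<Rightarrow> real set \<Rightarrow> bool" where
  "diffeo_family F I \<longleftrightarrow>
     open I \<and> is_interval I \<and> 0 \<in> I \<and>
     smooth_on (UNIV \<times> I) F \<and>
     (\<forall>t\<in>I. diffeomorphism_between UNIV UNIV (\<lambda>x. F (x, t))) \<and>
     (\<forall>x. F (x, 0) = x)"

text \<open>\<open>F\<close> extends to the family \<open>F'\<close> on an open interval \<open>J\<close> containing the closure of \<open>I\<close>.\<close>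

definition extends_to_family ::
  "((real ^ 'n::finite) \<times> real \<Rightarrow> real ^ 'n) \<Rightarrow> real set \<Rightarrow>
   ((real ^ 'n) \<times> real \<Rightarrow> real ^ 'n) \<Rightarrow> real set \<Rightarrow> bool" where
  "extends_to_family F I F' J \<longleftrightarrow>
     diffeo_family F' J \<and> closure I \<subseteq> J \<and> (\<forall>x. \<forall>t\<in>I. F' (x, t) = F (x, t))"

definition moving ::
  "((real ^ 'n::finite) \<times> real \<Rightarrow> real ^ 'n) \<Rightarrow> real set \<Rightarrow>
   ((real ^ 'n) \<times> real \<Rightarrow> real ^ 'n) \<Rightarrow> (real ^ 'n) set \<Rightarrow> real \<Rightarrow> (real ^ 'n) set" where
  "moving F I F' M0 t =
     (if t \<in> I then (\<lambda>x. F (x, t)) ` M0 else (\<lambda>x. F' (x, t)) ` M0)"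

definition track :: "(real \<Rightarrow> 'a set) \<Rightarrow> real set \<Rightarrow> ('a \<times> real) set" where
  "track M I = {(x, t). t \<in> I \<and> x \<in> M t}"

section \<open>Classical partial derivatives in space-time\<close>

definition has_pd :: "'a::real_normed_vector \<Rightarrow> ('a \<Rightarrow> 'b::real_normed_vector) \<Rightarrow> 'a \<Rightarrow> bool" where
  "has_pd v f z \<longleftrightarrow> (\<lambda>s::real. f (z + s *\<^sub>R v)) differentiable (at 0)"

definition pd :: "'a::real_normed_vector \<Rightarrow> ('a \<Rightarrow> 'b::real_normed_vector) \<Rightarrow> 'a \<Rightarrow> 'b" where
  "pd v f z = vector_derivative (\<lambda>s::real. f (z + s *\<^sub>R v)) (at 0)"

definition e_x :: "'n::finite \<Rightarrow> (real ^ 'n) \<times> real" where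
  "e_x i = (axis i 1, 0)"

definition e_t :: "(real ^ 'n::finite) \<times> real" where
  "e_t = (0, 1)"

definition C21_on :: "((real ^ 'n::finite) \<times> real) set \<Rightarrow> ((real ^ 'n) \<times> real \<Rightarrow> real) \<Rightarrow> bool" where
  "C21_on S u \<longleftrightarrow>
     continuous_on S u \<and>
     (\<forall>z\<in>S. has_pd e_t u z) \<and> continuous_on S (pd e_t u) \<and>
     (\<forall>i. (\<forall>z\<in>S. has_pd (e_x i) u z) \<and> continuous_on S (pd (e_x i) u)) \<and>
     (\<forall>i j. (\<forall>z\<in>S. has_pd (e_x i) (pd (e_x j) u) z) \<and>
            continuous_on S (pd (e_x i) (pd (e_x j) u)))"

definition laplacian :: "((real ^ 'n::finite) \<times> real \<Rightarrow> real) \<Rightarrow> (real ^ 'n) \<times> real \<Rightarrow> real" where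
  "laplacian u z = (\<Sum>i\<in>UNIV. pd (e_x i) (pd (e_x i) u) z)"

text \<open>The power \<open>u\<^sup>p\<close> with real exponent is meaningful for nonnegative \<open>u\<close> only, so
  nonnegativity is part of being a solution.\<close>

definition nonneg_solution ::
  "real \<Rightarrow> ((real ^ 'n::finite) \<times> real) set \<Rightarrow> ((real ^ 'n) \<times> real \<Rightarrow> real) \<Rightarrow> bool" where
  "nonneg_solution p S u \<longleftrightarrow>
     C21_on S u \<and> (\<forall>z\<in>S. 0 \<le> u z) \<and>
     (\<forall>z\<in>S. pd e_t u z - laplacian u z = - (u z powr p))"

section \<open>\<open>B\<close>-boundedness and uniform limits\<close>

definition Linf_norm :: "'a::euclidean_space set \<Rightarrow> ('a \<Rightarrow> 'b::real_normed_vector) \<Rightarrow> ennreal" where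
  "Linf_norm S f = esssup (lebesgue_on S) (\<lambda>z. ennreal (norm (f z)))"

definition B_bounded ::
  "real \<Rightarrow> ((real ^ 'n::finite) \<times> real \<Rightarrow> real ^ 'n) \<Rightarrow> real set \<Rightarrow> (real ^ 'n) set \<Rightarrow> bool" where
  "B_bounded B F I M0 \<longleftrightarrow>
     (SUP s\<in>I. SUP q\<in>M0. ennreal (norm (pd e_t F (q, s))))
       + (\<Sum>i\<in>UNIV. Linf_norm (UNIV \<times> I) (pd (e_x i) F))
       + (\<Sum>i\<in>UNIV. Linf_norm (UNIV \<times> I) (pd e_t (pd (e_x i) F)))
       + (\<Sum>i\<in>UNIV. \<Sum>j\<in>UNIV. Linf_norm (UNIV \<times> I) (pd (e_x i) (pd (e_x j) F)))
       \<le> ennreal B \<and>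
     (\<forall>t\<in>I. \<forall>x\<in>M0. \<forall>y\<in>M0. norm (F (x, t) - F (y, t)) \<ge> inverse B * norm (x - y))"

definition tube :: "'a::metric_space set \<Rightarrow> real \<Rightarrow> 'a set" where
  "tube M \<delta> = {x. infdist x M < \<delta>}"

definition lim_to_moving ::
  "(real \<Rightarrow> 'a::metric_space set) \<Rightarrow> real set \<Rightarrow> ('a \<times> real \<Rightarrow> real) \<Rightarrow> real \<Rightarrow> bool" where
  "lim_to_moving M I' g a \<longleftrightarrow>
     (\<forall>\<epsilon>>0. \<exists>\<delta>>0. \<forall>t\<in>I'. \<forall>x\<in>tube (M t) \<delta> - M t. \<bar>g (x, t) - a\<bar> \<le> \<epsilon>)"

end

theory Submission
  imports Defs "HOL-Probability.Distributions"
begin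

text \<open>
  Near the singular set \<open>K = {(x, t). x \<in> M t}\<close> one has \<open>u = o(d ^ -(n-m-2))\<close>, where \<open>d\<close> is the space-time
  distance to \<open>K\<close>. Covering numbers \<open>O(\<epsilon> ^ -(m+1))\<close> of \<open>K\<close> give its \<open>\<epsilon>\<close>-tube volume \<open>O(\<epsilon> ^ (n-m))\<close>,
  so \<open>u\<close> and \<open>u powr p\<close> are locally integrable (the latter because \<open>p < p_*\<close>). Apply Duhamel's formula to
  \<open>u \<psi> \<eta>\<close>, where \<open>\<psi>\<close> is a fixed cutoff and \<open>\<eta>\<close> vanishes near \<open>K\<close>, and move all derivatives onto the cutoffs and
  the heat kernel \<open>\<Gamma>\<close>. The terms with derivatives of \<open>\<eta>\<close> are at most
  \<open>O(\<epsilon> ^ -2) o(\<epsilon> ^ -(n-m-2)) O(\<epsilon> ^ (n-m)) = o(1)\<close>, so that off \<open>K\<close>, with convolutions \<open>\<star>\<close>,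
  \<open>u \<psi> = - \<Gamma> \<star> (u powr p \<psi>) + S\<close>, where \<open>S\<close> is a potential of densities supported where \<open>\<psi>\<close> is not locally
  constant. Where \<open>\<psi> = 1\<close> the function \<open>S\<close> is smooth. Hence \<open>u \<le> S\<close> is locally bounded; then
  \<open>\<Gamma> \<star> (u powr p \<psi>)\<close> is continuously differentiable in space, so \<open>u powr p\<close> has continuous space derivatives,
  and therefore \<open>\<Gamma> \<star> (u powr p \<psi>)\<close> is twice continuously differentiable in space and once in time. Since \<open>K\<close> is
  null, the equation, the sign and the uniqueness of local extensions persist across \<open>K\<close> by continuity.
\<close>

text \<open>The exponent p_* = (n-m)/(n-m-2) marks where the singularity stops being integrable:
  near K, u^p is at most d^(-(n-m-2)p), and (n-m-2)p < n-m means p < p_*. Euclidean space-time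
  distance serves although the equation is parabolic, because a time derivative of \<eta> costs only
  \<epsilon>^-1 \<le> \<epsilon>^-2. The growth hypothesis speaks of distances at a fixed time; a
  Lipschitz bound for the family in space-time carries it over to K. The obstacle in the regularity
  part is that the potential \<Gamma> \<star> f of a merely continuous f need not be twice
  differentiable, the second derivatives of \<Gamma> not being locally integrable. So one derivative
  is put on f and one on \<Gamma>, which is why the bootstrap must first reach continuous space
  derivatives of u^p. No time derivative of f is at hand; that of \<Gamma> \<star> f is read off
  from Duhamel's formula for integrals of f over time windows of fixed length, in a form that asks
  for one space derivative only.\<close>

section \<open>Integrals depending on a parameter\<close>

text \<open>Dominated convergence, passed from sequences to a filter. The limit is taken within
  \<open>S\<close> so that a dominating function valid on a small ball suffices; an open ball around
  \<open>a\<close> then drops out of the filter.\<close>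

lemma tendsto_integral_at:
  fixes f :: "'b::first_countable_topology \<Rightarrow> 'a \<Rightarrow> real"
  assumes w: "integrable M w" and m: "\<And>y. y \<in> S \<Longrightarrow> f y \<in> borel_measurable M"
    and g: "g \<in> borel_measurable M"
    and lim: "AE x in M. ((\<lambda>y. f y x) \<longlongrightarrow> g x) (at a within S)"
    and b: "\<And>y. y \<in> S \<Longrightarrow> AE x in M. \<bar>f y x\<bar> \<le> w x"
  shows "((\<lambda>y. \<integral>x. f y x \<partial>M) \<longlongrightarrow> (\<integral>x. g x \<partial>M)) (at a within S)"
  unfolding tendsto_at_iff_sequentially o_def
proof (intro allI impI)
  fix X :: "nat \<Rightarrow> 'b" assume X: "\<forall>i. X i \<in> S - {a}" "X \<longlonglongrightarrow> a"
  show "(\<lambda>i. \<integral>x. f (X i) x \<partial>M) \<longlonglongrightarrow> (\<integral>x. g x \<partial>M)"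
  proof (rule integral_dominated_convergence[OF g _ w])
    show "AE x in M. (\<lambda>i. f (X i) x) \<longlonglongrightarrow> g x"
      using lim by eventually_elim (use X in \<open>auto simp: tendsto_at_iff_sequentially o_def\<close>)
  qed (use X m b in auto)
qed

text \<open>The mean value theorem turns the bound on the derivative into a bound on difference
  quotients, to which dominated convergence applies.\<close>

lemma DERIV_integral:
  fixes f :: "real \<Rightarrow> 'a \<Rightarrow> real"
  assumes r: "r > 0" and w: "integrable M w"
    and i: "\<And>s. \<bar>s\<bar> < r \<Longrightarrow> integrable M (f s)"
    and d: "\<And>s x. \<bar>s\<bar> < r \<Longrightarrow> ((\<lambda>s. f s x) has_real_derivative f' s x) (at s)"
    and b: "\<And>s x. \<bar>s\<bar> < r \<Longrightarrow> \<bar>f' s x\<bar> \<le> w x"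
  shows "((\<lambda>s. \<integral>x. f s x \<partial>M) has_real_derivative (\<integral>x. f' 0 x \<partial>M)) (at 0)"
proof -
  let ?S = "{-r<..<r} - {0}"
  have "at 0 within ?S = at 0 within {-r<..<r}" by (simp add: at_within_def)
  also have "\<dots> = at (0::real)" using r by (intro at_within_open) auto
  finally have S: "at 0 within ?S = at (0::real)" .
  have lim0: "((\<lambda>s. (f s x - f 0 x) / s) \<longlongrightarrow> f' 0 x) (at 0)" for x
    using d[of 0 x] r by (simp add: DERIV_def)
  have q: "\<bar>(f s x - f 0 x) / s\<bar> \<le> w x" if s: "s \<in> ?S" for s x
  proof -
    have "norm (f s x - f 0 x) \<le> w x * norm (s - 0)"
      by (rule field_differentiable_bound[of "{-r<..<r}" _ "\<lambda>s. f' s x"])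
         (use s r in \<open>auto intro!: b has_field_derivative_at_within d\<close>)
    then show ?thesis using s by (auto simp: divide_simps)
  qed
  have m: "(\<lambda>x. (f s x - f 0 x) / s) \<in> borel_measurable M" if "s \<in> ?S" for s
    using i[of s] i[of 0] that r by (auto intro!: borel_measurable_divide borel_measurable_diff borel_measurable_integrable)
  \<comment> \<open>Measurability of \<open>f' 0\<close> is not assumed: it is the pointwise limit
    of difference quotients along a sequence of nonzero steps inside the interval.\<close>
  have mg: "f' 0 \<in> borel_measurable M"
  proof (rule borel_measurable_LIMSEQ_real)
    define X where "X = (\<lambda>n. r / 2 * inverse (real (Suc n)))"
    have X: "X n \<in> ?S" for n
    proof -
      have "x \<in> ?S" if "0 < x" "x \<le> r / 2 * inverse 1" for x using that r by auto
      moreover have "X n \<le> r / 2 * inverse 1"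
        unfolding X_def using r by (intro mult_left_mono le_imp_inverse_le) auto
      moreover have "0 < X n" unfolding X_def using r by (intro mult_pos_pos) auto
      ultimately show ?thesis by blast
    qed
    have X0: "X \<longlonglongrightarrow> 0"
      unfolding X_def by (rule tendsto_mult_right_zero[OF LIMSEQ_inverse_real_of_nat])
    show "(\<lambda>n. (f (X n) x - f 0 x) / X n) \<longlonglongrightarrow> f' 0 x" for x
      using lim0[of x, unfolded tendsto_at_iff_sequentially o_def, rule_format, of X] X X0 by blast
    show "(\<lambda>x. (f (X n) x - f 0 x) / X n) \<in> borel_measurable M" for n
      by (rule m[OF X])
  qed
  have "((\<lambda>s. \<integral>x. (f s x - f 0 x) / s \<partial>M) \<longlongrightarrow> (\<integral>x. f' 0 x \<partial>M)) (at 0 within ?S)"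
    by (rule tendsto_integral_at[OF w m mg]) (use lim0 q S in auto)
  moreover have "\<forall>\<^sub>F s in at 0. (\<integral>x. (f s x - f 0 x) / s \<partial>M) = ((\<integral>x. f s x \<partial>M) - (\<integral>x. f 0 x \<partial>M)) / s"
    unfolding eventually_at using r i
    by (intro exI[of _ r]) (auto simp: Bochner_Integration.integral_diff dist_real_def)
  ultimately show ?thesis unfolding DERIV_def S by (auto elim: Lim_transform_eventually)
qed

section \<open>Directional derivatives\<close>

text \<open>A relation carrying the derivative explicitly, instead of the choice-based
  \<open>pd\<close>, so that sums, products and cutoffs need no side conditions of
  differentiability. Derivatives along lines are all that \<open>C21_on\<close> asks for.\<close>

definition dird :: "'a::real_normed_vector \<Rightarrow> ('a \<Rightarrow> real) \<Rightarrow> ('a \<Rightarrow> real) \<Rightarrow> 'a set \<Rightarrow> bool" where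
  "dird e f f' S \<longleftrightarrow> (\<forall>z\<in>S. ((\<lambda>s. f (z + s *\<^sub>R e)) has_real_derivative f' z) (at 0))"

lemma dird_line:
  assumes "dird e f f' S" "z + t *\<^sub>R e \<in> S"
  shows "((\<lambda>s. f (z + s *\<^sub>R e)) has_real_derivative f' (z + t *\<^sub>R e)) (at t)"
proof -
  have "((\<lambda>s. f (z + t *\<^sub>R e + s *\<^sub>R e)) has_real_derivative f' (z + t *\<^sub>R e)) (at 0)"
    using assms by (simp add: dird_def)
  then show ?thesis using DERIV_shift[of "\<lambda>s. f (z + s *\<^sub>R e)" "f' (z + t *\<^sub>R e)" 0 t]
    by (simp add: algebra_simps)
qed

lemma dird_subset: "dird e f f' S \<Longrightarrow> T \<subseteq> S \<Longrightarrow> dird e f f' T"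
  by (auto simp: dird_def)

lemma dird_mult: "dird e f f' S \<Longrightarrow> dird e g g' S \<Longrightarrow>
    dird e (\<lambda>z. f z * g z) (\<lambda>z. f' z * g z + f z * g' z) S"
  unfolding dird_def by (auto intro!: derivative_eq_intros)

lemma dird_add: "dird e f f' S \<Longrightarrow> dird e g g' S \<Longrightarrow> dird e (\<lambda>z. f z + g z) (\<lambda>z. f' z + g' z) S"
  unfolding dird_def by (auto intro!: derivative_eq_intros)

lemma dird_diff: "dird e f f' S \<Longrightarrow> dird e g g' S \<Longrightarrow> dird e (\<lambda>z. f z - g z) (\<lambda>z. f' z - g' z) S"
  unfolding dird_def by (auto intro!: derivative_eq_intros)

lemma dird_const: "dird e (\<lambda>z. c) (\<lambda>z. 0) S"
  unfolding dird_def by (auto intro!: derivative_eq_intros)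

lemma dird_cmult: "dird e f f' S \<Longrightarrow> dird e (\<lambda>z. c * f z) (\<lambda>z. c * f' z) S"
  unfolding dird_def by (auto intro!: derivative_eq_intros)

lemma dird_sum: "(\<And>i. i \<in> A \<Longrightarrow> dird e (f i) (f' i) S) \<Longrightarrow>
    dird e (\<lambda>z. \<Sum>i\<in>A. f i z) (\<lambda>z. \<Sum>i\<in>A. f' i z) S"
  unfolding dird_def by (auto intro!: DERIV_sum)

lemma dird_chain:
  assumes "dird e f f' S" "\<And>x. DERIV \<phi> x :> \<phi>' x"
  shows "dird e (\<lambda>z. \<phi> (f z)) (\<lambda>z. \<phi>' (f z) * f' z) S"
  unfolding dird_def
proof
  fix z assume "z \<in> S"
  then have "((\<lambda>s. f (z + s *\<^sub>R e)) has_real_derivative f' z) (at 0)" using assms by (auto simp: dird_def)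
  from DERIV_chain2[OF assms(2) this]
  show "((\<lambda>s. \<phi> (f (z + s *\<^sub>R e))) has_real_derivative \<phi>' (f z) * f' z) (at 0)" by simp
qed

lemma eventually_line:
  fixes z :: "'a::real_normed_vector"
  assumes "open S" "z \<in> S"
  shows "\<forall>\<^sub>F s in nhds (0::real). z + s *\<^sub>R e \<in> S"
proof -
  have "((\<lambda>s. z + s *\<^sub>R e) \<longlongrightarrow> z + 0 *\<^sub>R e) (nhds 0)"
    by (intro tendsto_intros filterlim_ident)
  then have "((\<lambda>s. z + s *\<^sub>R e) \<longlongrightarrow> z) (nhds 0)" by simp
  then show ?thesis using assms by (auto dest: topological_tendstoD)
qed

lemma dird_cong:
  assumes "dird e f f' S" "open S" "\<And>z. z \<in> S \<Longrightarrow> f z = g z" "\<And>z. z \<in> S \<Longrightarrow> f' z = g' z"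
  shows "dird e g g' S"
  unfolding dird_def
proof
  fix z assume z: "z \<in> S"
  have "\<forall>\<^sub>F s in nhds (0::real). f (z + s *\<^sub>R e) = g (z + s *\<^sub>R e)"
    using eventually_line[OF assms(2) z] by eventually_elim (use assms in auto)
  then show "((\<lambda>s. g (z + s *\<^sub>R e)) has_real_derivative g' z) (at 0)"
    using assms z DERIV_cong_ev[OF refl, of "\<lambda>s. f (z + s *\<^sub>R e)" "\<lambda>s. g (z + s *\<^sub>R e)" 0 "f' z" "g' z"]
    by (auto simp: dird_def)
qed

lemma dird_unique: "dird e f f' S \<Longrightarrow> dird e f g' S \<Longrightarrow> z \<in> S \<Longrightarrow> f' z = g' z"
  unfolding dird_def by (blast dest: DERIV_unique)

lemma dird_locally_const:
  assumes "dird e f f' S" "open T" "T \<subseteq> S" "\<And>z. z \<in> T \<Longrightarrow> f z = c" "z \<in> T"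
  shows "f' z = 0"
  using dird_unique[OF dird_subset[OF assms(1,3)] dird_cong[OF dird_const[of e c T] assms(2), of f "\<lambda>z. 0"] assms(5)] assms(4)
  by auto

text \<open>The open sets \<open>G\<close> and \<open>- C\<close> cover everything: on the first the
  product rule applies, on the second the product is constantly 0 and \<zeta>' vanishes too. Values
  of \<open>u\<close> and \<open>u'\<close> outside \<open>G\<close> are thus multiplied by
  0.\<close>

lemma dird_mult_cutoff:
  assumes u: "dird e u u' G" and z: "dird e \<zeta> \<zeta>' UNIV" and C: "closed C" "C \<subseteq> G"
    and 0: "\<And>z. z \<notin> C \<Longrightarrow> \<zeta> z = 0"
  shows "dird e (\<lambda>z. u z * \<zeta> z) (\<lambda>z. u' z * \<zeta> z + u z * \<zeta>' z) UNIV"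
proof -
  have 1: "dird e (\<lambda>z. u z * \<zeta> z) (\<lambda>z. u' z * \<zeta> z + u z * \<zeta>' z) G"
    by (intro dird_mult u dird_subset[OF z]) auto
  have "\<zeta>' z = 0" if "z \<in> - C" for z
    by (rule dird_locally_const[OF z, of "- C"]) (use C 0 that in auto)
  then have 2: "dird e (\<lambda>z. u z * \<zeta> z) (\<lambda>z. u' z * \<zeta> z + u z * \<zeta>' z) (- C)"
    by (intro dird_cong[OF dird_const[of e 0]]) (use C 0 in auto)
  from 1 2 show ?thesis using C(2) unfolding dird_def by blast
qed

lemma continuous_mult_cutoff:
  fixes \<zeta> :: "'a::topological_space \<Rightarrow> real"
  assumes u: "continuous_on G u" and z: "continuous_on UNIV \<zeta>" and C: "closed C" "C \<subseteq> G" "open G"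
    and 0: "\<And>z. z \<notin> C \<Longrightarrow> \<zeta> z = 0"
  shows "continuous_on UNIV (\<lambda>z. u z * \<zeta> z)"
proof -
  have "continuous_on G (\<lambda>z. u z * \<zeta> z)"
    by (intro continuous_intros u continuous_on_subset[OF z]) auto
  moreover have "continuous_on (- C) (\<lambda>z. u z * \<zeta> z)"
    by (subst continuous_on_cong[where g="\<lambda>_. 0"]) (use 0 in auto)
  ultimately have "continuous_on (G \<union> - C) (\<lambda>z. u z * \<zeta> z)"
    using C by (intro continuous_on_open_Un) auto
  moreover have "G \<union> - C = UNIV" using C by auto
  ultimately show ?thesis by simp
qed

lemma dird_has_pd:
  assumes "dird e f f' S" "z \<in> S"
  shows "has_pd e f z \<and> pd e f z = f' z"
proof -
  have "((\<lambda>s. f (z + s *\<^sub>R e)) has_vector_derivative f' z) (at 0)"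
    using assms by (simp add: dird_def has_real_derivative_iff_has_vector_derivative)
  then show ?thesis unfolding has_pd_def pd_def
    by (intro conjI differentiableI_vector vector_derivative_at)
qed

lemma has_pd_dird:
  fixes f :: "'a::real_normed_vector \<Rightarrow> real"
  assumes "\<And>z. z \<in> S \<Longrightarrow> has_pd e f z"
  shows "dird e f (pd e f) S"
  unfolding dird_def
proof
  fix z assume "z \<in> S"
  from assms[OF this] show "((\<lambda>s. f (z + s *\<^sub>R e)) has_real_derivative pd e f z) (at 0)"
    by (simp add: has_pd_def pd_def has_real_derivative_iff_has_vector_derivative vector_derivative_works)
qed

lemma C21_onI:
  fixes v :: "(real ^ 'n::finite) \<times> real \<Rightarrow> real"
  assumes S: "open S" and c: "continuous_on S v"
    and t: "dird e_t v vt S" "continuous_on S vt"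
    and x: "\<And>i. dird (e_x i) v (vx i) S" "\<And>i. continuous_on S (vx i)"
    and xx: "\<And>i j. dird (e_x i) (vx j) (vxx i j) S" "\<And>i j. continuous_on S (vxx i j)"
  shows "C21_on S v"
proof -
  have 1: "has_pd e_t v z \<and> pd e_t v z = vt z" if "z \<in> S" for z using dird_has_pd[OF t(1) that] .
  have 2: "has_pd (e_x i) v z \<and> pd (e_x i) v z = vx i z" if "z \<in> S" for z i using dird_has_pd[OF x(1) that] .
  have "dird (e_x i) (pd (e_x j) v) (vxx i j) S" for i j
    by (rule dird_cong[OF xx(1) S]) (use 2 in auto)
  then have 3: "has_pd (e_x i) (pd (e_x j) v) z \<and> pd (e_x i) (pd (e_x j) v) z = vxx i j z" if "z \<in> S" for z i j
    using that by (rule dird_has_pd)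
  have "continuous_on S (pd e_t v)"
    using t(2) by (rule continuous_on_eq) (simp add: 1)
  moreover have "continuous_on S (pd (e_x i) v)" for i
    using x(2)[of i] by (rule continuous_on_eq) (simp add: 2)
  moreover have "continuous_on S (pd (e_x i) (pd (e_x j) v))" for i j
    using xx(2)[of i j] by (rule continuous_on_eq) (simp add: 3)
  ultimately show "C21_on S v" unfolding C21_on_def
    using 1 2 3 c by blast
qed

lemma C21_onD:
  fixes u :: "(real ^ 'n::finite) \<times> real \<Rightarrow> real"
  assumes "C21_on S u"
  shows "continuous_on S u" "dird e_t u (pd e_t u) S" "continuous_on S (pd e_t u)"
    "dird (e_x i) u (pd (e_x i) u) S" "continuous_on S (pd (e_x i) u)"
    "dird (e_x i) (pd (e_x j) u) (pd (e_x i) (pd (e_x j) u)) S" "continuous_on S (pd (e_x i) (pd (e_x j) u))"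
  using assms unfolding C21_on_def by (blast intro: has_pd_dird)+

section \<open>Covering numbers and volumes of tubes\<close>

text \<open>Covering numbers of order \<epsilon>^-d, that is, an upper bound of box-counting type
  for the dimension. Unlike finite Hausdorff measure, this controls the volume of tubes, and it is
  stable under Lipschitz maps and products with intervals. The inequality is multiplied out to avoid
  division.\<close>

definition cov :: "nat \<Rightarrow> 'a::metric_space set \<Rightarrow> bool" where
  "cov d A \<longleftrightarrow> (\<exists>C. \<forall>\<epsilon>. 0 < \<epsilon> \<and> \<epsilon> \<le> 1 \<longrightarrow>
     (\<exists>S. finite S \<and> real (card S) * \<epsilon> ^ d \<le> C \<and> A \<subseteq> (\<Union>c\<in>S. cball c \<epsilon>)))"

lemma cov_subset: "cov d A \<Longrightarrow> B \<subseteq> A \<Longrightarrow> cov d B"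
  unfolding cov_def by (meson subset_trans)

lemma cov_empty: "cov d {}"
  unfolding cov_def by (intro exI[of _ 0] allI impI exI[of _ "{}"]) auto

lemma cov_Un:
  assumes "cov d A" "cov d B"
  shows "cov d (A \<union> B)"
proof -
  from assms(1) obtain C1 where C1: "\<And>\<epsilon>. 0 < \<epsilon> \<Longrightarrow> \<epsilon> \<le> 1 \<Longrightarrow>
     \<exists>S. finite S \<and> real (card S) * \<epsilon> ^ d \<le> C1 \<and> A \<subseteq> (\<Union>c\<in>S. cball c \<epsilon>)" unfolding cov_def by blast
  from assms(2) obtain C2 where C2: "\<And>\<epsilon>. 0 < \<epsilon> \<Longrightarrow> \<epsilon> \<le> 1 \<Longrightarrow>
     \<exists>S. finite S \<and> real (card S) * \<epsilon> ^ d \<le> C2 \<and> B \<subseteq> (\<Union>c\<in>S. cball c \<epsilon>)" unfolding cov_def by blast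
  show ?thesis unfolding cov_def
  proof (intro exI[of _ "C1 + C2"] allI impI)
    fix \<epsilon> :: real assume e: "0 < \<epsilon> \<and> \<epsilon> \<le> 1"
    obtain S where S: "finite S" "real (card S) * \<epsilon> ^ d \<le> C1" "A \<subseteq> (\<Union>c\<in>S. cball c \<epsilon>)" using C1 e by blast
    obtain T where T: "finite T" "real (card T) * \<epsilon> ^ d \<le> C2" "B \<subseteq> (\<Union>c\<in>T. cball c \<epsilon>)" using C2 e by blast
    have "real (card (S \<union> T)) * \<epsilon> ^ d \<le> (real (card S) + real (card T)) * \<epsilon> ^ d"
      using e card_Un_le[of S T] by (intro mult_right_mono) (auto simp flip: of_nat_add)
    then show "\<exists>S. finite S \<and> real (card S) * \<epsilon> ^ d \<le> C1 + C2 \<and> A \<union> B \<subseteq> (\<Union>c\<in>S. cball c \<epsilon>)"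
      using S T by (intro exI[of _ "S \<union> T"]) (auto simp: distrib_right)
  qed
qed

lemma cov_UN: "finite X \<Longrightarrow> (\<And>x. x \<in> X \<Longrightarrow> cov d (A x)) \<Longrightarrow> cov d (\<Union>x\<in>X. A x)"
  by (induction X rule: finite_induct) (auto intro: cov_empty cov_Un)

lemma cov_lipschitz_image:
  assumes A: "cov d A" and L: "\<And>x y. x \<in> A \<Longrightarrow> y \<in> A \<Longrightarrow> dist (f x) (f y) \<le> L * dist x y"
  shows "cov d (f ` A)"
proof -
  from A obtain C where C: "\<And>\<epsilon>. 0 < \<epsilon> \<Longrightarrow> \<epsilon> \<le> 1 \<Longrightarrow>
     \<exists>S. finite S \<and> real (card S) * \<epsilon> ^ d \<le> C \<and> A \<subseteq> (\<Union>c\<in>S. cball c \<epsilon>)" unfolding cov_def by blast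
  \<comment> \<open>\<open>f\<close> is Lipschitz on \<open>A\<close> only, while centres of
    covering balls may lie outside \<open>A\<close>. Replacing each centre by a point of
    \<open>A\<close> in its ball doubles the radius, hence the factor 2. Adding 1 gives M \<ge> 1
    for every \<open>L\<close>, so that \<epsilon> / M is again an admissible radius. For balls that
    miss \<open>A\<close> the chosen point is arbitrary, but they cover nothing.\<close>
  define M where "M = 2 * (\<bar>L\<bar> + 1)"
  have M: "M \<ge> 1" "M > 0" by (auto simp: M_def)
  show ?thesis unfolding cov_def
  proof (intro exI[of _ "C * M ^ d"] allI impI)
    fix \<epsilon> :: real assume e: "0 < \<epsilon> \<and> \<epsilon> \<le> 1"
    then have "0 < \<epsilon> / M" "\<epsilon> / M \<le> 1" using M by (auto simp: divide_simps)
    then obtain S where S: "finite S" "real (card S) * (\<epsilon> / M) ^ d \<le> C" "A \<subseteq> (\<Union>c\<in>S. cball c (\<epsilon> / M))"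
      using C by blast
    define a where "a c = (SOME x. x \<in> A \<and> x \<in> cball c (\<epsilon> / M))" for c
    define T where "T = (\<lambda>c. f (a c)) ` S"
    have "real (card T) * \<epsilon> ^ d \<le> real (card S) * \<epsilon> ^ d"
      unfolding T_def using e card_image_le[OF S(1)] by (intro mult_right_mono) auto
    also have "\<dots> = real (card S) * (\<epsilon> / M) ^ d * M ^ d"
      using M by (simp add: power_divide)
    also have "\<dots> \<le> C * M ^ d" using S(2) M by (intro mult_right_mono) auto
    finally have T: "real (card T) * \<epsilon> ^ d \<le> C * M ^ d" .
    have "f x \<in> (\<Union>c\<in>T. cball c \<epsilon>)" if x: "x \<in> A" for x
    proof -
      obtain c where c: "c \<in> S" "x \<in> cball c (\<epsilon> / M)" using S(3) x by blast
      then have ac: "a c \<in> A" "a c \<in> cball c (\<epsilon> / M)"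
        unfolding a_def using someI_ex[of "\<lambda>x. x \<in> A \<and> x \<in> cball c (\<epsilon> / M)"] x by blast+
      have "dist (a c) x \<le> 2 * (\<epsilon> / M)"
        using c(2) ac(2) dist_triangle[of "a c" x c] by (simp add: dist_commute)
      then have "dist (f (a c)) (f x) \<le> (\<bar>L\<bar> + 1) * (2 * (\<epsilon> / M))"
        by (intro order_trans[OF L[OF ac(1) x]] mult_mono) auto
      also have "\<dots> = \<epsilon>" using M unfolding M_def by (simp add: field_simps)
      finally show ?thesis using c unfolding T_def by auto
    qed
    then show "\<exists>S. finite S \<and> real (card S) * \<epsilon> ^ d \<le> C * M ^ d \<and> f ` A \<subseteq> (\<Union>c\<in>S. cball c \<epsilon>)"
      using T S(1) by (intro exI[of _ T]) (auto simp: T_def)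
  qed
qed

lemma cov_Times_Icc:
  fixes A :: "'a::metric_space set" and a b :: real
  assumes A: "cov d A"
  shows "cov (Suc d) (A \<times> {a..b})"
proof (cases "a \<le> b")
  case False
  then show ?thesis by (simp add: cov_empty)
next
  case ab: True
  from A obtain C where C: "\<And>\<epsilon>. 0 < \<epsilon> \<Longrightarrow> \<epsilon> \<le> 1 \<Longrightarrow>
     \<exists>S. finite S \<and> real (card S) * \<epsilon> ^ d \<le> C \<and> A \<subseteq> (\<Union>c\<in>S. cball c \<epsilon>)" unfolding cov_def by blast
  show ?thesis unfolding cov_def
  \<comment> \<open>Covering \<open>A\<close> at radius \<epsilon>/2 costs the factor 2^d; a time
    grid of mesh \<epsilon>/2 has J + 1 points, and (J + 1) \<epsilon> is at most 2 (b - a) + 2. The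
    two errors \<epsilon>/2 add up to at most \<epsilon> in the product metric.\<close>
  proof (intro exI[of _ "C * 2 ^ d * (2 * (b - a) + 2)"] allI impI)
    fix \<epsilon> :: real assume e: "0 < \<epsilon> \<and> \<epsilon> \<le> 1"
    then obtain S where S: "finite S" "real (card S) * (\<epsilon> / 2) ^ d \<le> C" "A \<subseteq> (\<Union>c\<in>S. cball c (\<epsilon> / 2))"
      using C[of "\<epsilon> / 2"] by auto
    define J where "J = nat \<lfloor>(b - a) / (\<epsilon> / 2)\<rfloor>"
    define T where "T = S \<times> (\<lambda>j. a + real j * (\<epsilon> / 2)) ` {..J}"
    have J: "real J \<le> (b - a) / (\<epsilon> / 2)" unfolding J_def using ab e by simp
    have "card T \<le> card S * (J + 1)" unfolding T_def card_cartesian_product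
      using card_image_le[of "{..J}" "\<lambda>j. a + real j * (\<epsilon> / 2)"] by (intro mult_left_mono) auto
    then have "real (card T) \<le> real (card S) * (real J + 1)"
      by (metis of_nat_1 of_nat_add of_nat_le_iff of_nat_mult)
    then have "real (card T) * \<epsilon> ^ Suc d \<le> real (card S) * (real J + 1) * \<epsilon> ^ Suc d"
      using e by (intro mult_right_mono) auto
    also have "\<dots> = (real (card S) * (\<epsilon> / 2) ^ d * 2 ^ d) * ((real J + 1) * \<epsilon>)"
      by (simp add: power_divide)
    also have "\<dots> \<le> (C * 2 ^ d) * (2 * (b - a) + 2)"
    proof (rule mult_mono)
      have "real J * \<epsilon> \<le> (b - a) / (\<epsilon> / 2) * \<epsilon>" using J e by (intro mult_right_mono) auto
      moreover have "(b - a) / (\<epsilon> / 2) * \<epsilon> = 2 * (b - a)" using e by simp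
      ultimately show "(real J + 1) * \<epsilon> \<le> 2 * (b - a) + 2" using e by (simp add: distrib_right)
      have "0 \<le> C" using S(2) e by (meson divide_nonneg_nonneg mult_nonneg_nonneg of_nat_0_le_iff
          order_trans zero_le_numeral zero_le_power less_imp_le)
      then show "0 \<le> C * 2 ^ d" by simp
    qed (use S(2) e in auto)
    finally have cT: "real (card T) * \<epsilon> ^ Suc d \<le> C * 2 ^ d * (2 * (b - a) + 2)" .
    have "\<exists>c\<in>T. (x, t) \<in> cball c \<epsilon>" if x: "x \<in> A" and t: "a \<le> t" "t \<le> b" for x t
    proof -
      obtain c where c: "c \<in> S" "x \<in> cball c (\<epsilon> / 2)" using S(3) x by blast
      define j where "j = nat \<lfloor>(t - a) / (\<epsilon> / 2)\<rfloor>"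
      have "(t - a) / (\<epsilon> / 2) \<le> (b - a) / (\<epsilon> / 2)" using t e by (intro divide_right_mono) auto
      then have "j \<le> J" unfolding j_def J_def by (intro nat_mono floor_mono)
      have j1: "real j \<le> (t - a) / (\<epsilon> / 2)" unfolding j_def using t e by simp
      have j2: "(t - a) / (\<epsilon> / 2) < real j + 1" unfolding j_def
        using real_of_int_floor_add_one_gt[of "(t - a) / (\<epsilon> / 2)"] t e by simp
      have "real j * (\<epsilon> / 2) \<le> t - a" "t - a < (real j + 1) * (\<epsilon> / 2)"
        using j1 j2 e by (auto simp: field_simps)
      then have "dist (a + real j * (\<epsilon> / 2)) t \<le> \<epsilon> / 2" by (simp add: dist_real_def abs_le_iff algebra_simps)
      moreover have "dist c x \<le> \<epsilon> / 2" using c by simp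
      ultimately have "dist (c, a + real j * (\<epsilon> / 2)) (x, t) \<le> \<epsilon>"
        unfolding dist_Pair_Pair
        using sqrt_sum_squares_le_sum[of "dist c x" "dist (a + real j * (\<epsilon> / 2)) t"] by auto
      then show ?thesis using c \<open>j \<le> J\<close> unfolding T_def by (auto intro!: bexI[of _ "(c, a + real j * (\<epsilon> / 2))"])
    qed
    then have "A \<times> {a..b} \<subseteq> (\<Union>c\<in>T. cball c \<epsilon>)" by auto
    then show "\<exists>S. finite S \<and> real (card S) * \<epsilon> ^ Suc d \<le> C * 2 ^ d * (2 * (b - a) + 2) \<and> A \<times> {a..b} \<subseteq> (\<Union>c\<in>S. cball c \<epsilon>)"
      using cT S(1) by (intro exI[of _ T]) (auto simp: T_def)
  qed
qed

lemma cov_singleton: "cov 0 {x}"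
  unfolding cov_def by (intro exI[of _ 1] allI impI exI[of _ "{x}"]) auto

text \<open>Each additional free coordinate exhibits the box as a Lipschitz image of a product with
  an interval, which raises the exponent by one.\<close>

lemma cov_slice:
  fixes K :: "'n::finite set"
  shows "cov (card K) {y :: real ^ 'n. (\<forall>i. i \<notin> K \<longrightarrow> y $ i = 0) \<and> (\<forall>i. \<bar>y $ i\<bar> \<le> r)}"
proof -
  have "finite K" by simp
  then show ?thesis
  proof (induction K rule: finite_induct)
    case empty
    show ?case by (rule cov_subset[of _ "{0}"]) (auto simp: vec_eq_iff cov_singleton)
  next
    case (insert i K)
    let ?A = "{y :: real ^ 'n. (\<forall>i. i \<notin> K \<longrightarrow> y $ i = 0) \<and> (\<forall>i. \<bar>y $ i\<bar> \<le> r)}"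
    let ?f = "\<lambda>(y, t). y + t *\<^sub>R axis i 1 :: real ^ 'n"
    have ax: "dist (t *\<^sub>R axis i 1) (s *\<^sub>R axis i 1 :: real ^ 'n) = dist t s" for t s
      by (simp add: dist_norm flip: scaleR_diff_left)
    have 1: "dist (?f x) (?f y) \<le> 2 * dist x y" for x y
    proof -
      have "dist (?f x) (?f y) \<le> dist (fst x) (fst y) + dist (snd x) (snd y)"
        using dist_triangle_add[of "fst x" "snd x *\<^sub>R axis i 1" "fst y" "snd y *\<^sub>R axis i 1"]
        by (simp add: ax[unfolded dist_real_def] dist_real_def case_prod_beta)
      also have "\<dots> \<le> 2 * dist x y" using dist_fst_le[of x y] dist_snd_le[of x y] by simp
      finally show ?thesis .
    qed
    have "cov (Suc (card K)) (?f ` (?A \<times> {-r..r}))"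
      by (rule cov_lipschitz_image[OF cov_Times_Icc[OF insert.IH] 1])
    moreover have "{y :: real ^ 'n. (\<forall>j. j \<notin> insert i K \<longrightarrow> y $ j = 0) \<and> (\<forall>i. \<bar>y $ i\<bar> \<le> r)} \<subseteq> ?f ` (?A \<times> {-r..r})"
    proof
      fix y :: "real ^ 'n" assume y: "y \<in> {y. (\<forall>j. j \<notin> insert i K \<longrightarrow> y $ j = 0) \<and> (\<forall>i. \<bar>y $ i\<bar> \<le> r)}"
      then have r: "0 \<le> r" by (auto intro: order_trans[OF abs_ge_zero])
      have "y = ?f (y - (y $ i) *\<^sub>R axis i 1, y $ i)" by simp
      moreover have "y - (y $ i) *\<^sub>R axis i 1 \<in> ?A"
        using y r insert.hyps by (auto simp: axis_def)
      moreover have "y $ i \<in> {-r..r}" using y by (auto simp: abs_le_iff minus_le_iff)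
      ultimately show "y \<in> ?f ` (?A \<times> {-r..r})" by (metis (no_types, lifting) SigmaI image_eqI)
    qed
    ultimately show ?case using insert.hyps by (auto intro: cov_subset)
  qed
qed

text \<open>Balls of a cover at scale \<epsilon> are enlarged threefold. The infimum in the distance
  need not be attained, so a point of \<open>A\<close> closer than 2 \<epsilon> is used, and one
  more \<epsilon> reaches the centre of its ball.\<close>

lemma tube_volume:
  fixes A :: "'a::euclidean_space set"
  assumes A: "cov d A" and d: "d \<le> DIM('a)" and ne: "A \<noteq> {}"
  obtains C where "C \<ge> 0" "\<And>\<epsilon>. 0 < \<epsilon> \<Longrightarrow> \<epsilon> \<le> 1 \<Longrightarrow>
    emeasure lborel {z. infdist z A \<le> \<epsilon>} \<le> ennreal (C * \<epsilon> ^ (DIM('a) - d))"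
proof -
  from A obtain C where C: "\<And>\<epsilon>. 0 < \<epsilon> \<Longrightarrow> \<epsilon> \<le> 1 \<Longrightarrow>
     \<exists>S. finite S \<and> real (card S) * \<epsilon> ^ d \<le> C \<and> A \<subseteq> (\<Union>c\<in>S. cball c \<epsilon>)" unfolding cov_def by blast
  let ?N = "DIM('a)"
  define V where "V = unit_ball_vol (real ?N) * 3 ^ ?N"
  have V: "V \<ge> 0" unfolding V_def by simp
  have "0 \<le> C" using C[of 1] by (auto intro: order_trans[of 0])
  show thesis
  proof (rule that[of "C * V"])
    show "0 \<le> C * V" using V \<open>0 \<le> C\<close> by simp
    fix \<epsilon> :: real assume e: "0 < \<epsilon>" "\<epsilon> \<le> 1"
    obtain S where S: "finite S" "real (card S) * \<epsilon> ^ d \<le> C" "A \<subseteq> (\<Union>c\<in>S. cball c \<epsilon>)" using C e by blast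
    have "{z. infdist z A \<le> \<epsilon>} \<subseteq> (\<Union>c\<in>S. cball c (3 * \<epsilon>))"
    proof
      fix z assume "z \<in> {z. infdist z A \<le> \<epsilon>}"
      then have "infdist z A < 2 * \<epsilon>" using e by simp
      then obtain a where a: "a \<in> A" "dist z a < 2 * \<epsilon>"
        using ne cINF_less_iff[of A "dist z" "2 * \<epsilon>"] by (auto simp: infdist_notempty)
      then obtain c where c: "c \<in> S" "dist c a \<le> \<epsilon>" using S(3) by auto
      then have "dist c z \<le> 3 * \<epsilon>" using a dist_triangle[of c z a] by (simp add: dist_commute)
      then show "z \<in> (\<Union>c\<in>S. cball c (3 * \<epsilon>))" using c by auto
    qed
    then have "emeasure lborel {z. infdist z A \<le> \<epsilon>} \<le> emeasure lborel (\<Union>c\<in>S. cball c (3 * \<epsilon>))"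
      using S(1) by (intro emeasure_mono) (auto intro!: borel_closed closed_UN)
    also have "\<dots> \<le> (\<Sum>c\<in>S. emeasure lborel (cball c (3 * \<epsilon>)))"
      using S(1) by (intro emeasure_subadditive_finite) auto
    also have "\<dots> = (\<Sum>c\<in>S. ennreal (V * \<epsilon> ^ ?N))"
      using e by (simp add: emeasure_cball V_def power_mult_distrib mult.assoc)
    also have "\<dots> = ennreal (real (card S) * (V * \<epsilon> ^ ?N))"
      using V e by (simp add: ennreal_mult ennreal_of_nat_eq_real_of_nat)
    also have "\<dots> \<le> ennreal (C * V * \<epsilon> ^ (?N - d))"
    proof (rule ennreal_leI)
      have "\<epsilon> ^ ?N = \<epsilon> ^ d * \<epsilon> ^ (?N - d)" using d by (simp flip: power_add)
      then have "real (card S) * (V * \<epsilon> ^ ?N) = (real (card S) * \<epsilon> ^ d) * (V * \<epsilon> ^ (?N - d))" by simp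
      also have "\<dots> \<le> C * (V * \<epsilon> ^ (?N - d))" using S(2) V e by (intro mult_right_mono) auto
      finally show "real (card S) * (V * \<epsilon> ^ ?N) \<le> C * V * \<epsilon> ^ (?N - d)" by (simp add: mult.assoc)
    qed
    finally show "emeasure lborel {z. infdist z A \<le> \<epsilon>} \<le> ennreal (C * V * \<epsilon> ^ (?N - d))" .
  qed
qed

lemma cov_null_sets:
  fixes A :: "'a::euclidean_space set"
  assumes A: "cov d A" and d: "d < DIM('a)" and cl: "closed A"
  shows "A \<in> null_sets lborel"
proof (cases "A = {}")
  case ne: False
  obtain C where C: "C \<ge> 0" "\<And>\<epsilon>. 0 < \<epsilon> \<Longrightarrow> \<epsilon> \<le> 1 \<Longrightarrow>
    emeasure lborel {z. infdist z A \<le> \<epsilon>} \<le> ennreal (C * \<epsilon> ^ (DIM('a) - d))"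
    using tube_volume[OF A less_imp_le[OF d] ne] by blast
  have X0: "(\<lambda>n. inverse (real (Suc n))) \<longlonglongrightarrow> 0" by (rule LIMSEQ_inverse_real_of_nat)
  have "(\<lambda>n. ennreal (C * inverse (real (Suc n)) ^ (DIM('a) - d))) \<longlonglongrightarrow> ennreal (C * 0 ^ (DIM('a) - d))"
    by (intro tendsto_ennrealI tendsto_intros X0)
  then have lim: "(\<lambda>n. ennreal (C * inverse (real (Suc n)) ^ (DIM('a) - d))) \<longlonglongrightarrow> 0" using d by (simp add: power_0_left)
  have "emeasure lborel A \<le> ennreal (C * inverse (real (Suc n)) ^ (DIM('a) - d))" for n
  proof -
    have "emeasure lborel A \<le> emeasure lborel {z. infdist z A \<le> inverse (real (Suc n))}"
    proof (rule emeasure_mono)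
      have "0 \<le> inverse (real (Suc n))" by simp
      then show "A \<subseteq> {z. infdist z A \<le> inverse (real (Suc n))}" by (metis (no_types, lifting) infdist_zero mem_Collect_eq subsetI)
      have "closed {z. infdist z A \<le> inverse (real (Suc n))}"
        by (intro closed_Collect_le continuous_intros)
      then show "{z. infdist z A \<le> inverse (real (Suc n))} \<in> sets lborel" by simp
    qed
    also have "\<dots> \<le> ennreal (C * inverse (real (Suc n)) ^ (DIM('a) - d))"
      by (rule C(2)) (auto simp: inverse_le_1_iff)
    finally show ?thesis .
  qed
  then have "emeasure lborel A \<le> 0" using LIMSEQ_le_const[OF lim] by blast
  then show ?thesis using cl by (auto simp: null_sets_def)
qed auto

text \<open>Dyadic layers: where the distance is about 2^-k the integrand is at most 2^((k+1)q), on
  a set of volume O(2^(-k(N-d))) with N = \<open>DIM('a)\<close>. The sum is a geometric series of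
  ratio 2^(q-(N-d)) < 1.\<close>

lemma integrable_infdist_powr:
  fixes A :: "'a::euclidean_space set"
  assumes A: "cov d A" and d: "d < DIM('a)" and ne: "A \<noteq> {}" and q: "0 \<le> q" "q < real (DIM('a) - d)"
  shows "integrable lborel (\<lambda>z. indicator (cball 0 R) z * infdist z A powr (- q))"
proof (rule integrableI_bounded)
  show "(\<lambda>z. indicator (cball 0 R) z * infdist z A powr (- q)) \<in> borel_measurable lborel"
  proof -
    have [measurable]: "(\<lambda>z. infdist z A) \<in> borel_measurable borel" "cball 0 R \<in> sets borel"
      by (auto intro!: borel_measurable_continuous_onI continuous_intros)
    show ?thesis by measurable
  qed
  obtain C where C: "C \<ge> 0" "\<And>\<epsilon>. 0 < \<epsilon> \<Longrightarrow> \<epsilon> \<le> 1 \<Longrightarrow>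
    emeasure lborel {z. infdist z A \<le> \<epsilon>} \<le> ennreal (C * \<epsilon> ^ (DIM('a) - d))"
    using tube_volume[OF A less_imp_le[OF d] ne] by blast
  define T where "T k = {z. infdist z A \<le> (1/2) ^ k}" for k :: nat
  have Tm: "T k \<in> sets lborel" for k
  proof -
    have "closed (T k)" unfolding T_def by (intro closed_Collect_le continuous_intros)
    then show ?thesis by simp
  qed
  define a where "a k = 2 powr (real (Suc k) * q)" for k
  have pt: "ennreal (norm (indicator (cball 0 R) z * infdist z A powr (- q)))
      \<le> indicator (cball 0 R) z + (\<Sum>k. ennreal (a k) * indicator (T k) z)" for z
  \<comment> \<open>On the zero set of the distance \<open>0 powr (- q)\<close> is 0, so nothing has
    to be bounded there; at distances above 1 the power is at most 1 and the first summand
    suffices.\<close>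
  proof (cases "infdist z A = 0 \<or> 1 < infdist z A \<or> z \<notin> cball 0 R")
    case True
    have "ennreal (norm (indicator (cball 0 R) z * infdist z A powr (- q))) \<le> indicator (cball 0 R) z"
      using True q powr_mono2'[of "-q" 1 "infdist z A"] by (auto simp: indicator_def intro!: ennreal_leI split: if_splits)
    then show ?thesis by (simp add: add_increasing2)
  next
    case False
    define D where "D = infdist z A"
    have D: "0 < D" "D \<le> 1" using False infdist_nonneg[of z A] unfolding D_def by auto
    \<comment> \<open>The \<open>Suc\<close> yields (1/2)^Suc k < D \<le> (1/2)^k by minimality, the
      upper bound for k = 0 being D \<le> 1.\<close>
    define k where "k = (LEAST k. (1/2)^Suc k < D)"
    have "\<exists>k. (1/2)^k < D" using real_arch_pow_inv[OF D(1), of "1/2"] by auto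
    then have "\<exists>k. (1/2::real)^Suc k < D"
      by (metis (no_types, opaque_lifting) D(2) not_less power_0 power_one_over less_le_trans not0_implies_Suc order_less_irrefl)
    then have k1: "(1/2)^Suc k < D" unfolding k_def by (rule LeastI_ex)
    have k2: "D \<le> (1/2)^k"
    proof (cases k)
      case (Suc j)
      then show ?thesis using not_less_Least[of j "\<lambda>k. (1/2)^Suc k < D"] unfolding k_def[symmetric] by (simp add: not_less)
    qed (use D in simp)
    have "D powr (- q) \<le> ((1/2)^Suc k) powr (- q)"
      using k1 q by (intro powr_mono2') auto
    also have "\<dots> = a k"
    proof -
      have "((1/2::real)^Suc k) = 2 powr (- real (Suc k))"
        by (simp only: powr_minus powr_realpow[of 2] zero_less_numeral power_one_over inverse_eq_divide)
      then show ?thesis unfolding a_def by (simp only: powr_powr) (simp add: algebra_simps)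
    qed
    finally have "ennreal (norm (indicator (cball 0 R) z * infdist z A powr (- q))) \<le> ennreal (a k) * indicator (T k) z"
      using k2 unfolding T_def D_def by (auto simp: indicator_def intro!: ennreal_leI)
    also have "\<dots> \<le> (\<Sum>k. ennreal (a k) * indicator (T k) z)"
    proof -
      have "f k \<le> suminf f" for f :: "nat \<Rightarrow> ennreal" using sum_le_suminf[of f "{k}"] by simp
      then show ?thesis .
    qed
    finally show ?thesis by (simp add: add_increasing)
  qed
  define x where "x = 2 powr (q - real (DIM('a) - d))"
  have x: "0 \<le> x" "x < 1" unfolding x_def using q powr_less_one[of 2 "q - real (DIM('a) - d)"] by auto
  have "(\<integral>\<^sup>+z. ennreal (norm (indicator (cball 0 R) z * infdist z A powr (- q))) \<partial>lborel)
     \<le> (\<integral>\<^sup>+z. indicator (cball 0 R) z + (\<Sum>k. ennreal (a k) * indicator (T k) z) \<partial>(lborel::'a measure))"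
    by (intro nn_integral_mono pt)
  also have "\<dots> = emeasure lborel (cball 0 R :: 'a set) + (\<Sum>k. ennreal (a k) * emeasure lborel (T k))"
  proof -
    have [measurable]: "T k \<in> sets borel" "cball 0 R \<in> sets (borel :: 'a measure)" for k using Tm by auto
    have "(\<integral>\<^sup>+z. indicator (cball 0 R) z + (\<Sum>k. ennreal (a k) * indicator (T k) z) \<partial>(lborel::'a measure))
      = (\<integral>\<^sup>+z. indicator (cball 0 R) z \<partial>(lborel::'a measure)) + (\<integral>\<^sup>+z. (\<Sum>k. ennreal (a k) * indicator (T k) z) \<partial>(lborel::'a measure))"
      by (rule nn_integral_add) measurable
    also have "(\<integral>\<^sup>+z. (\<Sum>k. ennreal (a k) * indicator (T k) z) \<partial>(lborel::'a measure)) = (\<Sum>k. \<integral>\<^sup>+z. ennreal (a k) * indicator (T k) z \<partial>lborel)"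
      by (rule nn_integral_suminf) measurable
    finally show ?thesis using Tm by (simp add: nn_integral_cmult_indicator)
  qed
  also have "\<dots> \<le> emeasure lborel (cball 0 R :: 'a set) + (\<Sum>k. ennreal (2 powr q * C * x ^ k))"
  proof (intro add_left_mono suminf_le allI)
    fix k
    have "emeasure lborel (T k) \<le> ennreal (C * ((1/2) ^ k) ^ (DIM('a) - d))"
      unfolding T_def by (rule C(2)) (auto simp: power_le_one)
    then have "ennreal (a k) * emeasure lborel (T k) \<le> ennreal (a k) * ennreal (C * ((1/2) ^ k) ^ (DIM('a) - d))"
      by (intro mult_left_mono) auto
    also have "\<dots> = ennreal (a k * (C * ((1/2) ^ k) ^ (DIM('a) - d)))"
      using C(1) by (intro ennreal_mult[symmetric]) (auto simp: a_def)
    also have "a k * (C * ((1/2) ^ k) ^ (DIM('a) - d)) = 2 powr q * C * x ^ k"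
    proof -
      have 1: "((1/2::real) ^ k) ^ (DIM('a) - d) = 2 powr (- real k * real (DIM('a) - d))"
      proof -
        have "((1/2::real) ^ k) ^ (DIM('a) - d) = (1/2) ^ (k * (DIM('a) - d))" by (simp only: power_mult)
        also have "\<dots> = 2 powr (- real (k * (DIM('a) - d)))"
          by (simp only: powr_minus powr_realpow[of 2] zero_less_numeral power_one_over inverse_eq_divide)
        finally show ?thesis by (simp only: of_nat_mult mult_minus_left)
      qed
      have 2: "x ^ k = 2 powr (real k * (q - real (DIM('a) - d)))"
        unfolding x_def by (simp add: powr_powr mult.commute powr_power)
      have 3: "a k * 2 powr (- real k * real (DIM('a) - d)) = 2 powr q * x ^ k"
        unfolding 2 a_def by (simp add: algebra_simps flip: powr_add)
      show ?thesis unfolding 1 using arg_cong[OF 3, of "\<lambda>y. C * y"] by (simp only: mult_ac)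
    qed
    finally show "ennreal (a k) * emeasure lborel (T k) \<le> ennreal (2 powr q * C * x ^ k)" .
  qed auto
  also have "\<dots> < \<infinity>"
  proof -
    have "summable (\<lambda>k. 2 powr q * C * x ^ k)" using x by (intro summable_mult summable_geometric) auto
    then have "(\<Sum>k. ennreal (2 powr q * C * x ^ k)) = ennreal (\<Sum>k. 2 powr q * C * x ^ k)"
      using x C(1) by (intro suminf_ennreal2) auto
    moreover have "emeasure lborel (cball 0 R :: 'a set) < \<infinity>" by (rule emeasure_bounded_finite) simp
    ultimately show ?thesis by (simp add: ennreal_add_less_top)
  qed
  finally show "(\<integral>\<^sup>+z. ennreal (norm (indicator (cball 0 R) z * infdist z A powr (- q))) \<partial>lborel) < \<infinity>" .
qed

section \<open>Reflection and translation of integrals\<close>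

lemma lborel_distr_reflect: "distr lborel borel (\<lambda>w. z - w) = (lborel :: 'a::euclidean_space measure)"
  using lborel_affine[of "-1" z] by (simp add: density_1)

lemma
  fixes f :: "'a::euclidean_space \<Rightarrow> real"
  assumes [measurable]: "f \<in> borel_measurable borel"
  shows integral_reflect: "(\<integral>w. f (z - w) \<partial>lborel) = (\<integral>w. f w \<partial>lborel)"
    and integrable_reflect: "integrable lborel (\<lambda>w. f (z - w)) \<longleftrightarrow> integrable lborel f"
proof -
  have m: "(\<lambda>w. z - w) \<in> measurable lborel borel" by simp
  show "(\<integral>w. f (z - w) \<partial>lborel) = (\<integral>w. f w \<partial>lborel)"
    using integral_distr[OF m, of f] unfolding lborel_distr_reflect by simp
  show "integrable lborel (\<lambda>w. f (z - w)) \<longleftrightarrow> integrable lborel f"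
    using integrable_distr_eq[OF m, of f] unfolding lborel_distr_reflect by simp
qed

lemma
  fixes f :: "'a::euclidean_space \<Rightarrow> real"
  assumes [measurable]: "f \<in> borel_measurable borel"
  shows integral_translate: "(\<integral>w. f (w + a) \<partial>lborel) = (\<integral>w. f w \<partial>lborel)"
    and integrable_translate: "integrable lborel (\<lambda>w. f (w + a)) \<longleftrightarrow> integrable lborel f"
proof -
  have m: "(\<lambda>w. a + w) \<in> measurable lborel borel" by simp
  show "(\<integral>w. f (w + a) \<partial>lborel) = (\<integral>w. f w \<partial>lborel)"
    using integral_distr[OF m, of f] unfolding lborel_distr_plus by (simp add: add.commute)
  show "integrable lborel (\<lambda>w. f (w + a)) \<longleftrightarrow> integrable lborel f"
    using integrable_distr_eq[OF m, of f] unfolding lborel_distr_plus by (simp add: add.commute)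
qed

lemma integrable_cball_indicator:
  "integrable lborel (\<lambda>w::'a::euclidean_space. B * indicator (cball a R) w :: real)"
  by (intro integrable_mult_right integrable_real_indicator emeasure_bounded_finite) auto

lemma integrable_bounded_supp:
  fixes f :: "'a::euclidean_space \<Rightarrow> real"
  assumes "f \<in> borel_measurable borel" "\<And>w. \<bar>f w\<bar> \<le> B * indicator (cball a R) w"
  shows "integrable lborel f"
proof (rule Bochner_Integration.integrable_bound[OF integrable_cball_indicator[of B a R]])
  show "AE w in lborel. norm (f w) \<le> norm (B * indicator (cball a R) w)"
    by (intro AE_I2) (metis assms(2) abs_ge_self order_trans real_norm_def)
qed (use assms in simp)

section \<open>Cutoff functions\<close>

text \<open>A power at least 2 of the positive part has derivative 0 at the origin. Applied twice,
  this makes the cube of the positive part twice continuously differentiable.\<close>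

lemma DERIV_max_power:
  "DERIV (\<lambda>x::real. max 0 x ^ Suc (Suc k)) x :> real (Suc (Suc k)) * max 0 x ^ Suc k"
proof -
  consider "x > 0" | "x < 0" | "x = 0" by linarith
  then show ?thesis
  proof cases
    case 1
    have "\<forall>\<^sub>F y in nhds x. max 0 y ^ Suc (Suc k) = y ^ Suc (Suc k)"
      using eventually_nhds_in_open[of "{0<..}" x] 1 by (auto elim!: eventually_mono simp: max_def)
    moreover have "DERIV (\<lambda>y. y ^ Suc (Suc k)) x :> real (Suc (Suc k)) * max 0 x ^ Suc k"
      using DERIV_pow[of "Suc (Suc k)" x] 1 by (simp del: of_nat_Suc power_Suc)
    ultimately show ?thesis by (rule iffD2[OF DERIV_cong_ev[OF refl _ refl]])
  next
    case 2
    have "\<forall>\<^sub>F y in nhds x. max 0 y ^ Suc (Suc k) = 0"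
      using eventually_nhds_in_open[of "{..<0}" x] 2 by (auto elim!: eventually_mono simp: max_def)
    moreover have "DERIV (\<lambda>y. 0) x :> real (Suc (Suc k)) * max 0 x ^ Suc k" using 2 by simp
    ultimately show ?thesis by (rule iffD2[OF DERIV_cong_ev[OF refl _ refl]])
  next
    case 3
    have "(\<lambda>h::real. max 0 h ^ Suc (Suc k) / h) \<midarrow>0\<rightarrow> 0"
    proof (rule Lim_null_comparison)
      show "\<forall>\<^sub>F h::real in at 0. norm (max 0 h ^ Suc (Suc k) / h) \<le> \<bar>h\<bar> ^ Suc k"
      proof (intro always_eventually allI)
        fix h :: real
        show "norm (max 0 h ^ Suc (Suc k) / h) \<le> \<bar>h\<bar> ^ Suc k"
        proof (cases "h \<le> 0")
          case True
          then have "norm (max 0 h ^ Suc (Suc k) / h) = 0" by simp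
          then show ?thesis using zero_le_power[of "\<bar>h\<bar>" "Suc k"] by linarith
        qed (simp add: max_def)
      qed
      have "((\<lambda>h. \<bar>h\<bar> ^ Suc k) \<longlongrightarrow> \<bar>0::real\<bar> ^ Suc k) (at 0)" by (intro tendsto_intros)
      then show "((\<lambda>h. \<bar>h\<bar> ^ Suc k) \<longlongrightarrow> (0::real)) (at 0)" by simp
    qed
    then show ?thesis using 3 by (simp add: DERIV_def)
  qed
qed

locale mollifier =
  fixes E :: "'a::euclidean_space set" and \<epsilon> :: real
  assumes E[measurable]: "E \<in> sets borel" and \<epsilon>: "\<epsilon> > 0"
begin

definition moll :: "('a \<Rightarrow> real) \<Rightarrow> 'a \<Rightarrow> real" where
  "moll k z = (\<integral>w. k (z - w) * indicator E w \<partial>lborel)"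

context
  fixes k :: "'a \<Rightarrow> real" and B :: real
  assumes kc: "continuous_on UNIV k" and kb: "\<And>w. \<bar>k w\<bar> \<le> B" and k0: "\<And>w. norm w > \<epsilon> \<Longrightarrow> k w = 0"
begin

lemma kernel_measurable[measurable]: "k \<in> borel_measurable borel"
  by (rule borel_measurable_continuous_onI[OF kc])

lemma B_nonneg: "0 \<le> B" using kb[of 0] abs_ge_zero order_trans by blast

lemma moll_dominated:
  assumes "dist z z' \<le> r"
  shows "\<bar>k (z' - w) * indicator E w\<bar> \<le> B * indicator (cball z (\<epsilon> + r)) w"
proof (cases "norm (z' - w) > \<epsilon>")
  case False
  then have "dist z w \<le> \<epsilon> + r" using dist_triangle[of z w z'] assms by (simp add: dist_norm)
  then show ?thesis using kb[of "z' - w"] B_nonneg by (auto simp: indicator_def)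
qed (use k0 B_nonneg in auto)

lemma moll_integrable: "integrable lborel (\<lambda>w. k (z - w) * indicator E w)"
  by (rule integrable_bounded_supp[of _ B z "\<epsilon> + 0"]) (measurable, rule moll_dominated, simp)

lemma moll_bound: "\<bar>moll k z\<bar> \<le> B * (unit_ball_vol (real DIM('a)) * \<epsilon> ^ DIM('a))"
proof -
  have "\<bar>moll k z\<bar> \<le> (\<integral>w. \<bar>k (z - w) * indicator E w\<bar> \<partial>lborel)"
    unfolding moll_def using integral_norm_bound[of lborel "\<lambda>w. k (z - w) * indicator E w"] by simp
  also have "\<dots> \<le> (\<integral>w. B * indicator (cball z (\<epsilon> + 0)) w \<partial>lborel)"
    by (intro integral_mono integrable_abs moll_integrable integrable_cball_indicator moll_dominated) simp
  also have "\<dots> = B * (unit_ball_vol (real DIM('a)) * \<epsilon> ^ DIM('a))"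
    using \<epsilon> by (simp add: content_cball)
  finally show ?thesis .
qed

lemma moll_continuous: "continuous_on UNIV (moll k)"
  unfolding continuous_on_eq_continuous_at[OF open_UNIV]
proof
  fix z
  have "((\<lambda>z. moll k z) \<longlongrightarrow> moll k z) (at z within ball z 1)"
    unfolding moll_def
  proof (rule tendsto_integral_at[OF integrable_cball_indicator[of B z "\<epsilon> + 1"]])
    show "AE w in lborel. ((\<lambda>y. k (y - w) * indicator E w) \<longlongrightarrow> k (z - w) * indicator E w) (at z within ball z 1)"
    proof (intro AE_I2 tendsto_mult_right)
      fix w
      have "((\<lambda>y. y - w) \<longlongrightarrow> z - w) (at z within ball z 1)" by (intro tendsto_intros)
      moreover have "isCont k (z - w)" using kc by (simp add: continuous_on_eq_continuous_at)
      ultimately show "((\<lambda>y. k (y - w)) \<longlongrightarrow> k (z - w)) (at z within ball z 1)"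
        by (rule isCont_tendsto_compose[rotated])
    qed
    show "AE w in lborel. \<bar>k (y - w) * indicator E w\<bar> \<le> B * indicator (cball z (\<epsilon> + 1)) w" if "y \<in> ball z 1" for y
      using that by (intro AE_I2 moll_dominated) (auto simp: less_imp_le)
  qed auto
  moreover have "at z within ball z 1 = at z" by (rule at_within_open) auto
  ultimately show "isCont (moll k) z" by (simp only: isCont_def)
qed

lemma moll_dird:
  assumes g: "dird v g k UNIV" and gc: "continuous_on UNIV g" and gb: "\<And>w. \<bar>g w\<bar> \<le> B'"
    and g0: "\<And>w. norm w > \<epsilon> \<Longrightarrow> g w = 0"
    and gi: "\<And>z. integrable lborel (\<lambda>w. g (z - w) * indicator E w)"
  shows "dird v (moll g) (moll k) UNIV"
  unfolding dird_def
proof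
  fix z
  let ?f' = "\<lambda>s w. k (z + s *\<^sub>R v - w) * indicator E w"
  have "((\<lambda>s. \<integral>w. g (z + s *\<^sub>R v - w) * indicator E w \<partial>lborel) has_real_derivative (\<integral>w. ?f' 0 w \<partial>lborel)) (at 0)"
  proof (rule DERIV_integral[where r="1 / (norm v + 1)" and w="\<lambda>w. B * indicator (cball z (\<epsilon> + 1)) w"])
    show "0 < 1 / (norm v + 1)" by (simp add: add_nonneg_pos)
    fix s :: real assume s: "\<bar>s\<bar> < 1 / (norm v + 1)"
    show "integrable lborel (\<lambda>w. g (z + s *\<^sub>R v - w) * indicator E w)" by (rule gi)
    fix w
    have "((\<lambda>s. g ((z - w) + s *\<^sub>R v)) has_real_derivative k ((z - w) + s *\<^sub>R v)) (at s)"
      by (rule dird_line[OF g]) simp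
    then show "((\<lambda>s. g (z + s *\<^sub>R v - w) * indicator E w) has_real_derivative ?f' s w) (at s)"
      by (intro DERIV_cmult_right) (simp add: algebra_simps)
    have "\<bar>s\<bar> * norm v \<le> \<bar>s\<bar> * (norm v + 1)" by (intro mult_left_mono) auto
    also have "\<dots> < 1" using s pos_less_divide_eq[of "norm v + 1" "\<bar>s\<bar>" 1] by (simp add: add_nonneg_pos)
    finally have "dist z (z + s *\<^sub>R v) \<le> 1" by (simp add: dist_norm)
    then show "\<bar>?f' s w\<bar> \<le> B * indicator (cball z (\<epsilon> + 1)) w" by (rule moll_dominated)
  qed (rule integrable_cball_indicator)
  then show "((\<lambda>s. moll g (z + s *\<^sub>R v)) has_real_derivative moll k z) (at 0)"
    by (simp add: moll_def)
qed

end

text \<open>The cube is the smallest integer power of the positive part of 1 - |w|^2/\<epsilon>^2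
  that is twice continuously differentiable, which is what two derivatives of a cutoff require.
  \<open>\<rho>1\<close> and \<open>\<rho>2\<close> are its first and second directional
  derivatives.\<close>

definition \<rho> :: "'a \<Rightarrow> real" where "\<rho> w = max 0 (1 - (w \<bullet> w) / \<epsilon>\<^sup>2) ^ 3"
definition \<rho>1 :: "'a \<Rightarrow> 'a \<Rightarrow> real" where
  "\<rho>1 v w = 3 * max 0 (1 - (w \<bullet> w) / \<epsilon>\<^sup>2) ^ 2 * (- 2 * (w \<bullet> v) / \<epsilon>\<^sup>2)"
definition \<rho>2 :: "'a \<Rightarrow> 'a \<Rightarrow> 'a \<Rightarrow> real" where
  "\<rho>2 v' v w = 6 * max 0 (1 - (w \<bullet> w) / \<epsilon>\<^sup>2) * (- 2 * (w \<bullet> v') / \<epsilon>\<^sup>2) * (- 2 * (w \<bullet> v) / \<epsilon>\<^sup>2)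
     + 3 * max 0 (1 - (w \<bullet> w) / \<epsilon>\<^sup>2) ^ 2 * (- 2 * (v' \<bullet> v) / \<epsilon>\<^sup>2)"

lemma inner_dird: "dird v (\<lambda>w::'a. 1 - (w \<bullet> w) / \<epsilon>\<^sup>2) (\<lambda>w. - 2 * (w \<bullet> v) / \<epsilon>\<^sup>2) UNIV"
  unfolding dird_def
  using \<epsilon> by (auto intro!: derivative_eq_intros simp: inner_add_left inner_add_right inner_commute field_simps)

lemma inner_dird2: "dird v' (\<lambda>w::'a. - 2 * (w \<bullet> v) / \<epsilon>\<^sup>2) (\<lambda>w. - 2 * (v' \<bullet> v) / \<epsilon>\<^sup>2) UNIV"
  unfolding dird_def
  using \<epsilon> by (auto intro!: derivative_eq_intros simp: inner_add_left inner_add_right inner_commute field_simps)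

lemma \<rho>_dird: "dird v \<rho> (\<rho>1 v) UNIV"
proof -
  have "DERIV (\<lambda>x::real. max 0 x ^ 3) x :> 3 * max 0 x ^ 2" for x
    using DERIV_max_power[of 1 x] by (simp add: eval_nat_numeral)
  from dird_chain[OF inner_dird[of v] this] show ?thesis unfolding \<rho>_def[abs_def] \<rho>1_def[abs_def] .
qed

lemma \<rho>1_dird: "dird v' (\<rho>1 v) (\<rho>2 v' v) UNIV"
proof -
  have "DERIV (\<lambda>x::real. 3 * max 0 x ^ 2) x :> 6 * max 0 x" for x
    using DERIV_cmult[OF DERIV_max_power[of 0 x], of 3] by (simp add: eval_nat_numeral)
  from dird_mult[OF dird_chain[OF inner_dird[of v'] this] inner_dird2[of v' v]]
  show ?thesis unfolding \<rho>1_def[abs_def] \<rho>2_def[abs_def] .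
qed

lemma \<rho>_continuous: "continuous_on UNIV \<rho>" "continuous_on UNIV (\<rho>1 v)" "continuous_on UNIV (\<rho>2 v' v)"
  unfolding \<rho>_def[abs_def] \<rho>1_def[abs_def] \<rho>2_def[abs_def] using \<epsilon> by (auto intro!: continuous_intros)

lemma inner_ge: "norm w > \<epsilon> \<Longrightarrow> max 0 (1 - (w \<bullet> w) / \<epsilon>\<^sup>2) = 0"
  using \<epsilon> power_strict_mono[of \<epsilon> "norm w" 2] by (auto simp: dot_square_norm max_def field_simps)

lemma \<rho>_supp: "norm w > \<epsilon> \<Longrightarrow> \<rho> w = 0" "norm w > \<epsilon> \<Longrightarrow> \<rho>1 v w = 0" "norm w > \<epsilon> \<Longrightarrow> \<rho>2 v' v w = 0"
  using inner_ge[of w] by (auto simp: \<rho>_def \<rho>1_def \<rho>2_def)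

lemma max_bound: "\<bar>max 0 (1 - (w \<bullet> w) / \<epsilon>\<^sup>2)\<bar> \<le> 1"
  using \<epsilon> by (auto simp: max_def abs_le_iff intro: order_trans)

lemma lin_bound:
  assumes "norm w \<le> \<epsilon>"
  shows "\<bar>- 2 * (w \<bullet> v) / \<epsilon>\<^sup>2\<bar> \<le> 2 * norm v / \<epsilon>"
proof -
  have "\<bar>w \<bullet> v\<bar> \<le> \<epsilon> * norm v"
    using Cauchy_Schwarz_ineq2[of w v] assms by (meson mult_right_mono norm_ge_zero order_trans)
  then have "2 * \<bar>w \<bullet> v\<bar> / \<epsilon>\<^sup>2 \<le> 2 * (\<epsilon> * norm v) / \<epsilon>\<^sup>2" using \<epsilon> by (intro divide_right_mono) auto
  also have "\<dots> = 2 * norm v / \<epsilon>" using \<epsilon> by (simp add: power2_eq_square)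
  finally show ?thesis using \<epsilon> by (simp add: abs_mult)
qed

lemma \<rho>_bound: "\<bar>\<rho> w\<bar> \<le> 1"
  unfolding \<rho>_def power_abs using max_bound by (intro power_le_one) auto

lemma \<rho>1_bound: "\<bar>\<rho>1 v w\<bar> \<le> 6 * norm v / \<epsilon>"
proof (cases "norm w > \<epsilon>")
  case False
  have "\<bar>\<rho>1 v w\<bar> = 3 * \<bar>max 0 (1 - (w \<bullet> w) / \<epsilon>\<^sup>2)\<bar> ^ 2 * \<bar>- 2 * (w \<bullet> v) / \<epsilon>\<^sup>2\<bar>"
    unfolding \<rho>1_def by (simp add: abs_mult)
  also have "\<dots> \<le> 3 * 1 ^ 2 * (2 * norm v / \<epsilon>)"
    using \<epsilon> by (intro mult_mono power_mono max_bound lin_bound) (use False in auto)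
  finally show ?thesis by simp
qed (use \<rho>_supp \<epsilon> in auto)

lemma \<rho>2_bound: "\<bar>\<rho>2 v' v w\<bar> \<le> 30 * norm v' * norm v / \<epsilon>\<^sup>2"
proof (cases "norm w > \<epsilon>")
  case False
  have 0: "\<bar>v' \<bullet> v\<bar> \<le> norm v' * norm v" by (rule Cauchy_Schwarz_ineq2)
  have "\<bar>\<rho>2 v' v w\<bar> \<le> 6 * \<bar>max 0 (1 - (w \<bullet> w) / \<epsilon>\<^sup>2)\<bar> * \<bar>- 2 * (w \<bullet> v') / \<epsilon>\<^sup>2\<bar> * \<bar>- 2 * (w \<bullet> v) / \<epsilon>\<^sup>2\<bar>
     + 3 * \<bar>max 0 (1 - (w \<bullet> w) / \<epsilon>\<^sup>2)\<bar> ^ 2 * (2 * \<bar>v' \<bullet> v\<bar> / \<epsilon>\<^sup>2)"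
    unfolding \<rho>2_def by (rule order_trans[OF abs_triangle_ineq]) (simp add: abs_mult)
  \<comment> \<open>The constant 30 is 6 * 2 * 2 + 3 * 2.\<close>
  also have "\<dots> \<le> 6 * 1 * (2 * norm v' / \<epsilon>) * (2 * norm v / \<epsilon>) + 3 * 1 ^ 2 * (2 * (norm v' * norm v) / \<epsilon>\<^sup>2)"
    using \<epsilon> by (intro add_mono mult_mono power_mono max_bound lin_bound divide_right_mono 0) (use False in auto)
  also have "\<dots> = 30 * norm v' * norm v / \<epsilon>\<^sup>2" using \<epsilon> by (simp add: field_simps power2_eq_square)
  finally show ?thesis .
qed (use \<rho>_supp \<epsilon> in auto)

definition mass :: real where "mass = (\<integral>w. \<rho> w \<partial>lborel)"

lemma \<rho>_nonneg: "0 \<le> \<rho> w" by (simp add: \<rho>_def)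

lemma \<rho>_measurable[measurable]: "\<rho> \<in> borel_measurable borel"
  by (rule borel_measurable_continuous_onI[OF \<rho>_continuous(1)])

lemma \<rho>_integrable: "integrable lborel \<rho>"
  by (rule integrable_bounded_supp[of _ 1 0 \<epsilon>]) (use \<rho>_bound \<rho>_supp in \<open>auto simp: indicator_def\<close>)

text \<open>On the ball of radius \<epsilon>/2 the bump is at least (1 - 1/4)^3 = 27/64. The bound
  scales like the volume of the \<epsilon>-ball, so dividing by the mass leaves no power of
  \<epsilon> behind.\<close>

lemma mass_ge: "mass \<ge> 27 / 64 * (unit_ball_vol (real DIM('a)) * (\<epsilon> / 2) ^ DIM('a))"
proof -
  have "27 / 64 * (unit_ball_vol (real DIM('a)) * (\<epsilon> / 2) ^ DIM('a)) = (\<integral>w. 27 / 64 * indicator (cball (0::'a) (\<epsilon> / 2)) w \<partial>lborel)"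
    using \<epsilon> by (simp add: content_cball)
  also have "\<dots> \<le> mass" unfolding mass_def
  proof (intro integral_mono integrable_cball_indicator \<rho>_integrable)
    fix w
    show "27 / 64 * indicator (cball 0 (\<epsilon> / 2)) w \<le> \<rho> w"
    proof (cases "norm w \<le> \<epsilon> / 2")
      case True
      then have "(norm w)\<^sup>2 \<le> (\<epsilon> / 2)\<^sup>2" by (intro power_mono) auto
      then have "(w \<bullet> w) / \<epsilon>\<^sup>2 \<le> (\<epsilon> / 2)\<^sup>2 / \<epsilon>\<^sup>2" unfolding dot_square_norm by (rule divide_right_mono) simp
      also have "\<dots> = 1 / 4" using \<epsilon> by (simp add: power_divide)
      finally have "3 / 4 \<le> 1 - (w \<bullet> w) / \<epsilon>\<^sup>2" by linarith
      then have "3 / 4 \<le> max 0 (1 - (w \<bullet> w) / \<epsilon>\<^sup>2)" by (rule max.coboundedI2)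
      then have "(3 / 4) ^ 3 \<le> \<rho> w" unfolding \<rho>_def by (rule power_mono) simp
      then show ?thesis using True by (simp add: power3_eq_cube)
    qed (use \<rho>_nonneg in auto)
  qed
  finally show ?thesis .
qed

lemma mass_pos: "mass > 0"
  by (rule less_le_trans[OF _ mass_ge]) (use \<epsilon> in \<open>auto intro!: mult_pos_pos zero_less_power\<close>)

definition \<eta> :: "'a \<Rightarrow> real" where "\<eta> z = moll \<rho> z / mass"
definition \<eta>1 :: "'a \<Rightarrow> 'a \<Rightarrow> real" where "\<eta>1 v z = moll (\<rho>1 v) z / mass"
definition \<eta>2 :: "'a \<Rightarrow> 'a \<Rightarrow> 'a \<Rightarrow> real" where "\<eta>2 v' v z = moll (\<rho>2 v' v) z / mass"

lemma \<eta>_continuous: "continuous_on UNIV \<eta>" "continuous_on UNIV (\<eta>1 v)" "continuous_on UNIV (\<eta>2 v' v)"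
  unfolding \<eta>_def[abs_def] \<eta>1_def[abs_def] \<eta>2_def[abs_def]
  using mass_pos moll_continuous[OF \<rho>_continuous(1) \<rho>_bound \<rho>_supp(1)]
    moll_continuous[OF \<rho>_continuous(2) \<rho>1_bound \<rho>_supp(2)] moll_continuous[OF \<rho>_continuous(3) \<rho>2_bound \<rho>_supp(3)]
  by (auto intro!: continuous_intros)

lemma \<eta>_dird: "dird v \<eta> (\<eta>1 v) UNIV" "dird v' (\<eta>1 v) (\<eta>2 v' v) UNIV"
proof -
  have "dird v (moll \<rho>) (moll (\<rho>1 v)) UNIV"
    by (rule moll_dird[OF \<rho>_continuous(2) \<rho>1_bound \<rho>_supp(2) \<rho>_dird \<rho>_continuous(1) \<rho>_bound \<rho>_supp(1)
       moll_integrable[OF \<rho>_continuous(1) \<rho>_bound \<rho>_supp(1)]])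
  from dird_cmult[OF this, of "1 / mass"] show "dird v \<eta> (\<eta>1 v) UNIV" by (simp add: \<eta>_def[abs_def] \<eta>1_def[abs_def])
  have "dird v' (moll (\<rho>1 v)) (moll (\<rho>2 v' v)) UNIV"
    by (rule moll_dird[OF \<rho>_continuous(3) \<rho>2_bound \<rho>_supp(3) \<rho>1_dird \<rho>_continuous(2) \<rho>1_bound \<rho>_supp(2)
       moll_integrable[OF \<rho>_continuous(2) \<rho>1_bound \<rho>_supp(2)]])
  from dird_cmult[OF this, of "1 / mass"] show "dird v' (\<eta>1 v) (\<eta>2 v' v) UNIV" by (simp add: \<eta>2_def[abs_def] \<eta>1_def[abs_def])
qed

text \<open>A derivative of the bump is integrated over a ball of radius \<epsilon> and divided by
  the mass; the volume of that ball over the mass is at most 2^N * 64/27. The only powers of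
  \<epsilon> left are those from differentiating the bump, and \<open>E\<close> does not enter the
  constant.\<close>

lemma \<eta>_bounds: "\<bar>\<eta>1 v z\<bar> \<le> 6 * 2 ^ DIM('a) * 64 / 27 * norm v / \<epsilon>"
  "\<bar>\<eta>2 v' v z\<bar> \<le> 30 * 2 ^ DIM('a) * 64 / 27 * norm v' * norm v / \<epsilon>\<^sup>2"
proof -
  let ?V = "unit_ball_vol (real DIM('a)) * \<epsilon> ^ DIM('a)"
  have V: "?V > 0" using \<epsilon> by (auto intro!: mult_pos_pos zero_less_power)
  have m: "mass \<ge> ?V * (27 / 64 / 2 ^ DIM('a))" using mass_ge by (simp add: power_divide)
  have *: "B * ?V / mass \<le> B * 2 ^ DIM('a) * 64 / 27" if "B \<ge> 0" for B
  proof -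
    have "B * ?V / mass \<le> B * ?V / (?V * (27 / 64 / 2 ^ DIM('a)))"
      using that V m \<epsilon> by (intro divide_left_mono mult_pos_pos mass_pos) auto
    also have "\<dots> = B * 2 ^ DIM('a) * 64 / 27"
    proof -
      have "B * X / (X * (27 / 64 / Y)) = B * Y * 64 / 27" if "X > 0" "Y > 0" for X Y :: real
        using that by (simp add: field_simps)
      from this[OF V, of "2 ^ DIM('a)"] show ?thesis by simp
    qed
    finally show ?thesis .
  qed
  have "\<bar>\<eta>1 v z\<bar> \<le> 6 * norm v / \<epsilon> * ?V / mass"
    unfolding \<eta>1_def abs_divide abs_of_pos[OF mass_pos]
    by (rule divide_right_mono[OF moll_bound[OF \<rho>_continuous(2) \<rho>1_bound \<rho>_supp(2)] less_imp_le[OF mass_pos]])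
  also have "\<dots> \<le> 6 * norm v / \<epsilon> * 2 ^ DIM('a) * 64 / 27" by (rule *) (use \<epsilon> in simp)
  finally show "\<bar>\<eta>1 v z\<bar> \<le> 6 * 2 ^ DIM('a) * 64 / 27 * norm v / \<epsilon>" by (simp add: mult_ac)
  have "\<bar>\<eta>2 v' v z\<bar> \<le> 30 * norm v' * norm v / \<epsilon>\<^sup>2 * ?V / mass"
    unfolding \<eta>2_def abs_divide abs_of_pos[OF mass_pos]
    by (rule divide_right_mono[OF moll_bound[OF \<rho>_continuous(3) \<rho>2_bound \<rho>_supp(3)] less_imp_le[OF mass_pos]])
  also have "\<dots> \<le> 30 * norm v' * norm v / \<epsilon>\<^sup>2 * 2 ^ DIM('a) * 64 / 27" by (rule *) (use \<epsilon> in simp)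
  finally show "\<bar>\<eta>2 v' v z\<bar> \<le> 30 * 2 ^ DIM('a) * 64 / 27 * norm v' * norm v / \<epsilon>\<^sup>2" by (simp add: mult_ac)
qed

lemma \<eta>_nonneg: "0 \<le> \<eta> z"
  unfolding \<eta>_def moll_def using mass_pos \<rho>_nonneg
  by (intro divide_nonneg_pos Bochner_Integration.integral_nonneg) auto

lemma mass_eq: "(\<integral>w. \<rho> (z - w) \<partial>lborel) = mass"
  unfolding mass_def by (rule integral_reflect) simp

lemma \<eta>_le_1: "\<eta> z \<le> 1"
proof -
  have "moll \<rho> z \<le> (\<integral>w. \<rho> (z - w) \<partial>lborel)" unfolding moll_def
    using \<rho>_nonneg by (intro integral_mono moll_integrable[OF \<rho>_continuous(1) \<rho>_bound \<rho>_supp(1)])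
      (auto simp: integrable_reflect \<rho>_integrable indicator_def)
  then show ?thesis unfolding \<eta>_def mass_eq using mass_pos by simp
qed

lemma \<eta>_eq_1: "(\<And>w. dist z w \<le> \<epsilon> \<Longrightarrow> w \<in> E) \<Longrightarrow> \<eta> z = 1"
proof -
  assume *: "\<And>w. dist z w \<le> \<epsilon> \<Longrightarrow> w \<in> E"
  have "moll \<rho> z = (\<integral>w. \<rho> (z - w) \<partial>lborel)" unfolding moll_def
  proof (intro Bochner_Integration.integral_cong refl)
    fix w show "\<rho> (z - w) * indicator E w = \<rho> (z - w)"
      using *[of w] \<rho>_supp(1)[of "z - w"] by (cases "dist z w \<le> \<epsilon>") (auto simp: dist_norm)
  qed
  then show ?thesis unfolding \<eta>_def mass_eq using mass_pos by simp
qed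

lemma \<eta>_eq_0: "(\<And>w. dist z w \<le> \<epsilon> \<Longrightarrow> w \<notin> E) \<Longrightarrow> \<eta> z = 0"
proof -
  assume *: "\<And>w. dist z w \<le> \<epsilon> \<Longrightarrow> w \<notin> E"
  have "moll \<rho> z = (\<integral>w. 0 \<partial>(lborel :: 'a measure))" unfolding moll_def
  proof (intro Bochner_Integration.integral_cong refl)
    fix w show "\<rho> (z - w) * indicator E w = 0"
      using *[of w] \<rho>_supp(1)[of "z - w"] by (cases "dist z w \<le> \<epsilon>") (auto simp: dist_norm)
  qed
  then show ?thesis unfolding \<eta>_def by simp
qed

end

definition cutoff_data :: "real \<Rightarrow> 'a::euclidean_space set \<Rightarrow> real \<Rightarrow> ('a \<Rightarrow> real) \<Rightarrow> ('a \<Rightarrow> 'a \<Rightarrow> real) \<Rightarrow> ('a \<Rightarrow> 'a \<Rightarrow> 'a \<Rightarrow> real) \<Rightarrow> bool" where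
  "cutoff_data C S \<epsilon> \<eta> \<eta>1 \<eta>2 \<longleftrightarrow>
        continuous_on UNIV \<eta> \<and> (\<forall>v. continuous_on UNIV (\<eta>1 v)) \<and> (\<forall>v' v. continuous_on UNIV (\<eta>2 v' v)) \<and>
        (\<forall>v. dird v \<eta> (\<eta>1 v) UNIV) \<and> (\<forall>v' v. dird v' (\<eta>1 v) (\<eta>2 v' v) UNIV) \<and>
        (\<forall>z. 0 \<le> \<eta> z \<and> \<eta> z \<le> 1) \<and>
        (\<forall>z. infdist z S < \<epsilon> \<longrightarrow> \<eta> z = 0) \<and> (\<forall>z. infdist z S > 3 * \<epsilon> \<longrightarrow> \<eta> z = 1) \<and>
        (\<forall>v z. \<bar>\<eta>1 v z\<bar> \<le> C * norm v / \<epsilon>) \<and> (\<forall>v' v z. \<bar>\<eta>2 v' v z\<bar> \<le> C * norm v' * norm v / \<epsilon>\<^sup>2)"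

text \<open>The indicator of the points at distance at least 2 \<epsilon> from \<open>S\<close> is
  mollified at scale \<epsilon>, hence the thresholds \<epsilon> and 3 \<epsilon>. The constant is
  fixed before \<open>S\<close> and \<epsilon>, which is what allows \<epsilon> to tend to 0
  later.\<close>

lemma cutoff_exists:
  obtains C :: real where "C > 0"
    "\<And>(S::'a::euclidean_space set) \<epsilon>. S \<noteq> {} \<Longrightarrow> \<epsilon> > 0 \<Longrightarrow>
      \<exists>\<eta> \<eta>1 \<eta>2. cutoff_data C S \<epsilon> \<eta> \<eta>1 \<eta>2"
proof (rule that[of "30 * 2 ^ DIM('a) * 64 / 27"])
  fix S :: "'a set" and \<epsilon> :: real assume S: "S \<noteq> {}" and e: "\<epsilon> > 0"
  define E where "E = {z. 2 * \<epsilon> \<le> infdist z S}"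
  have "closed E" unfolding E_def by (intro closed_Collect_le continuous_intros)
  then interpret mollifier E \<epsilon> by unfold_locales (use e in auto)
  have 1: "\<eta> z = 1" if "infdist z S > 3 * \<epsilon>" for z
  proof (rule \<eta>_eq_1)
    fix w assume "dist z w \<le> \<epsilon>"
    then show "w \<in> E" using that infdist_triangle[of z S w] by (simp add: E_def)
  qed
  have 0: "\<eta> z = 0" if z: "infdist z S < \<epsilon>" for z
  proof (rule \<eta>_eq_0)
    fix w assume "dist z w \<le> \<epsilon>"
    then show "w \<notin> E" using z infdist_triangle[of w S z] by (simp add: E_def dist_commute)
  qed
  have b1: "\<bar>\<eta>1 v z\<bar> \<le> 30 * 2 ^ DIM('a) * 64 / 27 * norm v / \<epsilon>" for v z
    by (rule order_trans[OF \<eta>_bounds(1)]) (use e in \<open>auto intro!: divide_right_mono mult_right_mono\<close>)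
  show "\<exists>\<eta> \<eta>1 \<eta>2. cutoff_data (30 * 2 ^ DIM('a) * 64 / 27) S \<epsilon> \<eta> \<eta>1 \<eta>2"
    using \<eta>_continuous \<eta>_dird \<eta>_nonneg \<eta>_le_1 0 1 b1 \<eta>_bounds(2)
    unfolding cutoff_data_def by (intro exI[of _ \<eta>] exI[of _ \<eta>1] exI[of _ \<eta>2]) blast
qed simp

section \<open>Convolutions\<close>

definition locint :: "('a::euclidean_space \<Rightarrow> real) \<Rightarrow> bool" where
  "locint k \<longleftrightarrow> k \<in> borel_measurable borel \<and> (\<forall>R. integrable lborel (\<lambda>w. indicator (cball 0 R) w * k w))"

definition bdsupp :: "('a::euclidean_space \<Rightarrow> real) \<Rightarrow> bool" where
  "bdsupp f \<longleftrightarrow> f \<in> borel_measurable borel \<and> (\<exists>B R. 0 \<le> B \<and> (\<forall>w. \<bar>f w\<bar> \<le> B * indicator (cball 0 R) w))"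

definition conv :: "('a::euclidean_space \<Rightarrow> real) \<Rightarrow> ('a \<Rightarrow> real) \<Rightarrow> 'a \<Rightarrow> real" where
  "conv k f z = (\<integral>w. k w * f (z - w) \<partial>lborel)"

lemma locint_measurable: "locint k \<Longrightarrow> k \<in> borel_measurable borel" by (simp add: locint_def)

lemma bdsupp_measurable: "bdsupp f \<Longrightarrow> f \<in> borel_measurable borel" by (simp add: bdsupp_def)

lemma bdsuppI:
  assumes "f \<in> borel_measurable borel" "\<And>w. \<bar>f w\<bar> \<le> B" "\<And>w. norm w > R \<Longrightarrow> f w = 0"
  shows "bdsupp f"
  unfolding bdsupp_def
proof (intro conjI exI[of _ B, OF exI[of _ R]] allI)
  show "0 \<le> B" using assms(2) abs_ge_zero order_trans by blast
  fix w show "\<bar>f w\<bar> \<le> B * indicator (cball 0 R) w"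
    using assms(2)[of w] assms(3)[of w] by (cases "norm w \<le> R") auto
qed (rule assms(1))

lemma bdsupp_continuousI:
  assumes c: "continuous_on UNIV f" and 0: "\<And>w. norm w > R \<Longrightarrow> f w = 0"
  shows "bdsupp f"
proof -
  have "compact (f ` cball 0 R)" by (intro compact_continuous_image continuous_on_subset[OF c]) auto
  then obtain B where B: "\<And>w. w \<in> cball 0 R \<Longrightarrow> \<bar>f w\<bar> \<le> B"
    by (metis compact_imp_bounded bounded_iff imageI real_norm_def)
  show ?thesis
  proof (rule bdsuppI[where B="max B 0" and R=R])
    fix w show "\<bar>f w\<bar> \<le> max B 0" using B[of w] 0[of w] by (cases "norm w \<le> R") auto
  qed (use 0 borel_measurable_continuous_onI[OF c] in auto)
qed

lemma locint_continuousI: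
  fixes k :: "'a::euclidean_space \<Rightarrow> real"
  assumes "continuous_on UNIV k"
  shows "locint k"
  unfolding locint_def
proof (intro conjI allI)
  show "k \<in> borel_measurable borel" by (rule borel_measurable_continuous_onI[OF assms])
  fix R
  have "set_integrable lborel (cball 0 R) k"
    unfolding set_integrable_def by (rule borel_integrable_compact) (use continuous_on_subset[OF assms] in auto)
  then show "integrable lborel (\<lambda>w. indicator (cball 0 R) w * k w)" by (simp add: set_integrable_def)
qed

lemma conv_dominated:
  fixes f k :: "'a::euclidean_space \<Rightarrow> real"
  assumes f: "\<And>w. \<bar>f w\<bar> \<le> B * indicator (cball 0 R) w" and B: "0 \<le> B" and z: "norm z \<le> M"
  shows "\<bar>k w * f (z - w)\<bar> \<le> B * \<bar>indicator (cball 0 (R + M)) w * k w\<bar>"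
proof (cases "norm (z - w) \<le> R")
  case True
  then have "norm w \<le> R + M" using z norm_triangle_ineq2[of w z] by (simp add: norm_minus_commute)
  moreover have "\<bar>f (z - w)\<bar> \<le> B" using f[of "z - w"] True by simp
  ultimately show ?thesis by (simp add: abs_mult mult.commute[of "\<bar>k w\<bar>"] mult_right_mono)
next
  case False
  then have "f (z - w) = 0" using f[of "z - w"] by simp
  then show ?thesis using B by simp
qed

lemma locint_dominating: "locint k \<Longrightarrow> integrable lborel (\<lambda>w. B * \<bar>indicator (cball 0 R) w * k w\<bar>)"
  by (intro integrable_mult_right integrable_abs) (auto simp: locint_def)

lemma conv_integrable:
  assumes k: "locint k" and f: "bdsupp f"
  shows "integrable lborel (\<lambda>w. k w * f (z - w))"
proof -
  have [measurable]: "k \<in> borel_measurable borel" "f \<in> borel_measurable borel"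
    using k f by (auto simp: locint_def bdsupp_def)
  obtain B R where B: "0 \<le> B" "\<And>w. \<bar>f w\<bar> \<le> B * indicator (cball 0 R) w" using f by (auto simp: bdsupp_def)
  show ?thesis
  proof (rule Bochner_Integration.integrable_bound[OF locint_dominating[OF k, of B "R + norm z"]])
    show "AE w in lborel. norm (k w * f (z - w)) \<le> norm (B * \<bar>indicator (cball 0 (R + norm z)) w * k w\<bar>)"
      using conv_dominated[OF B(2,1) order_refl[of "norm z"], of k] B(1) by (intro AE_I2) (auto simp: abs_mult)
  qed measurable
qed

lemma AE_reflect_notin:
  fixes N :: "'a::euclidean_space set"
  assumes "N \<in> null_sets lborel"
  shows "AE w in lborel. z - w \<notin> N"
proof -
  have "AE x in distr lborel borel (\<lambda>w. z - w). x \<notin> N"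
    unfolding lborel_distr_reflect by (rule AE_not_in[OF assms])
  then show ?thesis
    by (subst (asm) AE_distr_iff) (use assms in \<open>auto simp: null_sets_def\<close>)
qed

text \<open>Almost everywhere continuity of the density is all that dominated convergence needs. The
  nonlinear term is continuous off the null singular set only, and this is the version that applies
  to it.\<close>

lemma conv_isCont:
  assumes k: "locint k" and f: "bdsupp f" and c: "AE w in lborel. isCont f (z - w)"
  shows "isCont (conv k f) z"
proof -
  have [measurable]: "k \<in> borel_measurable borel" "f \<in> borel_measurable borel"
    using k f by (auto simp: locint_def bdsupp_def)
  obtain B R where B: "0 \<le> B" "\<And>w. \<bar>f w\<bar> \<le> B * indicator (cball 0 R) w" using f by (auto simp: bdsupp_def)
  have "((\<lambda>y. \<integral>w. k w * f (y - w) \<partial>lborel) \<longlongrightarrow> (\<integral>w. k w * f (z - w) \<partial>lborel)) (at z within ball z 1)"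
  proof (rule tendsto_integral_at[OF locint_dominating[OF k, of B "R + (norm z + 1)"]])
    show "AE w in lborel. ((\<lambda>y. k w * f (y - w)) \<longlongrightarrow> k w * f (z - w)) (at z within ball z 1)"
      using c
    proof eventually_elim
      case (elim w)
      have "((\<lambda>y. y - w) \<longlongrightarrow> z - w) (at z within ball z 1)" by (intro tendsto_intros)
      from isCont_tendsto_compose[OF elim this] show ?case by (intro tendsto_mult_left)
    qed
    fix y assume "y \<in> ball z 1"
    then have "norm y \<le> norm z + 1" using norm_triangle_ineq2[of y z] by (simp add: dist_norm norm_minus_commute)
    then show "AE w in lborel. \<bar>k w * f (y - w)\<bar> \<le> B * \<bar>indicator (cball 0 (R + (norm z + 1))) w * k w\<bar>"
      by (intro AE_I2 conv_dominated[OF B(2,1)])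
  qed measurable
  moreover have "at z within ball z 1 = at z" by (rule at_within_open) auto
  ultimately show ?thesis by (simp add: isCont_def conv_def[abs_def])
qed

lemma conv_continuous:
  assumes k: "locint k" and f: "bdsupp f" and N: "N \<in> null_sets lborel"
    and c: "\<And>z. z \<notin> N \<Longrightarrow> isCont f z"
  shows "continuous_on UNIV (conv k f)"
  unfolding continuous_on_eq_continuous_at[OF open_UNIV]
proof
  fix z
  have "AE w in lborel. isCont f (z - w)" using AE_reflect_notin[OF N, of z] by eventually_elim (rule c)
  then show "isCont (conv k f) z" by (rule conv_isCont[OF k f])
qed

lemma conv_continuous':
  assumes k: "locint k" and f: "bdsupp f" and c: "continuous_on UNIV f"
  shows "continuous_on UNIV (conv k f)"
  using c by (intro conv_continuous[OF k f, of "{}"]) (auto simp: continuous_on_eq_continuous_at)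

lemma small_shift:
  fixes v z :: "'a::real_normed_vector"
  assumes "\<bar>s\<bar> < r / (norm v + 1)"
  shows "dist z (z + s *\<^sub>R v) < r"
proof -
  have "\<bar>s\<bar> * norm v \<le> \<bar>s\<bar> * (norm v + 1)" by (intro mult_left_mono) auto
  also have "\<dots> < r" using assms pos_less_divide_eq[of "norm v + 1" "\<bar>s\<bar>" r] by (simp add: add_nonneg_pos)
  finally show ?thesis by (simp add: dist_norm)
qed

lemma conv_dird:
  assumes k: "locint k" and f: "bdsupp f" and f': "bdsupp f'" and d: "dird e f f' UNIV"
  shows "dird e (conv k f) (conv k f') UNIV"
  unfolding dird_def
proof
  fix z
  obtain B R where B: "0 \<le> B" "\<And>w. \<bar>f' w\<bar> \<le> B * indicator (cball 0 R) w" using f' by (auto simp: bdsupp_def)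
  have "((\<lambda>s. \<integral>w. k w * f (z + s *\<^sub>R e - w) \<partial>lborel) has_real_derivative (\<integral>w. k w * f' (z + 0 *\<^sub>R e - w) \<partial>lborel)) (at 0)"
  proof (rule DERIV_integral[where r="1 / (norm e + 1)" and w="\<lambda>w. B * \<bar>indicator (cball 0 (R + (norm z + 1))) w * k w\<bar>"])
    show "0 < 1 / (norm e + 1)" by (simp add: add_nonneg_pos)
    fix s :: real assume s: "\<bar>s\<bar> < 1 / (norm e + 1)"
    show "integrable lborel (\<lambda>w. k w * f (z + s *\<^sub>R e - w))" by (rule conv_integrable[OF k f])
    fix w
    have "((\<lambda>s. f ((z - w) + s *\<^sub>R e)) has_real_derivative f' ((z - w) + s *\<^sub>R e)) (at s)"
      by (rule dird_line[OF d]) simp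
    then show "((\<lambda>s. k w * f (z + s *\<^sub>R e - w)) has_real_derivative k w * f' (z + s *\<^sub>R e - w)) (at s)"
      by (intro DERIV_cmult) (simp add: algebra_simps)
    have "norm (z + s *\<^sub>R e) \<le> norm z + 1"
      using small_shift[OF s, of z] norm_triangle_ineq[of z "s *\<^sub>R e"] by (simp add: dist_norm)
    then show "\<bar>k w * f' (z + s *\<^sub>R e - w)\<bar> \<le> B * \<bar>indicator (cball 0 (R + (norm z + 1))) w * k w\<bar>"
      by (rule conv_dominated[OF B(2,1)])
  qed (rule locint_dominating[OF k])
  then show "((\<lambda>s. conv k f (z + s *\<^sub>R e)) has_real_derivative conv k f' z) (at 0)"
    by (simp add: conv_def)
qed

lemma conv_translate:
  assumes k: "locint k" and f: "bdsupp f"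
  shows "conv k f (y + a) = (\<integral>w. k (w + a) * f (y - w) \<partial>lborel)"
    and "integrable lborel (\<lambda>w. k (w + a) * f (y - w))"
proof -
  have [measurable]: "k \<in> borel_measurable borel" "f \<in> borel_measurable borel"
    using k f by (auto simp: locint_def bdsupp_def)
  show "conv k f (y + a) = (\<integral>w. k (w + a) * f (y - w) \<partial>lborel)"
    using integral_translate[of "\<lambda>w. k w * f (y + a - w)" a] by (simp add: conv_def)
  show "integrable lborel (\<lambda>w. k (w + a) * f (y - w))"
    using integrable_translate[of "\<lambda>w. k w * f (y + a - w)" a] conv_integrable[OF k f, of "y + a"] by simp
qed

text \<open>The difference quotients of a locally integrable kernel need not be dominated, so the derivative is
  obtained from the fundamental theorem along lines and Fubini.\<close>

lemma conv_line_integral: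
  assumes k: "locint k" and k': "locint k'" and d: "dird e k k' UNIV"
    and lc: "\<And>w. continuous_on UNIV (\<lambda>s. k' (w + s *\<^sub>R e))" and f: "bdsupp f" and c: "0 \<le> c"
  shows "conv k f (y + c *\<^sub>R e) - conv k f y = (\<integral>s. indicator {0..c} s * conv k' f (y + s *\<^sub>R e) \<partial>lborel)"
proof -
  have [measurable]: "k \<in> borel_measurable borel" "k' \<in> borel_measurable borel" "f \<in> borel_measurable borel"
    using k k' f by (auto simp: locint_def bdsupp_def)
  obtain B R where B: "0 \<le> B" "\<And>w. \<bar>f w\<bar> \<le> B * indicator (cball 0 R) w" using f by (auto simp: bdsupp_def)
  define H where "H s w = indicator {0..c} s * (k' (w + s *\<^sub>R e) * f (y - w))" for s w
  have Hm[measurable]: "case_prod H \<in> borel_measurable (lborel \<Otimes>\<^sub>M lborel)"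
    unfolding H_def by measurable
  \<comment> \<open>Translation invariance moves the shift by \<open>s *\<^sub>R e\<close> from the
    kernel to \<open>f\<close>, so a single integral of |k'| over a large ball bounds the inner
    integrals for all s in [0, c]. This justifies Fubini.\<close>
  define D where "D = (\<integral>w. B * \<bar>indicator (cball 0 (R + (norm y + c * norm e))) w * k' w\<bar> \<partial>lborel)"
  have D0: "0 \<le> D" unfolding D_def using B by (intro Bochner_Integration.integral_nonneg) auto
  have bnd: "(\<integral>w. norm (case_prod H (s, w)) \<partial>lborel) \<le> D * indicator {0..c} s" for s
  proof (cases "s \<in> {0..c}")
    case True
    have "norm (s *\<^sub>R e) \<le> c * norm e" using True by (auto intro: mult_right_mono)
    then have "norm (y + s *\<^sub>R e) \<le> norm y + c * norm e" using norm_triangle_ineq[of y "s *\<^sub>R e"] by linarith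
    note dom = conv_dominated[OF B(2,1) this, of k']
    have "(\<integral>w. norm (case_prod H (s, w)) \<partial>lborel) = (\<integral>w. \<bar>k' (w + s *\<^sub>R e) * f (y - w)\<bar> \<partial>lborel)"
      using True by (simp add: H_def)
    also have "\<dots> = (\<integral>w. \<bar>k' w * f (y + s *\<^sub>R e - w)\<bar> \<partial>lborel)"
      using integral_translate[of "\<lambda>w. \<bar>k' w * f (y + s *\<^sub>R e - w)\<bar>" "s *\<^sub>R e"] by simp
    also have "\<dots> \<le> D" unfolding D_def
      by (intro integral_mono integrable_abs conv_integrable[OF k' f] locint_dominating[OF k'] dom)
    finally show ?thesis using True by simp
  qed (simp add: H_def)
  have Hi: "integrable (lborel \<Otimes>\<^sub>M lborel) (case_prod H)"
  proof (rule lborel_pair.Fubini_integrable)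
    show "integrable lborel (\<lambda>s. \<integral>w. norm (case_prod H (s, w)) \<partial>lborel)"
    proof (rule Bochner_Integration.integrable_bound)
      show "integrable lborel (\<lambda>s. D * indicator {0..c} s)" by (intro integrable_mult_right integrable_real_indicator) (auto simp: emeasure_lborel_Icc_eq)
      show "AE s in lborel. norm (\<integral>w. norm (case_prod H (s, w)) \<partial>lborel) \<le> norm (D * indicator {0..c} s)"
        using bnd D0 by (intro AE_I2) (simp add: abs_mult)
    qed measurable
    show "AE s in lborel. integrable lborel (\<lambda>w. case_prod H (s, w))"
      using conv_translate(2)[OF k' f] by (intro AE_I2) (simp add: H_def)
  qed measurable
  have kftc: "k (w + c *\<^sub>R e) - k w = (\<integral>s. k' (w + s *\<^sub>R e) * indicator {0..c} s \<partial>lborel)" for w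
  proof -
    have "(\<integral>s. k' (w + s *\<^sub>R e) * indicator {0..c} s \<partial>lborel) = k (w + c *\<^sub>R e) - k (w + 0 *\<^sub>R e)"
    proof (rule integral_FTC_Icc_real[OF c])
      fix s
      show "((\<lambda>s. k (w + s *\<^sub>R e)) has_real_derivative k' (w + s *\<^sub>R e)) (at s)" by (rule dird_line[OF d]) simp
      show "isCont (\<lambda>s. k' (w + s *\<^sub>R e)) s" using lc[of w] by (simp add: continuous_on_eq_continuous_at)
    qed
    then show ?thesis by simp
  qed
  have "conv k f (y + c *\<^sub>R e) - conv k f y = (\<integral>w. k (w + c *\<^sub>R e) * f (y - w) - k w * f (y - w) \<partial>lborel)"
    unfolding conv_translate(1)[OF k f] unfolding conv_def
    by (intro Bochner_Integration.integral_diff[symmetric] conv_translate(2)[OF k f] conv_integrable[OF k f])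
  also have "\<dots> = (\<integral>w. (\<integral>s. H s w \<partial>lborel) \<partial>lborel)"
  proof (intro Bochner_Integration.integral_cong refl)
    fix w
    have "k (w + c *\<^sub>R e) * f (y - w) - k w * f (y - w) = (\<integral>s. k' (w + s *\<^sub>R e) * indicator {0..c} s \<partial>lborel) * f (y - w)"
      by (simp add: left_diff_distrib flip: kftc)
    also have "\<dots> = (\<integral>s. (k' (w + s *\<^sub>R e) * indicator {0..c} s) * f (y - w) \<partial>lborel)" by simp
    finally show "k (w + c *\<^sub>R e) * f (y - w) - k w * f (y - w) = (\<integral>s. H s w \<partial>lborel)"
      by (simp add: H_def mult_ac)
  qed
  also have "\<dots> = (\<integral>s. (\<integral>w. H s w \<partial>lborel) \<partial>lborel)" by (rule lborel_pair.Fubini_integral[OF Hi])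
  also have "\<dots> = (\<integral>s. indicator {0..c} s * conv k' f (y + s *\<^sub>R e) \<partial>lborel)"
    unfolding conv_translate(1)[OF k' f] H_def by simp
  finally show ?thesis .
qed

lemma conv_dird_kernel:
  assumes k: "locint k" and k': "locint k'" and d: "dird e k k' UNIV"
    and lc: "\<And>w. continuous_on UNIV (\<lambda>s. k' (w + s *\<^sub>R e))" and f: "bdsupp f"
    and cc: "continuous_on UNIV (conv k' f)"
  shows "dird e (conv k f) (conv k' f) UNIV"
  unfolding dird_def
proof
  fix z
  \<comment> \<open>The line formula is one-sided, for c \<ge> 0. Starting one step behind
    \<open>z\<close> makes \<open>z\<close> the point c = 1, interior to the range, so that the
    derivative there is two-sided.\<close>
  define y where "y = z - e"
  define W where "W s = conv k' f (y + s *\<^sub>R e)" for s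
  have Wc: "continuous_on A W" for A
    unfolding W_def by (rule continuous_on_compose2[OF cc]) (auto intro!: continuous_intros)
  have eq: "conv k f (y + c *\<^sub>R e) = conv k f y + integral {0..c} W" if "0 \<le> c" for c
  proof -
    have "set_integrable lborel {0..c} W"
      unfolding set_integrable_def by (rule borel_integrable_compact) (use Wc in auto)
    from set_borel_integral_eq_integral(2)[OF this]
    have "(\<integral>s. indicator {0..c} s * W s \<partial>lborel) = integral {0..c} W" by (simp add: set_lebesgue_integral_def)
    then show ?thesis using conv_line_integral[OF k k' d lc f that, of y] by (simp add: W_def)
  qed
  have "((\<lambda>c. integral {0..c} W) has_real_derivative W 1) (at 1 within {0..2})"
    by (rule integral_has_real_derivative[OF Wc]) auto
  then have "((\<lambda>c. integral {0..c} W) has_real_derivative W 1) (at 1)"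
    using at_within_interior[of 1 "{0..2::real}"] by simp
  then have 1: "((\<lambda>c. conv k f y + integral {0..c} W) has_real_derivative W 1) (at 1)"
    by (auto intro!: derivative_eq_intros)
  have ev: "\<forall>\<^sub>F c in nhds 1. conv k f (y + c *\<^sub>R e) = conv k f y + integral {0..c} W"
    using eventually_nhds_in_open[of "{0<..}" "1::real"] by (auto elim!: eventually_mono intro: eq)
  have "((\<lambda>c. conv k f (y + c *\<^sub>R e)) has_real_derivative W 1) (at 1)"
    by (rule iffD2[OF DERIV_cong_ev[OF refl ev refl] 1])
  then have "((\<lambda>s. conv k f (y + (s + 1) *\<^sub>R e)) has_real_derivative W 1) (at 0)"
    using DERIV_shift[of "\<lambda>c. conv k f (y + c *\<^sub>R e)" "W 1" 0 1] by simp
  then show "((\<lambda>s. conv k f (z + s *\<^sub>R e)) has_real_derivative conv k' f z) (at 0)"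
    by (simp add: W_def y_def algebra_simps)
qed

text \<open>Integration by parts without boundary terms: both sides are the derivative of
  \<open>conv k g\<close> along \<open>e\<close>, taken once on the density and once on the kernel,
  and derivatives are unique.\<close>

lemma conv_swap:
  assumes k: "locint k" and k': "locint k'" and d: "dird e k k' UNIV"
    and lc: "\<And>w. continuous_on UNIV (\<lambda>s. k' (w + s *\<^sub>R e))"
    and g: "bdsupp g" "continuous_on UNIV g" and g': "bdsupp g'" and dg: "dird e g g' UNIV"
  shows "conv k g' = conv k' g"
proof
  fix z
  show "conv k g' z = conv k' g z"
    by (rule dird_unique[OF conv_dird[OF k g(1) g' dg] conv_dird_kernel[OF k k' d lc g(1) conv_continuous'[OF k' g]]]) simp
qed

section \<open>Convolutions away from the support\<close>

definition offsupp :: "('a::euclidean_space \<Rightarrow> real) \<Rightarrow> 'a set \<Rightarrow> bool" where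
  "offsupp g P \<longleftrightarrow> g \<in> borel_measurable borel \<and> integrable lborel g \<and>
     (\<exists>R. \<forall>w. norm w > R \<longrightarrow> g w = 0) \<and> open P \<and> (\<forall>z\<in>P. g z = 0)"

lemma annulus_bounded:
  fixes k :: "'a::euclidean_space \<Rightarrow> real"
  assumes k: "continuous_on (- {0}) k" and d: "0 < \<delta>"
  obtains C where "0 \<le> C" "\<And>x. \<delta> \<le> norm x \<Longrightarrow> norm x \<le> R \<Longrightarrow> \<bar>k x\<bar> \<le> C"
proof -
  let ?A = "cball 0 R - ball 0 \<delta> :: 'a set"
  have "continuous_on ?A k" by (rule continuous_on_subset[OF k]) (use d in auto)
  then have "compact (k ` ?A)" by (intro compact_continuous_image compact_diff) auto
  then obtain C where "\<forall>y\<in>k ` ?A. norm y \<le> C" using compact_imp_bounded bounded_iff by blast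
  then have "\<bar>k x\<bar> \<le> max C 0" if "\<delta> \<le> norm x" "norm x \<le> R" for x
    using that by (force simp: not_less)
  then show thesis using that[of "max C 0"] by simp
qed

text \<open>For y near \<open>z\<close> and \<open>w\<close> with g w \<noteq> 0, the argument y - w
  stays in a fixed annulus, where the kernel is bounded. Hence |g| itself dominates, which allows
  densities that are integrable but unbounded near the singular set.\<close>

lemma offsupp_dominated:
  fixes k :: "'a::euclidean_space \<Rightarrow> real"
  assumes k: "continuous_on (- {0}) k" and g: "offsupp g P" and z: "z \<in> P"
  obtains C \<delta> where "0 < \<delta>" "ball z \<delta> \<subseteq> P" "0 \<le> C"
    "\<And>y w. y \<in> ball z \<delta> \<Longrightarrow> \<bar>k (y - w) * g w\<bar> \<le> C * \<bar>g w\<bar>"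
proof -
  obtain R where R: "\<And>w. norm w > R \<Longrightarrow> g w = 0" using g by (auto simp: offsupp_def)
  have g0: "\<And>z. z \<in> P \<Longrightarrow> g z = 0" and "open P" using g by (auto simp: offsupp_def)
  then obtain d where d: "0 < d" "ball z d \<subseteq> P" using z openE by blast
  obtain C where C: "0 \<le> C" "\<And>x. d / 2 \<le> norm x \<Longrightarrow> norm x \<le> norm z + d + R \<Longrightarrow> \<bar>k x\<bar> \<le> C"
    using annulus_bounded[OF k, of "d / 2" "norm z + d + R"] d by auto
  show thesis
  proof (rule that[of "d / 2" C])
    show "0 < d / 2" using d by simp
    show "ball z (d / 2) \<subseteq> P" using d by auto
    fix y w assume y: "y \<in> ball z (d / 2)"
    show "\<bar>k (y - w) * g w\<bar> \<le> C * \<bar>g w\<bar>"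
    proof (cases "norm w > R \<or> w \<in> P")
      case False
      then have "dist z w \<ge> d" using d(2) by (auto simp: not_less)
      then have "d / 2 \<le> norm (y - w)" using y dist_triangle[of z w y] by (simp add: dist_norm)
      moreover have "norm (y - w) \<le> norm z + d + R"
      proof -
        have "norm y \<le> norm z + d" using y d(1) norm_triangle_ineq2[of y z] by (simp add: dist_norm norm_minus_commute)
        then show ?thesis using False norm_triangle_ineq4[of y w] by simp
      qed
      ultimately show ?thesis using C(2)[of "y - w"] by (simp add: abs_mult mult_right_mono)
    next
      case True
      then have "g w = 0" using R g0 by blast
      then show ?thesis by simp
    qed
  qed (rule C)
qed

lemma conv_alt:
  assumes [measurable]: "k \<in> borel_measurable borel" "g \<in> borel_measurable borel"
  shows "conv k g z = (\<integral>w. k (z - w) * g w \<partial>lborel)"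
  using integral_reflect[of "\<lambda>w. k (z - w) * g w" z] by (simp add: conv_def)

context
  fixes k :: "'a::euclidean_space \<Rightarrow> real" and g :: "'a \<Rightarrow> real" and P :: "'a set"
  assumes km[measurable]: "k \<in> borel_measurable borel" and k: "continuous_on (- {0}) k" and g: "offsupp g P"
begin

lemma gm[measurable]: "g \<in> borel_measurable borel" using g by (simp add: offsupp_def)

lemma offsupp_integrable: "z \<in> P \<Longrightarrow> integrable lborel (\<lambda>w. k (z - w) * g w)"
proof -
  assume "z \<in> P"
  from offsupp_dominated[OF k g this] obtain C \<delta> where C: "0 < \<delta>" "0 \<le> C"
    "\<And>y w. y \<in> ball z \<delta> \<Longrightarrow> \<bar>k (y - w) * g w\<bar> \<le> C * \<bar>g w\<bar>" by metis
  have "integrable lborel (\<lambda>w. C * \<bar>g w\<bar>)" using g by (auto simp: offsupp_def)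
  then show ?thesis
    by (rule Bochner_Integration.integrable_bound) (use C in auto)
qed

lemma conv_off_continuous: "continuous_on P (conv k g)"
proof -
  have oP: "open P" using g by (simp add: offsupp_def)
  show ?thesis unfolding continuous_on_eq_continuous_at[OF oP]
  proof
    fix z assume z: "z \<in> P"
    from offsupp_dominated[OF k g this] obtain C \<delta> where C: "0 < \<delta>" "0 \<le> C"
      "\<And>y w. y \<in> ball z \<delta> \<Longrightarrow> \<bar>k (y - w) * g w\<bar> \<le> C * \<bar>g w\<bar>" by metis
    have "((\<lambda>y. \<integral>w. k (y - w) * g w \<partial>lborel) \<longlongrightarrow> (\<integral>w. k (z - w) * g w \<partial>lborel)) (at z within ball z \<delta>)"
    proof (rule tendsto_integral_at)
      show "integrable lborel (\<lambda>w. C * \<bar>g w\<bar>)" using g by (auto simp: offsupp_def)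
      show "AE w in lborel. ((\<lambda>y. k (y - w) * g w) \<longlongrightarrow> k (z - w) * g w) (at z within ball z \<delta>)"
      proof (intro AE_I2)
        fix w
        show "((\<lambda>y. k (y - w) * g w) \<longlongrightarrow> k (z - w) * g w) (at z within ball z \<delta>)"
        proof (cases "w = z")
          case True
          then have "g w = 0" using g z by (auto simp: offsupp_def)
          then show ?thesis by simp
        next
          case False
          then have "isCont k (z - w)" using iffD1[OF continuous_on_eq_continuous_at[OF open_Compl[OF closed_singleton]] k] by simp
          moreover have "((\<lambda>y. y - w) \<longlongrightarrow> z - w) (at z within ball z \<delta>)" by (intro tendsto_intros)
          ultimately show ?thesis by (intro tendsto_mult_right) (rule isCont_tendsto_compose)
        qed
      qed
    qed (use C in auto)
    moreover have "at z within ball z \<delta> = at z" by (rule at_within_open) (use C in auto)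
    moreover have "conv k g = (\<lambda>y. \<integral>w. k (y - w) * g w \<partial>lborel)" by (rule ext) (rule conv_alt[OF km gm])
    ultimately show "isCont (conv k g) z" by (simp add: isCont_def)
  qed
qed

lemma conv_off_dird:
  assumes k0m[measurable]: "k0 \<in> borel_measurable borel" and k0: "continuous_on (- {0}) k0"
    and i0: "\<And>z. z \<in> P \<Longrightarrow> integrable lborel (\<lambda>w. k0 (z - w) * g w)"
    and d: "dird e k0 k (- {0})"
  shows "dird e (conv k0 g) (conv k g) P"
  unfolding dird_def
proof
  fix z assume z: "z \<in> P"
  from offsupp_dominated[OF k g this] obtain C \<delta> where C: "0 < \<delta>" "ball z \<delta> \<subseteq> P" "0 \<le> C"
    "\<And>y w. y \<in> ball z \<delta> \<Longrightarrow> \<bar>k (y - w) * g w\<bar> \<le> C * \<bar>g w\<bar>" by metis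
  have "((\<lambda>s. \<integral>w. k0 (z + s *\<^sub>R e - w) * g w \<partial>lborel) has_real_derivative (\<integral>w. k (z + 0 *\<^sub>R e - w) * g w \<partial>lborel)) (at 0)"
  proof (rule DERIV_integral[where r="\<delta> / (norm e + 1)" and w="\<lambda>w. C * \<bar>g w\<bar>"])
    show "0 < \<delta> / (norm e + 1)" using C(1) by (simp add: add_nonneg_pos)
    show "integrable lborel (\<lambda>w. C * \<bar>g w\<bar>)" using g by (auto simp: offsupp_def)
    fix s :: real assume s: "\<bar>s\<bar> < \<delta> / (norm e + 1)"
    have y: "z + s *\<^sub>R e \<in> ball z \<delta>" using small_shift[OF s] by simp
    then have yP: "z + s *\<^sub>R e \<in> P" using C by blast
    show "integrable lborel (\<lambda>w. k0 (z + s *\<^sub>R e - w) * g w)" by (rule i0[OF yP])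
    fix w
    show "\<bar>k (z + s *\<^sub>R e - w) * g w\<bar> \<le> C * \<bar>g w\<bar>" by (rule C(4)[OF y])
    show "((\<lambda>s. k0 (z + s *\<^sub>R e - w) * g w) has_real_derivative k (z + s *\<^sub>R e - w) * g w) (at s)"
    proof (cases "w = z + s *\<^sub>R e")
      case True
      then have "g w = 0" using g yP by (auto simp: offsupp_def)
      then show ?thesis by simp
    next
      case False
      have "((\<lambda>s. k0 ((z - w) + s *\<^sub>R e)) has_real_derivative k ((z - w) + s *\<^sub>R e)) (at s)"
        by (rule dird_line[OF d]) (use False in \<open>auto simp: algebra_simps\<close>)
      then show ?thesis by (intro DERIV_cmult_right) (simp add: algebra_simps)
    qed
  qed
  then show "((\<lambda>s. conv k0 g (z + s *\<^sub>R e)) has_real_derivative conv k g z) (at 0)"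
    by (simp add: conv_alt)
qed

end

section \<open>The heat kernel\<close>

text \<open>The heat kernel in dimension n is the case a = n/2, up to normalisation. The exponent is
  a parameter because derivatives are polynomials in the space variable times members with larger
  \<open>a\<close>.\<close>

definition hk :: "real \<Rightarrow> (real ^ 'n::finite) \<times> real \<Rightarrow> real" where
  "hk a z = (if snd z > 0 then snd z powr (- a) * exp (- (fst z \<bullet> fst z) / (4 * snd z)) else 0)"

lemma powr_exp_bound:
  assumes "0 \<le> b"
  obtains C :: real where "0 \<le> C" "\<And>x. 0 < x \<Longrightarrow> x powr b * exp (- x / 4) \<le> C"
proof (cases "b = 0")
  case True
  show thesis by (rule that[of 1]) (use True in auto)
next
  case False
  then have b: "b > 0" using assms by simp
  have "x powr b * exp (- x / 4) \<le> (4 * b) powr b" if x: "x > 0" for x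
  proof -
    have "x / (4 * b) \<le> exp (x / (4 * b))" using exp_ge_add_one_self[of "x / (4 * b)"] by linarith
    then have "(x / (4 * b)) powr b \<le> exp (x / (4 * b)) powr b" using x b by (intro powr_mono2) auto
    also have "exp (x / (4 * b)) powr b = exp (x / 4)" using b by (simp add: powr_def)
    finally have "x powr b \<le> (4 * b) powr b * exp (x / 4)" using x b by (simp add: powr_divide field_simps)
    then have "x powr b * exp (- x / 4) \<le> (4 * b) powr b * exp (x / 4) * exp (- x / 4)" by (intro mult_right_mono) auto
    also have "\<dots> = (4 * b) powr b" by (simp flip: exp_add add: mult.assoc)
    finally show ?thesis .
  qed
  then show thesis by (intro that[of "(4 * b) powr b"]) auto
qed

text \<open>With x = |y|^2/r the Gaussian factor is at most C x^-b for any b \<ge> 0, so the single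
  singularity at the origin can be distributed between powers of r and of |y| at will.\<close>

lemma hk_bound:
  fixes a b :: real
  assumes b: "0 \<le> b"
  obtains C where "0 \<le> C" "\<And>(y::real^'n::finite) r. y \<noteq> 0 \<Longrightarrow> r > 0 \<Longrightarrow>
      hk a (y, r) \<le> C * r powr (b - a) * norm y powr (- 2 * b)"
proof -
  obtain C :: real where C: "0 \<le> C" "\<And>x. 0 < x \<Longrightarrow> x powr b * exp (- x / 4) \<le> C" using powr_exp_bound[OF b] by blast
  show thesis
  proof (rule that[OF C(1)])
    fix y :: "real ^ 'n" and r :: real assume y: "y \<noteq> 0" and r: "r > 0"
    define x where "x = (norm y)\<^sup>2 / r"
    have x: "x > 0" using y r by (simp add: x_def)
    have xb: "x powr b = norm y powr (2 * b) * r powr (- b)"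
    proof -
      have "((norm y)\<^sup>2) powr b = (norm y powr 2) powr b" using y by simp
      also have "\<dots> = norm y powr (2 * b)" by (rule powr_powr)
      finally show ?thesis unfolding x_def using y r by (simp add: powr_divide powr_minus_divide)
    qed
    have "hk a (y, r) = r powr (- a) * exp (- x / 4)"
      using r by (simp add: hk_def x_def dot_square_norm)
    also have "exp (- x / 4) \<le> C * x powr (- b)"
      using C(2)[OF x] x by (simp add: powr_minus field_simps)
    then have "r powr (- a) * exp (- x / 4) \<le> r powr (- a) * (C * x powr (- b))" by (intro mult_left_mono) auto
    also have "\<dots> = C * r powr (b - a) * norm y powr (- 2 * b)"
    proof -
      have 1: "x powr (- b) = norm y powr (- 2 * b) * r powr b" using xb by (simp add: powr_minus)
      have 2: "r powr (b - a) = r powr (- a) * r powr b" by (simp flip: powr_add)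
      show ?thesis unfolding 1 2 by (simp only: mult_ac)
    qed
    finally show "hk a (y, r) \<le> C * r powr (b - a) * norm y powr (- 2 * b)" .
  qed
qed

lemma hk_nonneg: "0 \<le> hk a z" by (simp add: hk_def)

lemma hk_bound2:
  obtains C b where "0 \<le> C" "\<And>(y::real^'n::finite) r. y \<noteq> 0 \<Longrightarrow> r \<le> 1 \<Longrightarrow> hk a (y, r) \<le> C * r\<^sup>2 * norm y powr b"
proof -
  \<comment> \<open>This makes the exponent of r at least 2: enough for \<open>hk a\<close> to tend
    to 0 at points (y, 0) with y \<noteq> 0, and, after division by r, for the time derivative there
    to be 0.\<close>
  let ?b = "\<bar>a\<bar> + 2"
  obtain C where C: "0 \<le> C" "\<And>(y::real^'n) r. y \<noteq> 0 \<Longrightarrow> r > 0 \<Longrightarrow>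
      hk a (y, r) \<le> C * r powr (?b - a) * norm y powr (- 2 * ?b)" using hk_bound[of ?b a] by auto
  show thesis
  proof (rule that[OF C(1)])
    fix y :: "real^'n" and r :: real assume y: "y \<noteq> 0" and r: "r \<le> 1"
    show "hk a (y, r) \<le> C * r\<^sup>2 * norm y powr (- 2 * ?b)"
    proof (cases "r > 0")
      case True
      have "r powr (?b - a) \<le> r powr 2" using True r by (intro powr_mono') auto
      then have "r powr (?b - a) \<le> r\<^sup>2" using True by simp
      then have "C * r powr (?b - a) * norm y powr (- 2 * ?b) \<le> C * r\<^sup>2 * norm y powr (- 2 * ?b)"
        using C(1) by (intro mult_right_mono mult_left_mono) auto
      then show ?thesis using C(2)[OF y True] by linarith
    qed (use C in \<open>simp add: hk_def\<close>)
  qed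
qed

lemma hk_measurable: "hk a \<in> borel_measurable borel"
proof -
  have "(\<lambda>z::(real^'n) \<times> real. if snd z > 0 then snd z powr (- a) * exp (- (fst z \<bullet> fst z) / (4 * snd z)) else 0)
    \<in> borel_measurable (borel \<Otimes>\<^sub>M borel)" by measurable
  then show ?thesis unfolding hk_def[abs_def] borel_prod .
qed

lemma nonzero_cases: "z \<noteq> 0 \<Longrightarrow> snd z > 0 \<or> snd z < 0 \<or> (snd z = (0::real) \<and> fst z \<noteq> (0::real^'n::finite))"
  by (cases z) (auto simp: prod_eq_iff)

lemma hk_isCont:
  fixes z :: "(real ^ 'n::finite) \<times> real"
  assumes "z \<noteq> 0"
  shows "isCont (hk a) z"
proof -
  from nonzero_cases[OF assms] consider "snd z > 0" | "snd z < 0" | "snd z = 0" "fst z \<noteq> 0" by blast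
  then show ?thesis
  proof cases
    case 1
    let ?S = "{z::(real ^ 'n) \<times> real. 0 < snd z}"
    have o: "open ?S" by (intro open_Collect_less continuous_intros)
    have "continuous_on ?S (\<lambda>z. snd z powr (- a) * exp (- (fst z \<bullet> fst z) / (4 * snd z)))"
      by (intro continuous_intros) auto
    then have "continuous_on ?S (hk a)" by (rule continuous_on_eq) (simp add: hk_def)
    then show ?thesis using continuous_on_eq_continuous_at[OF o] 1 by blast
  next
    case 2
    let ?S = "{z::(real ^ 'n) \<times> real. snd z < 0}"
    have o: "open ?S" by (intro open_Collect_less continuous_intros)
    have "continuous_on ?S (hk a)" by (rule continuous_on_eq[OF continuous_on_const[of _ 0]]) (simp add: hk_def)
    then show ?thesis using continuous_on_eq_continuous_at[OF o] 2 by blast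
  next
    case 3
    obtain C b where C: "0 \<le> C" "\<And>(y::real^'n::finite) r. y \<noteq> 0 \<Longrightarrow> r \<le> 1 \<Longrightarrow> hk a (y, r) \<le> C * r\<^sup>2 * norm y powr b"
      using hk_bound2 by blast
    let ?S = "{z::(real ^ 'n) \<times> real. snd z < 1} \<inter> {z. fst z \<noteq> 0}"
    have o: "open ?S" by (intro open_Int open_Collect_less open_Collect_neq continuous_intros)
    have "(hk a \<longlongrightarrow> 0) (at z)"
    proof (rule tendsto_sandwich[OF _ _ tendsto_const])
      show "\<forall>\<^sub>F z in at z. 0 \<le> hk a z" by (simp add: hk_nonneg)
      have "\<forall>\<^sub>F z in at z. z \<in> ?S" using o 3 by (intro eventually_at_in_open') auto
      then show "\<forall>\<^sub>F z in at z. hk a z \<le> C * (snd z)\<^sup>2 * norm (fst z) powr b"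
        by eventually_elim (use C(2) in \<open>auto simp: less_imp_le\<close>)
      have "((\<lambda>z. C * (snd z)\<^sup>2 * norm (fst z) powr b) \<longlongrightarrow> C * (snd z)\<^sup>2 * norm (fst z) powr b) (at z)"
        using 3 by (intro tendsto_intros) auto
      then show "((\<lambda>z. C * (snd z)\<^sup>2 * norm (fst z) powr b) \<longlongrightarrow> 0) (at z)" using 3 by simp
    qed
    moreover have "hk a z = 0" using 3 by (simp add: hk_def)
    ultimately show ?thesis by (simp add: isCont_def)
  qed
qed

lemma hk_continuous: "continuous_on (- {0}) (hk a)"
  by (intro continuous_at_imp_continuous_on ballI hk_isCont) auto

text \<open>No point is excluded, not even the origin: a spatial line stays at one time, and
  \<open>hk a\<close> vanishes identically at times \<le> 0.\<close>

lemma hk_dird_x: "dird (e_x (i::'n::finite)) (hk a) (\<lambda>z. - (1/2) * (fst z $ i * hk (a + 1) z)) UNIV"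
  unfolding dird_def
proof
  fix z :: "(real ^ 'n) \<times> real"
  obtain y r where z: "z = (y, r)" by (cases z)
  show "((\<lambda>s. hk a (z + s *\<^sub>R e_x i)) has_real_derivative - (1/2) * (fst z $ i * hk (a + 1) z)) (at 0)"
  proof (cases "r > 0")
    case True
    have feq: "hk a (z + s *\<^sub>R e_x i) = r powr (- a) * exp (- (y \<bullet> y + 2 * s * y $ i + s\<^sup>2) / (4 * r))" for s
      using True by (simp add: z hk_def e_x_def inner_add_left inner_add_right inner_axis inner_axis' inner_axis_axis power2_eq_square algebra_simps)
    have der: "((\<lambda>s. r powr (- a) * exp (- (y \<bullet> y + 2 * s * y $ i + s\<^sup>2) / (4 * r))) has_real_derivative
       r powr (- a) * (exp (- (y \<bullet> y) / (4 * r)) * (- (2 * y $ i) / (4 * r)))) (at 0)"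
      using True by (auto intro!: derivative_eq_intros)
    have deq: "r powr (- a) * (exp (- (y \<bullet> y) / (4 * r)) * (- (2 * y $ i) / (4 * r))) = - (1/2) * (fst z $ i * hk (a + 1) z)"
      using True by (simp add: z hk_def powr_diff)
    show ?thesis unfolding feq using der unfolding deq .
  qed (simp add: z hk_def e_x_def)
qed

text \<open>The origin is excluded here, since along the time axis \<open>hk a\<close> jumps from 0
  to the singular power r^(-a). At other points of time 0 both one-sided derivatives are 0.\<close>

lemma hk_dird_t: "dird e_t (hk a) (\<lambda>z. - a * hk (a + 1) z + 1/4 * ((fst z \<bullet> fst z) * hk (a + 2) z)) (- {0::(real ^ 'n::finite) \<times> real})"
  unfolding dird_def
proof
  fix z :: "(real ^ 'n) \<times> real" assume z0: "z \<in> - {0}"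
  obtain y r where z: "z = (y, r)" by (cases z)
  have e: "z + s *\<^sub>R e_t = (y, r + s)" for s by (simp add: z e_t_def)
  let ?D = "- a * hk (a + 1) z + 1/4 * ((fst z \<bullet> fst z) * hk (a + 2) z)"
  consider "r > 0" | "r < 0" | "r = 0" "y \<noteq> 0" using nonzero_cases[of z] z0 by (auto simp: z)
  then show "((\<lambda>s. hk a (z + s *\<^sub>R e_t)) has_real_derivative ?D) (at 0)"
  proof cases
    case 1
    have "((\<lambda>s. (r + s) powr (- a) * exp (- (y \<bullet> y) / (4 * (r + s)))) has_real_derivative
       - a * r powr (- a - 1) * exp (- (y \<bullet> y) / (4 * r)) + r powr (- a) * (exp (- (y \<bullet> y) / (4 * r)) * ((y \<bullet> y) * 4 / (4 * r)\<^sup>2))) (at 0)"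
      using 1 by (auto intro!: derivative_eq_intros simp: power2_eq_square)
    moreover have "- a * r powr (- a - 1) * exp (- (y \<bullet> y) / (4 * r)) + r powr (- a) * (exp (- (y \<bullet> y) / (4 * r)) * ((y \<bullet> y) * 4 / (4 * r)\<^sup>2)) = ?D"
    proof -
      have "- (a + 1) = - a - 1" by simp
      then have 1: "r powr (- (a + 1)) = r powr (- a - 1)" by (rule arg_cong)
      have "r powr (- (a + 2)) = r powr (- a) * r powr (- 2)" by (simp flip: powr_add)
      also have "r powr (- 2) = 1 / r\<^sup>2" using \<open>r > 0\<close> by (simp add: powr_minus_divide)
      finally have 2: "r powr (- (a + 2)) = r powr (- a) / r\<^sup>2" by simp
      show ?thesis using \<open>r > 0\<close> unfolding z hk_def fst_conv snd_conv 1 2 by (simp add: power_mult_distrib)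
    qed
    ultimately have d: "((\<lambda>s. (r + s) powr (- a) * exp (- (y \<bullet> y) / (4 * (r + s)))) has_real_derivative ?D) (at 0)" by simp
    have "\<forall>\<^sub>F s in nhds 0. s \<in> {- r<..}" using 1 by (intro eventually_nhds_in_open) auto
    then have "\<forall>\<^sub>F s in nhds 0. hk a (z + s *\<^sub>R e_t) = (r + s) powr (- a) * exp (- (y \<bullet> y) / (4 * (r + s)))"
      by eventually_elim (simp add: e hk_def)
    from iffD2[OF DERIV_cong_ev[OF refl this refl] d] show ?thesis .
  next
    case 2
    then have D: "?D = 0" by (simp add: z hk_def)
    have "\<forall>\<^sub>F s in nhds 0. s \<in> {..< - r}" using 2 by (intro eventually_nhds_in_open) auto
    then have "\<forall>\<^sub>F s in nhds 0. hk a (z + s *\<^sub>R e_t) = 0"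
      by eventually_elim (simp add: e hk_def)
    from iffD2[OF DERIV_cong_ev[OF refl this refl] DERIV_const] show ?thesis unfolding D .
  next
    case 3
    then have D: "?D = 0" by (simp add: z hk_def)
    obtain C b where C: "0 \<le> C" "\<And>(y::real^'n::finite) r. y \<noteq> 0 \<Longrightarrow> r \<le> 1 \<Longrightarrow> hk a (y, r) \<le> C * r\<^sup>2 * norm y powr b"
      using hk_bound2 by blast
    have "(\<lambda>h. hk a (y, h) / h) \<midarrow>0\<rightarrow> 0"
    proof (rule Lim_null_comparison)
      have "\<forall>\<^sub>F h in at (0::real). h \<in> {..<1}" by (intro eventually_at_in_open') auto
      then show "\<forall>\<^sub>F h in at 0. norm (hk a (y, h) / h) \<le> C * norm y powr b * \<bar>h\<bar>"
      proof eventually_elim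
        case (elim h)
        then have "hk a (y, h) \<le> C * h\<^sup>2 * norm y powr b" using C(2) 3 by auto
        then have "hk a (y, h) / \<bar>h\<bar> \<le> C * h\<^sup>2 * norm y powr b / \<bar>h\<bar>" by (intro divide_right_mono) auto
        also have "\<dots> = C * norm y powr b * \<bar>h\<bar>" by (cases "h = 0") (auto simp: power2_eq_square abs_if)
        finally show ?case by (simp add: hk_nonneg)
      qed
      have "((\<lambda>h. C * norm y powr b * \<bar>h\<bar>) \<longlongrightarrow> C * norm y powr b * \<bar>0\<bar>) (at (0::real))" by (intro tendsto_intros)
      then show "((\<lambda>h. C * norm y powr b * \<bar>h\<bar>) \<longlongrightarrow> 0) (at (0::real))" by simp
    qed
    moreover have "hk a (y, 0) = 0" by (simp add: hk_def)
    ultimately have "((\<lambda>s. hk a (y, s)) has_real_derivative 0) (at 0)" by (simp add: DERIV_def)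
    then show ?thesis unfolding D e using 3 by simp
  qed
qed

text \<open>Closed under differentiation and containing the heat kernel and its gradient, which gives smoothness of
  potentials off the support of their density.\<close>

inductive_set hkp :: "((real ^ 'n::finite) \<times> real \<Rightarrow> real) set" where
  hk: "hk a \<in> hkp"
| coord: "f \<in> hkp \<Longrightarrow> (\<lambda>z. fst z $ i * f z) \<in> hkp"
| add: "f \<in> hkp \<Longrightarrow> g \<in> hkp \<Longrightarrow> (\<lambda>z. f z + g z) \<in> hkp"
| cmult: "f \<in> hkp \<Longrightarrow> (\<lambda>z. c * f z) \<in> hkp"

lemma hkp_continuous: "f \<in> hkp \<Longrightarrow> continuous_on (- {0}) f"
  by (induction rule: hkp.induct) (auto intro!: continuous_intros hk_continuous)

lemma coord_measurable: "(\<lambda>z::(real ^ 'n::finite) \<times> real. fst z $ i) \<in> borel_measurable borel"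
  by (intro borel_measurable_continuous_onI continuous_intros)

lemma hkp_measurable: "f \<in> hkp \<Longrightarrow> f \<in> borel_measurable borel"
  by (induction rule: hkp.induct)
     (assumption | rule hk_measurable borel_measurable_times borel_measurable_add borel_measurable_const coord_measurable)+

lemma coord_dird:
  "dird (e_x i) (\<lambda>z::(real ^ 'n::finite) \<times> real. fst z $ j) (\<lambda>z. if i = j then 1 else 0) S"
  "dird e_t (\<lambda>z::(real ^ 'n) \<times> real. fst z $ j) (\<lambda>z. 0) S"
  unfolding dird_def e_x_def e_t_def by (auto simp: axis_def intro!: derivative_eq_intros)

lemma hkp_dird_x: "f \<in> hkp \<Longrightarrow> \<exists>f'\<in>hkp. dird (e_x i) f f' UNIV"
proof (induction rule: hkp.induct)
  case (hk a)
  show ?case using hk_dird_x[of i a] hkp.cmult[OF hkp.coord[OF hkp.hk]] by blast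
next
  case (coord f j)
  then obtain f' where f': "f' \<in> hkp" "dird (e_x i) f f' UNIV" by blast
  have "dird (e_x i) (\<lambda>z. fst z $ j * f z) (\<lambda>z. (if i = j then 1 else 0) * f z + fst z $ j * f' z) UNIV"
    by (rule dird_mult[OF coord_dird(1) f'(2)])
  moreover have "(\<lambda>z. (if i = j then 1 else 0) * f z + fst z $ j * f' z) \<in> hkp"
    by (rule hkp.add[OF hkp.cmult[OF coord.hyps] hkp.coord[OF f'(1)]])
  ultimately show ?case by blast
next
  case (add f g)
  then show ?case using dird_add hkp.add by blast
next
  case (cmult f c)
  then show ?case using dird_cmult hkp.cmult by blast
qed

lemma hkp_dird_t: "f \<in> hkp \<Longrightarrow> \<exists>f'\<in>hkp. dird e_t f f' (- {0})"
proof (induction rule: hkp.induct)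
  case (hk a)
  have eq: "(\<lambda>z::(real ^ 'a) \<times> real. - a * hk (a + 1) z + 1/4 * ((fst z \<bullet> fst z) * hk (a + 2) z))
    = (\<lambda>z. - a * hk (a + 1) z + 1/4 * (\<Sum>i\<in>UNIV. fst z $ i * (fst z $ i * hk (a + 2) z)))"
    by (simp add: inner_vec_def sum_distrib_right mult.assoc)
  have "(\<lambda>z::(real ^ 'a) \<times> real. \<Sum>i\<in>X. fst z $ i * (fst z $ i * hk (a + 2) z)) \<in> hkp" if "finite X" for X
    using that
  proof (induction X rule: finite_induct)
    case empty
    show ?case using hkp.cmult[OF hkp.hk, of 0] by simp
  next
    case (insert x X)
    then show ?case using hkp.add[OF hkp.coord[OF hkp.coord[OF hkp.hk]] insert.IH] by simp
  qed
  then have "(\<lambda>z::(real ^ 'a) \<times> real. - a * hk (a + 1) z + 1/4 * ((fst z \<bullet> fst z) * hk (a + 2) z)) \<in> hkp"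
    unfolding eq by (intro hkp.add hkp.cmult hkp.hk) simp
  then show ?case using hk_dird_t[of a] by blast
next
  case (coord f j)
  then obtain f' where f': "f' \<in> hkp" "dird e_t f f' (- {0})" by blast
  have "dird e_t (\<lambda>z. fst z $ j * f z) (\<lambda>z. 0 * f z + fst z $ j * f' z) (- {0})"
    by (rule dird_mult[OF coord_dird(2) f'(2)])
  then have "dird e_t (\<lambda>z. fst z $ j * f z) (\<lambda>z. fst z $ j * f' z) (- {0})" by simp
  then show ?case using hkp.coord[OF f'(1)] by blast
next
  case (add f g)
  then show ?case using dird_add hkp.add by blast
next
  case (cmult f c)
  then show ?case using dird_cmult hkp.cmult by blast
qed

text \<open>Continuity along spatial lines holds even through the origin, where the kernel as a
  function of space-time is singular. This is what the fundamental theorem along lines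
  consumes.\<close>

lemma hkp_line_continuous: "f \<in> hkp \<Longrightarrow> continuous_on UNIV (\<lambda>s. f (w + s *\<^sub>R e_x i))"
proof (induction rule: hkp.induct)
  case (hk a)
  then show ?case
  proof (cases "snd w > 0")
    case True
    then have feq: "(\<lambda>s. hk a (w + s *\<^sub>R e_x i)) = (\<lambda>s. snd w powr (- a) *
        exp (- ((fst w + s *\<^sub>R axis i 1) \<bullet> (fst w + s *\<^sub>R axis i 1)) / (4 * snd w)))"
      by (simp add: hk_def e_x_def)
    show ?thesis unfolding feq using True by (intro continuous_intros) auto
  qed (simp add: hk_def e_x_def)
qed (auto intro!: continuous_intros)

subsection \<open>Local integrability\<close>

text \<open>The bound separates the variables: |y|^-q is locally integrable for q < n and r^-s for s
  < 1. Both are powers of the distance to a point, a set of covering dimension 0.\<close>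

lemma kernel_locint:
  fixes k :: "(real ^ 'n::finite) \<times> real \<Rightarrow> real"
    and q s :: real
  assumes m: "k \<in> borel_measurable borel" and q: "0 \<le> q" "q < CARD('n)" and s: "0 \<le> s" "s < 1"
    and b: "\<And>y r. y \<noteq> 0 \<Longrightarrow> r > 0 \<Longrightarrow> \<bar>k (y, r)\<bar> \<le> C * r powr (- s) * norm y powr (- q)"
    and 0: "\<And>y r. r \<le> 0 \<Longrightarrow> k (y, r) = 0" and C: "0 \<le> C"
  shows "locint k"
  unfolding locint_def
proof (intro conjI allI m)
  fix R :: real
  let ?f = "\<lambda>y::real^'n. indicator (cball 0 R) y * infdist y {0} powr (- q) :: real"
  let ?g = "\<lambda>r::real. indicator (cball 0 R) r * infdist r {0} powr (- s) :: real"
  have f: "integrable lborel ?f"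
    by (rule integrable_infdist_powr[of 0]) (use q in \<open>auto intro: cov_singleton\<close>)
  have g: "integrable lborel ?g"
    by (rule integrable_infdist_powr[of 0]) (use s in \<open>auto intro: cov_singleton\<close>)
  have fm: "(\<lambda>z. ?f (fst z) * ?g (snd z)) \<in> borel_measurable (lborel \<Otimes>\<^sub>M lborel)"
    by (rule borel_measurable_times[OF measurable_compose[OF measurable_fst borel_measurable_integrable[OF f]]
          measurable_compose[OF measurable_snd borel_measurable_integrable[OF g]]])
  have "integrable (lborel \<Otimes>\<^sub>M lborel) (\<lambda>z. ?f (fst z) * ?g (snd z))"
  proof (rule lborel_pair.Fubini_integrable[OF fm])
    have "(\<lambda>y. \<integral>r. norm (?f (fst (y, r)) * ?g (snd (y, r))) \<partial>lborel) = (\<lambda>y. ?f y * (\<integral>r. ?g r \<partial>lborel))"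
      by (auto simp: abs_mult)
    then show "integrable lborel (\<lambda>y. \<integral>r. norm (?f (fst (y, r)) * ?g (snd (y, r))) \<partial>lborel)"
      using integrable_mult_left[OF f] by simp
    show "AE y in lborel. integrable lborel (\<lambda>r. ?f (fst (y, r)) * ?g (snd (y, r)))"
    proof (intro AE_I2)
      fix y :: "real ^ 'n"
      have "integrable lborel (\<lambda>r. ?f y * ?g r)" by (rule integrable_mult_right) (rule g)
      then show "integrable lborel (\<lambda>r. ?f (fst (y, r)) * ?g (snd (y, r)))" by (simp only: fst_conv snd_conv)
    qed
  qed
  then have fg: "integrable lborel (\<lambda>z. C * (?f (fst z) * ?g (snd z)))" by (simp add: lborel_prod)
  have "{z::(real ^ 'n) \<times> real. fst z = 0} \<in> null_sets lborel"
  proof -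
    obtain i :: 'n where True by simp
    have cl: "closed {z::(real ^ 'n) \<times> real. fst z = 0}" by (intro closed_Collect_eq continuous_intros)
    have "negligible {z::(real ^ 'n) \<times> real. (axis i 1, 0) \<bullet> z = 0}"
      by (rule negligible_hyperplane) (auto simp: axis_eq_0_iff zero_prod_def)
    then have "negligible {z::(real ^ 'n) \<times> real. fst z = 0}"
      by (rule negligible_subset) (auto simp: inner_prod_def)
    then show ?thesis using cl by (simp add: negligible_iff_null_sets null_sets_completion_iff)
  qed
  then have ae: "AE z in lborel. z \<notin> {z::(real ^ 'n) \<times> real. fst z = 0}" by (rule AE_not_in)
  show "integrable lborel (\<lambda>w. indicator (cball 0 R) w * k w)"
  proof (rule Bochner_Integration.integrable_bound[OF fg])
    show "AE z in lborel. norm (indicator (cball 0 R) z * k z) \<le> norm (C * (?f (fst z) * ?g (snd z)))"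
      using ae
    proof eventually_elim
      case (elim z)
      obtain y r where z: "z = (y, r)" by (cases z)
      show ?case
      proof (cases "r > 0 \<and> z \<in> cball 0 R")
        case True
        then have yr: "norm y \<le> R" "\<bar>r\<bar> \<le> R" using norm_fst_le[of y r] norm_snd_le[where x=y and y=r] by (auto simp: z)
        have "\<bar>k z\<bar> \<le> C * r powr (- s) * norm y powr (- q)" using b[of y r] True elim by (auto simp: z)
        also have "\<dots> = C * (?f (fst z) * ?g (snd z))" using yr True C by (simp add: z dist_norm)
        finally show ?thesis using True C by (simp add: abs_mult)
      qed (use 0 in \<open>auto simp: z\<close>)
    qed
    show "(\<lambda>w. indicator (cball 0 R) w * k w) \<in> borel_measurable lborel"
    proof -
      have c: "cball 0 R \<in> sets (borel :: ((real ^ 'n) \<times> real) measure)" by (rule borel_closed[OF closed_cball])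
      show ?thesis using borel_measurable_times[OF borel_measurable_indicator[OF c] m] by (simp only: measurable_lborel2)
    qed
  qed
qed

text \<open>This is (4 \<pi>)^(n/2), kept as an integral: in the limit r \<rightarrow> 0 of the
  rescaled kernel the same integral appears and cancels. The \<open>itself\<close> argument only
  carries the dimension.\<close>

definition hmass :: "'n::finite itself \<Rightarrow> real" where
  "hmass (_::'n itself) = (\<integral>y. exp (- (y \<bullet> y) / 4) \<partial>(lborel :: (real ^ 'n) measure))"

definition Gam :: "(real ^ 'n::finite) \<times> real \<Rightarrow> real" where
  "Gam z = 1 / hmass TYPE('n) * hk (CARD('n) / 2) z"

definition Gamx :: "'n \<Rightarrow> (real ^ 'n::finite) \<times> real \<Rightarrow> real" where
  "Gamx i z = 1 / hmass TYPE('n) * (- (1/2) * (fst z $ i * hk (CARD('n) / 2 + 1) z))"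

lemma Gam_hkp: "Gam \<in> hkp"
  unfolding Gam_def[abs_def] by (intro hkp.intros)

lemma Gamx_hkp: "Gamx i \<in> hkp"
  unfolding Gamx_def[abs_def] by (intro hkp.intros)

lemma Gam_dird_x: "dird (e_x i) Gam (Gamx i) UNIV"
  unfolding Gam_def[abs_def] Gamx_def[abs_def] by (intro dird_cmult hk_dird_x)

lemma gauss_integrable: "integrable lborel (\<lambda>y::real ^ 'n::finite. exp (- (y \<bullet> y) / 4))"
proof (rule integrableI_bounded)
  show "(\<lambda>y::real ^ 'n. exp (- (y \<bullet> y) / 4)) \<in> borel_measurable lborel" by measurable
  have n: "normal_density 0 (sqrt 2) x = 1 / sqrt (4 * pi) * exp (- x\<^sup>2 / 4)" for x
    by (simp add: normal_density_def)
  have 1: "integrable lborel (\<lambda>x::real. exp (- x\<^sup>2 / 4))"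
  proof -
    have "integrable lborel (\<lambda>x. 1 / sqrt (4 * pi) * exp (- x\<^sup>2 / 4))"
      using integrable_normal_density[of "sqrt 2" 0] unfolding n by simp
    from integrable_mult_right[OF this, of "sqrt (4 * pi)"]
    have "integrable lborel (\<lambda>x. sqrt (4 * pi) * (1 / sqrt (4 * pi) * exp (- x\<^sup>2 / 4)))" .
    moreover have "c * (1 / c * y) = y" if "c \<noteq> 0" for c y :: real using that by simp
    from this[of "sqrt (4 * pi)"] have "sqrt (4 * pi) * (1 / sqrt (4 * pi) * y) = y" for y by simp
    ultimately show ?thesis by (simp only:)
  qed
  then have 2: "(\<integral>\<^sup>+x. ennreal (exp (- x\<^sup>2 / 4)) \<partial>lborel) < \<infinity>" by (simp add: integrable_iff_bounded)
  have "(\<integral>\<^sup>+(y::real ^ 'n). ennreal (norm (exp (- (y \<bullet> y) / 4))) \<partial>lborel)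
    = (\<integral>\<^sup>+(y::real ^ 'n). (\<Prod>b\<in>Basis. ennreal (exp (- (y \<bullet> b)\<^sup>2 / 4))) \<partial>lborel)"
  proof (intro nn_integral_cong)
    fix y :: "real ^ 'n"
    have "- (y \<bullet> y) / 4 = (\<Sum>b\<in>Basis. - (y \<bullet> b)\<^sup>2 / 4)"
      by (subst euclidean_inner) (simp add: power2_eq_square sum_negf sum_divide_distrib)
    then have e: "exp (- (y \<bullet> y) / 4) = (\<Prod>b\<in>Basis. exp (- (y \<bullet> b)\<^sup>2 / 4))" by (simp only: exp_sum[OF finite_Basis])
    have "ennreal (norm (exp (- (y \<bullet> y) / 4))) = ennreal (exp (- (y \<bullet> y) / 4))" by simp
    also have "\<dots> = (\<Prod>b\<in>Basis. ennreal (exp (- (y \<bullet> b)\<^sup>2 / 4)))"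
      unfolding e by (rule prod_ennreal[symmetric]) simp
    finally show "ennreal (norm (exp (- (y \<bullet> y) / 4))) = (\<Prod>b\<in>Basis. ennreal (exp (- (y \<bullet> b)\<^sup>2 / 4)))" .
  qed
  also have "\<dots> = (\<Prod>b\<in>(Basis :: (real ^ 'n) set). (\<integral>\<^sup>+x. ennreal (exp (- x\<^sup>2 / 4)) \<partial>lborel))"
    by (rule nn_integral_lborel_prod) auto
  also have "\<dots> < \<infinity>" using 2 by (simp add: power_less_top_ennreal)
  finally show "(\<integral>\<^sup>+(y::real ^ 'n). ennreal (norm (exp (- (y \<bullet> y) / 4))) \<partial>lborel) < \<infinity>" .
qed

lemma hmass_pos: "hmass TYPE('n::finite) > 0"
proof -
  have "hmass TYPE('n) \<noteq> 0"
  proof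
    assume "hmass TYPE('n) = 0"
    then have 0: "(\<integral>y. exp (- (y \<bullet> y) / 4) \<partial>(lborel :: (real ^ 'n) measure)) = 0" by (simp only: hmass_def)
    have "AE y in (lborel :: (real ^ 'n) measure). exp (- (y \<bullet> y) / 4) = 0"
      by (rule iffD1[OF integral_nonneg_eq_0_iff_AE[OF gauss_integrable] 0]) simp
    then have "AE y in (lborel :: (real ^ 'n) measure). False" by eventually_elim simp
    then have "UNIV \<in> null_sets (lborel :: (real ^ 'n) measure)" by (simp add: AE_iff_null)
    from null_setsD1[OF this] show False by (simp add: emeasure_lborel_UNIV)
  qed
  moreover have "hmass TYPE('n) \<ge> 0" unfolding hmass_def by simp
  ultimately show ?thesis by simp
qed

lemma Gam_nonneg: "0 \<le> Gam (z :: (real ^ 'n::finite) \<times> real)"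
  unfolding Gam_def using hmass_pos[where 'n='n] by (intro mult_nonneg_nonneg hk_nonneg) (simp add: less_imp_le)

lemma card_ge_1: "real CARD('n::finite) \<ge> 1"
  using zero_less_card_finite[where 'a='n] by linarith

lemma Gam_locint: "locint (Gam :: (real ^ 'n::finite) \<times> real \<Rightarrow> real)"
proof -
  let ?n = "real CARD('n)"
  \<comment> \<open>This is the value of b in \<open>hk_bound\<close>. With a = n/2, integrability
    in r asks for b > n/2 - 1 and integrability in y for b < n/2; the midpoint is taken.\<close>
  have "0 \<le> ?n / 2 - 1 / 2" using card_ge_1[where 'n='n] by simp
  then obtain C where C: "0 \<le> C" "\<And>(y::real^'n) r. y \<noteq> 0 \<Longrightarrow> r > 0 \<Longrightarrow>
      hk (?n / 2) (y, r) \<le> C * r powr (?n / 2 - 1 / 2 - ?n / 2) * norm y powr (- 2 * (?n / 2 - 1 / 2))"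
    using hk_bound by metis
  show ?thesis
  proof (rule kernel_locint[of _ "?n - 1" "1 / 2" "1 / hmass TYPE('n) * C"])
    fix y :: "real ^ 'n" and r :: real assume y: "y \<noteq> 0" "r > 0"
    have e: "?n / 2 - 1 / 2 - ?n / 2 = - (1 / 2)" "- 2 * (?n / 2 - 1 / 2) = - (?n - 1)" by auto
    have "hk (?n / 2) (y, r) \<le> C * r powr (- (1 / 2)) * norm y powr (- (?n - 1))" using C(2)[OF y] unfolding e .
    then have "Gam (y, r) \<le> 1 / hmass TYPE('n) * (C * r powr (- (1 / 2)) * norm y powr (- (?n - 1)))"
      unfolding Gam_def using hmass_pos[where 'n='n] by (intro mult_left_mono) auto
    then show "\<bar>Gam (y, r)\<bar> \<le> 1 / hmass TYPE('n) * C * r powr (- (1 / 2)) * norm y powr (- (?n - 1))"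
      using Gam_nonneg[of "(y, r)"] by (simp add: mult.assoc)
  next
    show "Gam \<in> borel_measurable borel" by (rule hkp_measurable[OF Gam_hkp])
    show "Gam (y, r) = 0" if "r \<le> 0" for y :: "real ^ 'n" and r using that by (simp add: Gam_def hk_def)
    show "0 \<le> 1 / hmass TYPE('n) * C" using C(1) hmass_pos[where 'n='n] by simp
  qed (insert card_ge_1[where 'n='n], (linarith | simp)+)
qed

lemma Gamx_locint: "locint (Gamx i :: (real ^ 'n::finite) \<times> real \<Rightarrow> real)"
proof -
  let ?n = "real CARD('n)"
  \<comment> \<open>Now a = n/2 + 1, and the coordinate factor gains one power of |y|. The
    admissible range is n/2 < b < (n+1)/2, again with the midpoint chosen.\<close>
  have "0 \<le> ?n / 2 + 1 / 4" by simp
  then obtain C where C: "0 \<le> C" "\<And>(y::real^'n) r. y \<noteq> 0 \<Longrightarrow> r > 0 \<Longrightarrow>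
      hk (?n / 2 + 1) (y, r) \<le> C * r powr (?n / 2 + 1 / 4 - (?n / 2 + 1)) * norm y powr (- 2 * (?n / 2 + 1 / 4))"
    using hk_bound by metis
  show ?thesis
  proof (rule kernel_locint[of _ "?n - 1 / 2" "3 / 4" "1 / hmass TYPE('n) * C"])
    fix y :: "real ^ 'n" and r :: real assume y: "y \<noteq> 0" "r > 0"
    have e: "?n / 2 + 1 / 4 - (?n / 2 + 1) = - (3 / 4)" "- 2 * (?n / 2 + 1 / 4) = - (?n + 1 / 2)" by auto
    have "hk (?n / 2 + 1) (y, r) \<le> C * r powr (- (3 / 4)) * norm y powr (- (?n + 1 / 2))" using C(2)[OF y] unfolding e .
    then have "norm y * hk (?n / 2 + 1) (y, r) \<le> norm y * (C * r powr (- (3 / 4)) * norm y powr (- (?n + 1 / 2)))"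
      by (intro mult_left_mono) auto
    also have "\<dots> = C * r powr (- (3 / 4)) * (norm y powr 1 * norm y powr (- (?n + 1 / 2)))" using y by (simp add: mult_ac)
    also have "norm y powr 1 * norm y powr (- (?n + 1 / 2)) = norm y powr (- (?n - 1 / 2))" by (subst powr_add[symmetric]) simp
    finally have *: "norm y * hk (?n / 2 + 1) (y, r) \<le> C * r powr (- (3 / 4)) * norm y powr (- (?n - 1 / 2))" .
    have "\<bar>y $ i\<bar> * hk (?n / 2 + 1) (y, r) \<le> norm y * hk (?n / 2 + 1) (y, r)"
      by (intro mult_right_mono component_le_norm_cart hk_nonneg)
    then have "1/2 * (\<bar>y $ i\<bar> * hk (?n / 2 + 1) (y, r)) \<le> C * r powr (- (3 / 4)) * norm y powr (- (?n - 1 / 2))"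
      using * mult_nonneg_nonneg[OF abs_ge_zero[of "y $ i"] hk_nonneg[of "?n / 2 + 1" "(y, r)"]] by linarith
    then have "1 / hmass TYPE('n) * (1/2 * (\<bar>y $ i\<bar> * hk (?n / 2 + 1) (y, r))) \<le> 1 / hmass TYPE('n) * (C * r powr (- (3 / 4)) * norm y powr (- (?n - 1 / 2)))"
      using hmass_pos[where 'n='n] by (intro mult_left_mono) auto
    moreover have "\<bar>Gamx i (y, r)\<bar> = 1 / hmass TYPE('n) * (1/2 * (\<bar>y $ i\<bar> * hk (?n / 2 + 1) (y, r)))"
      unfolding Gamx_def using hmass_pos[where 'n='n] hk_nonneg[of "?n / 2 + 1" "(y, r)"] by (simp add: abs_mult)
    ultimately show "\<bar>Gamx i (y, r)\<bar> \<le> 1 / hmass TYPE('n) * C * r powr (- (3 / 4)) * norm y powr (- (?n - 1 / 2))"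
      by (simp add: mult.assoc)
  next
    show "Gamx i \<in> borel_measurable borel" by (rule hkp_measurable[OF Gamx_hkp])
    show "Gamx i (y, r) = 0" if "r \<le> 0" for y :: "real ^ 'n" and r using that by (simp add: Gamx_def hk_def)
    show "0 \<le> 1 / hmass TYPE('n) * C" using C(1) hmass_pos[where 'n='n] by simp
  qed (insert card_ge_1[where 'n='n], (linarith | simp)+)
qed

section \<open>Duhamel's formula\<close>

lemma integrable_Icc_indicator: "integrable lborel (\<lambda>\<tau>. B * indicator {a..b} \<tau> :: real)" for a b :: real
proof (intro integrable_mult_right integrable_real_indicator)
  show "emeasure lborel {a..b} < \<infinity>" using emeasure_compact_finite[OF compact_Icc] by simp
qed simp

declare [[simproc del: measurable]] (* does not terminate on some goals over product spaces *)

lemma isCont_UNIV: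
  fixes f :: "'a::t2_space \<Rightarrow> 'b::topological_space"
  shows "continuous_on UNIV f \<Longrightarrow> isCont f x"
  by (simp add: continuous_on_eq_continuous_at)

lemma integral_scale:
  fixes f :: "'a::euclidean_space \<Rightarrow> real"
  assumes f: "f \<in> borel_measurable borel" and c: "c > 0"
  shows "(\<integral>y. f y \<partial>lborel) = c ^ DIM('a) * (\<integral>y. f (c *\<^sub>R y) \<partial>lborel)"
proof -
  have m: "(\<lambda>x::'a. 0 + c *\<^sub>R x) \<in> measurable lborel borel"
    unfolding measurable_lborel2 by (intro borel_measurable_continuous_onI continuous_intros)
  have "(\<integral>y. f y \<partial>lborel) = (\<integral>y. f y \<partial>density (distr lborel borel (\<lambda>x. 0 + c *\<^sub>R x)) (\<lambda>_. ennreal (\<bar>c\<bar> ^ DIM('a))))"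
    using lborel_affine[of c "0::'a"] c by simp
  also have "\<dots> = (\<integral>y. \<bar>c\<bar> ^ DIM('a) *\<^sub>R f y \<partial>distr lborel borel (\<lambda>x. 0 + c *\<^sub>R x))"
    by (rule integral_density) (use f in \<open>auto simp: borel_measurable_const\<close>)
  also have "\<dots> = (\<integral>y. \<bar>c\<bar> ^ DIM('a) *\<^sub>R f (0 + c *\<^sub>R y) \<partial>lborel)"
    by (rule integral_distr[OF m]) (intro borel_measurable_scaleR borel_measurable_const f)
  finally show ?thesis using c by simp
qed

section \<open>The heat kernel as an approximate identity for small times\<close>

context
  fixes w :: "(real ^ 'n::finite) \<times> real \<Rightarrow> real"
  assumes w: "bdsupp w" and wc: "continuous_on UNIV w"
begin

definition gphi :: "(real ^ 'n) \<times> real \<Rightarrow> real \<Rightarrow> real" where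
  "gphi z r = (\<integral>y. Gam (y, r) * w (z - (y, r)) \<partial>lborel)"

text \<open>Replacing y by \<open>sqrt r *\<^sub>R y\<close> absorbs the singular factor r^(-n/2)
  and leaves a Gaussian weight independent of r, so that the limit r \<rightarrow> 0 becomes a
  matter of dominated convergence.\<close>

lemma gphi_scaled:
  assumes r: "r > 0"
  shows "gphi z r = 1 / hmass TYPE('n) * (\<integral>y. exp (- (y \<bullet> y) / 4) * w (z - (sqrt r *\<^sub>R y, r)) \<partial>lborel)"
proof -
  have Gc: "continuous_on UNIV (\<lambda>y. Gam (y, r))"
    by (rule continuous_on_compose2[OF hkp_continuous[OF Gam_hkp]]) (use r in \<open>auto intro!: continuous_intros simp: zero_prod_def\<close>)
  have m: "(\<lambda>y. Gam (y, r) * w (z - (y, r))) \<in> borel_measurable borel"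
    by (intro borel_measurable_continuous_onI continuous_intros Gc continuous_on_compose2[OF wc]) auto
  have e: "sqrt r ^ DIM(real ^ 'n) * (Gam (sqrt r *\<^sub>R y, r) * w (z - (sqrt r *\<^sub>R y, r)))
      = 1 / hmass TYPE('n) * (exp (- (y \<bullet> y) / 4) * w (z - (sqrt r *\<^sub>R y, r)))" for y
  proof -
    have "sqrt r ^ DIM(real ^ 'n) = r powr (real CARD('n) / 2)"
      using r by (simp add: powr_half_sqrt[symmetric] powr_power)
    then have 1: "sqrt r ^ DIM(real ^ 'n) * r powr (- (real CARD('n) / 2)) = 1"
      using r by (simp flip: powr_add)
    have "(sqrt r *\<^sub>R y) \<bullet> (sqrt r *\<^sub>R y) = r * (y \<bullet> y)" using r by (simp flip: mult.assoc)
    then have "hk (real CARD('n) / 2) (sqrt r *\<^sub>R y, r) = r powr (- (real CARD('n) / 2)) * exp (- (y \<bullet> y) / 4)"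
      using r unfolding hk_def fst_conv snd_conv by (simp del: inner_scaleR_left inner_scaleR_right)
    then have "sqrt r ^ DIM(real ^ 'n) * Gam (sqrt r *\<^sub>R y, r)
      = (sqrt r ^ DIM(real ^ 'n) * r powr (- (real CARD('n) / 2))) * (1 / hmass TYPE('n) * exp (- (y \<bullet> y) / 4))"
      unfolding Gam_def by (simp only: mult_ac)
    then show ?thesis unfolding 1 by (simp only: mult_1 mult.assoc[symmetric])
  qed
  have "gphi z r = sqrt r ^ DIM(real ^ 'n) * (\<integral>y. Gam (sqrt r *\<^sub>R y, r) * w (z - (sqrt r *\<^sub>R y, r)) \<partial>lborel)"
    unfolding gphi_def by (rule integral_scale[OF m]) (use r in simp)
  also have "\<dots> = (\<integral>y. sqrt r ^ DIM(real ^ 'n) * (Gam (sqrt r *\<^sub>R y, r) * w (z - (sqrt r *\<^sub>R y, r))) \<partial>lborel)"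
    by (rule integral_mult_right_zero[symmetric])
  also have "\<dots> = 1 / hmass TYPE('n) * (\<integral>y. exp (- (y \<bullet> y) / 4) * w (z - (sqrt r *\<^sub>R y, r)) \<partial>lborel)"
    unfolding e by (rule integral_mult_right_zero)
  finally show ?thesis .
qed

lemma gphi_lim: "(gphi z \<longlongrightarrow> w z) (at 0 within {0<..})"
proof -
  obtain B R where B: "0 \<le> B" "\<And>x. \<bar>w x\<bar> \<le> B * indicator (cball 0 R) x" using w by (auto simp: bdsupp_def)
  have B': "\<bar>w x\<bar> \<le> B" for x using B(2)[of x] B(1) by (cases "x \<in> cball 0 R") auto
  have "((\<lambda>r. \<integral>y. exp (- (y \<bullet> y) / 4) * w (z - (sqrt r *\<^sub>R y, r)) \<partial>lborel)
      \<longlongrightarrow> (\<integral>y. exp (- (y \<bullet> y) / 4) * w z \<partial>(lborel :: (real ^ 'n) measure))) (at 0 within {0<..})"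
  proof (rule tendsto_integral_at)
    show "integrable lborel (\<lambda>y::real ^ 'n. exp (- (y \<bullet> y) / 4) * B)"
      by (rule integrable_mult_left) (rule gauss_integrable)
    have c1: "continuous_on UNIV (\<lambda>y::real ^ 'n. exp (- (y \<bullet> y) / 4))" by (intro continuous_intros) auto
    show "(\<lambda>y. exp (- (y \<bullet> y) / 4) * w (z - (sqrt r *\<^sub>R y, r))) \<in> borel_measurable lborel" for r
      unfolding measurable_lborel2
      by (intro borel_measurable_continuous_onI continuous_on_mult c1 continuous_on_compose2[OF wc] continuous_intros) auto
    show "(\<lambda>y. exp (- (y \<bullet> y) / 4) * w z) \<in> borel_measurable (lborel :: (real ^ 'n) measure)"
      unfolding measurable_lborel2
      by (intro borel_measurable_continuous_onI continuous_on_mult c1 continuous_intros)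
    show "AE y in lborel. ((\<lambda>r. exp (- (y \<bullet> y) / 4) * w (z - (sqrt r *\<^sub>R y, r))) \<longlongrightarrow> exp (- (y \<bullet> y) / 4) * w z) (at 0 within {0<..})"
    proof (intro AE_I2 tendsto_mult_left)
      fix y :: "real ^ 'n"
      have "((\<lambda>r. z - (sqrt r *\<^sub>R y, r)) \<longlongrightarrow> z - (sqrt 0 *\<^sub>R y, 0)) (at 0 within {0<..})"
        by (intro tendsto_intros)
      then have "((\<lambda>r. z - (sqrt r *\<^sub>R y, r)) \<longlongrightarrow> z) (at 0 within {0<..})" by (simp add: zero_prod_def[symmetric])
      moreover have "isCont w z" by (rule isCont_UNIV[OF wc])
      ultimately show "((\<lambda>r. w (z - (sqrt r *\<^sub>R y, r))) \<longlongrightarrow> w z) (at 0 within {0<..})"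
        by (rule isCont_tendsto_compose[rotated])
    qed
    show "AE y in lborel. \<bar>exp (- (y \<bullet> y) / 4) * w (z - (sqrt r *\<^sub>R y, r))\<bar> \<le> exp (- (y \<bullet> y) / 4) * B" for r
      by (intro AE_I2) (simp add: abs_mult B')
  qed
  also have "(\<integral>y. exp (- (y \<bullet> y) / 4) * w z \<partial>(lborel :: (real ^ 'n) measure)) = hmass TYPE('n) * w z"
    unfolding hmass_def by (rule integral_mult_left_zero)
  finally have "((\<lambda>r. 1 / hmass TYPE('n) * (\<integral>y. exp (- (y \<bullet> y) / 4) * w (z - (sqrt r *\<^sub>R y, r)) \<partial>lborel))
      \<longlongrightarrow> 1 / hmass TYPE('n) * (hmass TYPE('n) * w z)) (at 0 within {0<..})" by (intro tendsto_mult_left)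
  moreover have "1 / hmass TYPE('n) * (hmass TYPE('n) * w z) = w z" using hmass_pos[where 'n='n] by simp
  ultimately have "((\<lambda>r. 1 / hmass TYPE('n) * (\<integral>y. exp (- (y \<bullet> y) / 4) * w (z - (sqrt r *\<^sub>R y, r)) \<partial>lborel))
      \<longlongrightarrow> w z) (at 0 within {0<..})" by simp
  moreover have "\<forall>\<^sub>F r in at 0 within {0<..}. 1 / hmass TYPE('n) * (\<integral>y. exp (- (y \<bullet> y) / 4) * w (z - (sqrt r *\<^sub>R y, r)) \<partial>lborel) = gphi z r"
    unfolding eventually_at by (intro exI[of _ 1]) (simp add: gphi_scaled)
  ultimately show ?thesis by (rule Lim_transform_eventually)
qed

text \<open>In Duhamel's formula \<tau> is the derivative of a time cutoff on the kernel. It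
  averages \<open>gphi z r\<close> over r in [\<sigma>, 3 \<sigma>] with total weight 1, where
  \<open>gphi z r\<close> is within e of \<open>w z\<close>. No sign of \<tau> is assumed, so the
  error is C/\<sigma> times e times the length 2 \<sigma>, rounded up to 3 C e.\<close>

lemma conv_approx_identity:
  assumes e: "e > 0"
  obtains \<sigma>0 where "\<sigma>0 > 0"
    "\<And>\<sigma> \<tau> C. 0 < \<sigma> \<Longrightarrow> \<sigma> < \<sigma>0 \<Longrightarrow> continuous_on UNIV \<tau> \<Longrightarrow> (\<And>r. \<bar>\<tau> r\<bar> \<le> C / \<sigma>) \<Longrightarrow>
      (\<And>r. r < \<sigma> \<or> r > 3 * \<sigma> \<Longrightarrow> \<tau> r = 0) \<Longrightarrow> (\<integral>r. \<tau> r \<partial>lborel) = 1 \<Longrightarrow>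
      \<bar>conv (\<lambda>z. Gam z * \<tau> (snd z)) w z - w z\<bar> \<le> 3 * C * e"
proof -
  obtain d where d: "d > 0" "\<And>r. 0 < r \<Longrightarrow> r < d \<Longrightarrow> \<bar>gphi z r - w z\<bar> < e"
    using tendstoD[OF gphi_lim[of z] e] unfolding eventually_at by (auto simp: dist_real_def)
  show thesis
  proof (rule that[of "d / 3"])
    show "d / 3 > 0" using d by simp
    fix \<sigma> C :: real and \<tau> :: "real \<Rightarrow> real"
    assume s: "0 < \<sigma>" "\<sigma> < d / 3" and tc: "continuous_on UNIV \<tau>" and tb: "\<And>r. \<bar>\<tau> r\<bar> \<le> C / \<sigma>"
      and t0: "\<And>r. r < \<sigma> \<or> r > 3 * \<sigma> \<Longrightarrow> \<tau> r = 0" and t1: "(\<integral>r. \<tau> r \<partial>lborel) = 1"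
    define k where "k = (\<lambda>z::(real ^ 'n) \<times> real. Gam z * \<tau> (snd z))"
    have "continuous_on UNIV k" unfolding k_def
    proof (rule continuous_mult_cutoff[OF hkp_continuous[OF Gam_hkp]])
      show "continuous_on UNIV (\<lambda>z::(real ^ 'n) \<times> real. \<tau> (snd z))"
        by (rule continuous_on_compose2[OF tc]) (auto intro!: continuous_intros)
      show "closed {z::(real ^ 'n) \<times> real. \<sigma> \<le> snd z}" by (intro closed_Collect_le continuous_intros)
      show "{z::(real ^ 'n) \<times> real. \<sigma> \<le> snd z} \<subseteq> - {0}" using s by auto
      show "open (- {0::(real ^ 'n) \<times> real})" by (intro open_Compl closed_singleton)
      show "\<tau> (snd z) = 0" if "z \<notin> {z::(real ^ 'n) \<times> real. \<sigma> \<le> snd z}" for z using that t0 by auto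
    qed
    then have ki: "integrable lborel (\<lambda>x. k x * w (z - x))" by (intro conv_integrable locint_continuousI w)
    then have ki2: "integrable (lborel \<Otimes>\<^sub>M lborel) (\<lambda>(y, r). k (y, r) * w (z - (y, r)))"
      by (simp add: lborel_prod case_prod_beta')
    have in_eq: "(\<integral>y. k (y, r) * w (z - (y, r)) \<partial>lborel) = \<tau> r * gphi z r" for r
    proof -
      have "(\<lambda>y. k (y, r) * w (z - (y, r))) = (\<lambda>y. \<tau> r * (Gam (y, r) * w (z - (y, r))))"
        by (simp add: k_def mult_ac)
      then show ?thesis unfolding gphi_def by simp
    qed
    have "conv k w z = (\<integral>x. k x * w (z - x) \<partial>(lborel \<Otimes>\<^sub>M lborel))" by (simp add: conv_def lborel_prod)
    also have "\<dots> = (\<integral>r. (\<integral>y. k (y, r) * w (z - (y, r)) \<partial>lborel) \<partial>lborel)"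
      using lborel_pair.integral_snd[OF ki2] by (simp add: case_prod_beta')
    finally have cv: "conv k w z = (\<integral>r. \<tau> r * gphi z r \<partial>lborel)" unfolding in_eq .
    have i1: "integrable lborel (\<lambda>r. \<tau> r * gphi z r)"
      using lborel_pair.integrable_snd[OF ki2] unfolding in_eq by simp
    have i2: "integrable lborel \<tau>"
    proof (rule integrable_bounded_supp[of _ "C / \<sigma>" 0 "3 * \<sigma>"])
      show "\<bar>\<tau> r\<bar> \<le> C / \<sigma> * indicator (cball 0 (3 * \<sigma>)) r" for r
        using tb[of r] t0[of r] s by (cases "\<bar>r\<bar> \<le> 3 * \<sigma>") (auto simp: abs_le_iff)
    qed (rule borel_measurable_continuous_onI[OF tc])
    have "conv k w z - w z = (\<integral>r. \<tau> r * gphi z r \<partial>lborel) - (\<integral>r. \<tau> r * w z \<partial>lborel)"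
      unfolding cv using t1 by simp
    also have "\<dots> = (\<integral>r. \<tau> r * gphi z r - \<tau> r * w z \<partial>lborel)"
      by (rule Bochner_Integration.integral_diff[symmetric, OF i1 integrable_mult_left]) (rule i2)
    finally have "\<bar>conv k w z - w z\<bar> \<le> (\<integral>r. \<bar>\<tau> r * gphi z r - \<tau> r * w z\<bar> \<partial>lborel)"
      using integral_norm_bound[of lborel "\<lambda>r. \<tau> r * gphi z r - \<tau> r * w z"] by simp
    also have "\<dots> \<le> (\<integral>r. C / \<sigma> * e * indicator {\<sigma>..3 * \<sigma>} r \<partial>lborel)"
    proof (rule integral_mono)
      show "integrable lborel (\<lambda>r. \<bar>\<tau> r * gphi z r - \<tau> r * w z\<bar>)"
        by (intro integrable_abs Bochner_Integration.integrable_diff i1 integrable_mult_left i2)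
      show "integrable lborel (\<lambda>r. C / \<sigma> * e * indicator {\<sigma>..3 * \<sigma>} r)"
        by (rule integrable_Icc_indicator)
      fix r
      show "\<bar>\<tau> r * gphi z r - \<tau> r * w z\<bar> \<le> C / \<sigma> * e * indicator {\<sigma>..3 * \<sigma>} r"
      proof (cases "\<sigma> \<le> r \<and> r \<le> 3 * \<sigma>")
        case True
        then have "\<bar>gphi z r - w z\<bar> \<le> e" using d(2)[of r] s by auto
        then have "\<bar>\<tau> r\<bar> * \<bar>gphi z r - w z\<bar> \<le> C / \<sigma> * e"
          using tb[of r] by (intro mult_mono) (auto intro: order_trans[OF abs_ge_zero])
        then show ?thesis using True by (simp add: abs_mult flip: right_diff_distrib)
      qed (use t0 in auto)
    qed
    also have "\<dots> = C / \<sigma> * e * (2 * \<sigma>)" using s by simp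
    also have "\<dots> \<le> 3 * C * e"
    proof -
      have "0 \<le> C / \<sigma>" using tb[of 0] abs_ge_zero order_trans by blast
      then have "0 \<le> C" using s by (simp add: zero_le_divide_iff)
      then show ?thesis using s e by simp
    qed
    finally show "\<bar>conv (\<lambda>z. Gam z * \<tau> (snd z)) w z - w z\<bar> \<le> 3 * C * e" unfolding k_def .
  qed
qed

end

lemma infdist_atMost_0: "infdist r {..0} = max r (0::real)"
proof (cases "r \<le> 0")
  case False
  have "r \<le> infdist r {..0}" unfolding infdist_notempty[of "{..0::real}", simplified]
    by (rule cINF_greatest) (use False in \<open>auto simp: dist_real_def\<close>)
  moreover have "infdist r {..0} \<le> r" using infdist_le[of 0 "{..0}" r] False by (simp add: dist_real_def)
  ultimately show ?thesis using False by simp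
qed simp

text \<open>The general cutoff for the half-line of nonpositive times. Its derivative has integral 1
  because the cutoff rises from 0 to 1, and it vanishes outside [\<sigma>, 3 \<sigma>] because the
  cutoff is locally constant there.\<close>

lemma time_cutoff:
  obtains C :: real and \<theta> \<theta>1 :: "real \<Rightarrow> real \<Rightarrow> real" where "C > 0"
    "\<And>\<sigma>. \<sigma> > 0 \<Longrightarrow> continuous_on UNIV (\<theta> \<sigma>)" "\<And>\<sigma>. \<sigma> > 0 \<Longrightarrow> continuous_on UNIV (\<theta>1 \<sigma>)"
    "\<And>\<sigma> r. \<sigma> > 0 \<Longrightarrow> DERIV (\<theta> \<sigma>) r :> \<theta>1 \<sigma> r" "\<And>\<sigma> r. \<sigma> > 0 \<Longrightarrow> 0 \<le> \<theta> \<sigma> r \<and> \<theta> \<sigma> r \<le> 1"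
    "\<And>\<sigma> r. \<sigma> > 0 \<Longrightarrow> r < \<sigma> \<Longrightarrow> \<theta> \<sigma> r = 0" "\<And>\<sigma> r. \<sigma> > 0 \<Longrightarrow> r > 3 * \<sigma> \<Longrightarrow> \<theta> \<sigma> r = 1"
    "\<And>\<sigma> r. \<sigma> > 0 \<Longrightarrow> \<bar>\<theta>1 \<sigma> r\<bar> \<le> C / \<sigma>" "\<And>\<sigma> r. \<sigma> > 0 \<Longrightarrow> r < \<sigma> \<or> r > 3 * \<sigma> \<Longrightarrow> \<theta>1 \<sigma> r = 0"
    "\<And>\<sigma>. \<sigma> > 0 \<Longrightarrow> (\<integral>r. \<theta>1 \<sigma> r \<partial>lborel) = 1"
proof -
  obtain C :: real where C: "C > 0" "\<And>(S::real set) \<epsilon>. S \<noteq> {} \<Longrightarrow> \<epsilon> > 0 \<Longrightarrow>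
      \<exists>\<eta> \<eta>1 \<eta>2. cutoff_data C S \<epsilon> \<eta> \<eta>1 \<eta>2"
    by (rule cutoff_exists) (rule that, assumption+)
  have "\<exists>t t1. continuous_on UNIV t \<and> continuous_on UNIV t1 \<and> (\<forall>r. DERIV t r :> t1 r) \<and> (\<forall>r. 0 \<le> t r \<and> t r \<le> 1) \<and>
      (\<forall>r<\<sigma>. t r = 0) \<and> (\<forall>r>3*\<sigma>. t r = 1) \<and> (\<forall>r. \<bar>t1 r\<bar> \<le> C / \<sigma>)" if s: "\<sigma> > 0" for \<sigma> :: real
  proof -
    obtain \<eta> \<eta>1 \<eta>2 where h: "continuous_on UNIV \<eta>" "\<And>v. continuous_on UNIV (\<eta>1 v)" "\<And>v. dird v \<eta> (\<eta>1 v) UNIV"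
      "\<And>z. 0 \<le> \<eta> z \<and> \<eta> z \<le> 1" "\<And>z. infdist z {..0::real} < \<sigma> \<Longrightarrow> \<eta> z = 0"
      "\<And>z. infdist z {..0::real} > 3 * \<sigma> \<Longrightarrow> \<eta> z = 1" "\<And>v z. \<bar>\<eta>1 v z\<bar> \<le> C * norm v / \<sigma>"
      using C(2)[of "{..0::real}", OF _ s] unfolding cutoff_data_def by blast
    have "DERIV \<eta> r :> \<eta>1 1 r" for r
      using dird_line[OF h(3)[of 1], of 0 r] by simp
    moreover have "\<eta> r = 0" if "r < \<sigma>" for r using h(5)[of r] s that by (simp add: infdist_atMost_0)
    moreover have "\<eta> r = 1" if "r > 3 * \<sigma>" for r using h(6)[of r] s that by (simp add: infdist_atMost_0)
    moreover have "\<bar>\<eta>1 1 r\<bar> \<le> C / \<sigma>" for r using h(7)[of 1 r] by simp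
    ultimately show ?thesis using h(1,2,4) by (intro exI[of _ \<eta>] exI[of _ "\<eta>1 1"]) blast
  qed
  then obtain \<theta> \<theta>1 where t: "\<And>\<sigma>. \<sigma> > 0 \<Longrightarrow> continuous_on UNIV (\<theta> \<sigma>) \<and> continuous_on UNIV (\<theta>1 \<sigma>) \<and>
     (\<forall>r. DERIV (\<theta> \<sigma>) r :> \<theta>1 \<sigma> r) \<and> (\<forall>r. 0 \<le> \<theta> \<sigma> r \<and> \<theta> \<sigma> r \<le> 1) \<and>
      (\<forall>r<\<sigma>. \<theta> \<sigma> r = 0) \<and> (\<forall>r>3*\<sigma>. \<theta> \<sigma> r = 1) \<and> (\<forall>r. \<bar>\<theta>1 \<sigma> r\<bar> \<le> C / \<sigma>)" by metis
  have z: "\<theta>1 \<sigma> r = 0" if s: "\<sigma> > 0" and r: "r < \<sigma> \<or> r > 3 * \<sigma>" for \<sigma> r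
  proof -
    have d: "DERIV (\<theta> \<sigma>) r :> \<theta>1 \<sigma> r" using t s by blast
    have "\<exists>c. \<forall>\<^sub>F x in nhds r. \<theta> \<sigma> x = c"
    proof (cases "r < \<sigma>")
      case True
      have "\<forall>\<^sub>F x in nhds r. x \<in> {..<\<sigma>}" using True by (intro eventually_nhds_in_open) auto
      then have "\<forall>\<^sub>F x in nhds r. \<theta> \<sigma> x = 0" by eventually_elim (use t s in auto)
      then show ?thesis by blast
    next
      case False
      then have "\<forall>\<^sub>F x in nhds r. x \<in> {3*\<sigma><..}" using r by (intro eventually_nhds_in_open) auto
      then have "\<forall>\<^sub>F x in nhds r. \<theta> \<sigma> x = 1" by eventually_elim (use t s in auto)
      then show ?thesis by blast
    qed
    then obtain c where "\<forall>\<^sub>F x in nhds r. \<theta> \<sigma> x = c" by blast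
    from iffD2[OF DERIV_cong_ev[OF refl this refl] DERIV_const] have "DERIV (\<theta> \<sigma>) r :> 0" .
    then show ?thesis using d by (rule DERIV_unique[symmetric])
  qed
  have i: "(\<integral>r. \<theta>1 \<sigma> r \<partial>lborel) = 1" if s: "\<sigma> > 0" for \<sigma>
  proof -
    have "(\<integral>r. \<theta>1 \<sigma> r * indicator {0..4*\<sigma>} r \<partial>lborel) = \<theta> \<sigma> (4 * \<sigma>) - \<theta> \<sigma> 0"
      by (rule integral_FTC_Icc_real) (use t s in \<open>auto simp: continuous_on_eq_continuous_at\<close>)
    also have "\<dots> = 1" using t s by auto
    also have "(\<lambda>r. \<theta>1 \<sigma> r * indicator {0..4*\<sigma>} r) = \<theta>1 \<sigma>"
      proof
        fix r show "\<theta>1 \<sigma> r * indicator {0..4*\<sigma>} r = \<theta>1 \<sigma> r"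
          using z[OF s, of r] s by (cases "r < \<sigma> \<or> r > 3 * \<sigma>") auto
      qed
    finally show ?thesis .
  qed
  have t1: "continuous_on UNIV (\<theta> \<sigma>)" and t2: "continuous_on UNIV (\<theta>1 \<sigma>)"
    and t3: "DERIV (\<theta> \<sigma>) r :> \<theta>1 \<sigma> r" and t4: "0 \<le> \<theta> \<sigma> r \<and> \<theta> \<sigma> r \<le> 1" and t5: "\<bar>\<theta>1 \<sigma> r\<bar> \<le> C / \<sigma>"
    and t6: "r < \<sigma> \<Longrightarrow> \<theta> \<sigma> r = 0" and t7: "r > 3 * \<sigma> \<Longrightarrow> \<theta> \<sigma> r = 1" if "\<sigma> > 0" for \<sigma> r
    using t[OF that] by simp_all
  show thesis by (rule that[OF C(1) t1 t2 t3 t4 t6 t7 t5 z i])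
qed

lemma conv_cutoff_lim:
  fixes k f :: "(real ^ 'n::finite) \<times> real \<Rightarrow> real"
  assumes k: "locint k" and k0: "\<And>z. snd z \<le> 0 \<Longrightarrow> k z = 0" and f: "bdsupp f"
    and c: "\<And>j. continuous_on UNIV (\<theta> j)" and b: "\<And>j r. 0 \<le> \<theta> j r \<and> \<theta> j r \<le> (1::real)"
    and 1: "\<And>j r. r > s j \<Longrightarrow> \<theta> j r = 1" and s: "s \<longlonglongrightarrow> 0"
  shows "(\<lambda>j::nat. conv (\<lambda>z. k z * \<theta> j (snd z)) f z) \<longlonglongrightarrow> conv k f z"
  unfolding conv_def
proof (rule integral_dominated_convergence)
  have km: "k \<in> borel_measurable borel" and fm: "f \<in> borel_measurable borel" using k f by (auto simp: locint_def bdsupp_def)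
  show "integrable lborel (\<lambda>w. \<bar>k w * f (z - w)\<bar>)" by (intro integrable_abs conv_integrable k f)
  have fzm: "(\<lambda>w. f (z - w)) \<in> borel_measurable borel"
    by (rule measurable_compose[OF _ fm]) (intro borel_measurable_continuous_onI continuous_intros)
  show "(\<lambda>w. k w * f (z - w)) \<in> borel_measurable lborel"
    unfolding measurable_lborel2 by (intro borel_measurable_times km fzm)
  have "(\<lambda>w. \<theta> j (snd w)) \<in> borel_measurable (borel :: ((real ^ 'n) \<times> real) measure)" for j
    by (rule borel_measurable_continuous_onI, rule continuous_on_compose2[OF c]) (auto intro!: continuous_intros)
  then show "(\<lambda>w. k w * \<theta> j (snd w) * f (z - w)) \<in> borel_measurable lborel" for j
    unfolding measurable_lborel2 by (intro borel_measurable_times km fzm)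
  show "AE w in lborel. (\<lambda>j. k w * \<theta> j (snd w) * f (z - w)) \<longlonglongrightarrow> k w * f (z - w)"
  proof (intro AE_I2)
    fix w :: "(real ^ 'n) \<times> real"
    show "(\<lambda>j. k w * \<theta> j (snd w) * f (z - w)) \<longlonglongrightarrow> k w * f (z - w)"
    proof (cases "snd w > 0")
      case True
      have "\<forall>\<^sub>F j in sequentially. s j < snd w" using order_tendstoD(2)[OF s True] .
      then have "\<forall>\<^sub>F j in sequentially. k w * f (z - w) = k w * \<theta> j (snd w) * f (z - w)"
        by eventually_elim (simp add: 1)
      then show ?thesis by (rule Lim_transform_eventually[OF tendsto_const])
    qed (simp add: k0)
  qed
  show "AE w in lborel. norm (k w * \<theta> j (snd w) * f (z - w)) \<le> \<bar>k w * f (z - w)\<bar>" for j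
  proof (intro AE_I2)
    fix w :: "(real ^ 'n) \<times> real"
    have "norm (k w * \<theta> j (snd w) * f (z - w)) = \<theta> j (snd w) * \<bar>k w * f (z - w)\<bar>"
      using b[of j "snd w"] by (simp add: abs_mult)
    also have "\<dots> \<le> 1 * \<bar>k w * f (z - w)\<bar>" using b by (intro mult_right_mono) auto
    finally show "norm (k w * \<theta> j (snd w) * f (z - w)) \<le> \<bar>k w * f (z - w)\<bar>" by simp
  qed
qed

definition Gamt :: "(real ^ 'n::finite) \<times> real \<Rightarrow> real" where
  "Gamt z = 1 / hmass TYPE('n) * (- (CARD('n) / 2) * hk (CARD('n) / 2 + 1) z
      + 1/4 * ((fst z \<bullet> fst z) * hk (CARD('n) / 2 + 2) z))"

definition Gamxx :: "'n \<Rightarrow> (real ^ 'n::finite) \<times> real \<Rightarrow> real" where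
  "Gamxx i z = 1 / hmass TYPE('n) * (- (1/2) * (1 * hk (CARD('n) / 2 + 1) z
      + fst z $ i * (- (1/2) * (fst z $ i * hk (CARD('n) / 2 + 1 + 1) z))))"

lemma Gam_dird_t: "dird e_t Gam Gamt (- {0})"
  unfolding Gam_def[abs_def] Gamt_def[abs_def] by (intro dird_cmult hk_dird_t)

lemma Gamx_dird_x: "dird (e_x i) (Gamx i) (Gamxx i) UNIV"
proof -
  have "dird (e_x i) (\<lambda>z::(real ^ 'a) \<times> real. fst z $ i) (\<lambda>z. 1) UNIV" using coord_dird(1)[of i i UNIV] by simp
  then show ?thesis unfolding Gamx_def[abs_def] Gamxx_def[abs_def] by (intro dird_cmult dird_mult hk_dird_x)
qed

text \<open>The heat equation for the kernel. The exponent n/2 is forced by it: each of the n second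
  derivatives contributes -1/2 to the coefficient of \<open>hk (n/2 + 1)\<close>, and the time
  derivative contributes -n/2. At times \<le> 0 both sides vanish.\<close>

lemma Gamt_eq: "Gamt z = (\<Sum>i\<in>UNIV. Gamxx i (z :: (real ^ 'n::finite) \<times> real))"
proof -
  have 2: "real CARD('n) / 2 + 1 + 1 = real CARD('n) / 2 + 2" by simp
  have "(\<Sum>i\<in>UNIV. Gamxx i z) = 1 / hmass TYPE('n) * (\<Sum>i\<in>(UNIV::'n set). - (1/2) * hk (CARD('n) / 2 + 1) z
      + 1/4 * ((fst z $ i * fst z $ i) * hk (CARD('n) / 2 + 2) z))"
    unfolding Gamxx_def 2 sum_distrib_left by (intro sum.cong) (auto simp: algebra_simps)
  also have "(\<Sum>i\<in>(UNIV::'n set). - (1/2) * hk (CARD('n) / 2 + 1) z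
      + 1/4 * ((fst z $ i * fst z $ i) * hk (CARD('n) / 2 + 2) z))
    = - (CARD('n) / 2) * hk (CARD('n) / 2 + 1) z + 1/4 * ((fst z \<bullet> fst z) * hk (CARD('n) / 2 + 2) z)"
    by (simp add: sum_subtractf sum_distrib_right sum_divide_distrib inner_vec_def)
  finally show ?thesis unfolding Gamt_def by simp
qed

lemma Gamt_continuous: "continuous_on (- {0}) Gamt"
  unfolding Gamt_def[abs_def] by (intro continuous_intros hk_continuous)

lemma Gamxx_continuous: "continuous_on (- {0}) (Gamxx i)"
  unfolding Gamxx_def[abs_def] by (intro continuous_intros hk_continuous)

lemma Gam_past: "snd z \<le> 0 \<Longrightarrow> Gam z = 0" "snd z \<le> 0 \<Longrightarrow> Gamx i z = 0"
  by (auto simp: Gam_def Gamx_def hk_def)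

text \<open>The usual formula convolves \<Gamma> with the heat operator applied to w; here the
  Laplacian is integrated by parts once, so w needs only one space derivative. Time integrals of a
  density with continuous space gradient, to which it is applied later, have no more.\<close>

theorem duhamel:
  fixes w :: "(real ^ 'n::finite) \<times> real \<Rightarrow> real"
  assumes w: "bdsupp w" "continuous_on UNIV w"
    and wt: "bdsupp wt" "continuous_on UNIV wt" "dird e_t w wt UNIV"
    and wx: "\<And>i. bdsupp (wx i)" "\<And>i. continuous_on UNIV (wx i)" "\<And>i. dird (e_x i) w (wx i) UNIV"
  shows "w z = conv Gam wt z - (\<Sum>i\<in>UNIV. conv (Gamx i) (wx i) z)"
proof -
  obtain C :: real and \<theta> \<theta>1 :: "real \<Rightarrow> real \<Rightarrow> real" where t: "C > 0"
    "\<And>\<sigma>. \<sigma> > 0 \<Longrightarrow> continuous_on UNIV (\<theta> \<sigma>)" "\<And>\<sigma>. \<sigma> > 0 \<Longrightarrow> continuous_on UNIV (\<theta>1 \<sigma>)"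
    "\<And>\<sigma> r. \<sigma> > 0 \<Longrightarrow> DERIV (\<theta> \<sigma>) r :> \<theta>1 \<sigma> r" "\<And>\<sigma> r. \<sigma> > 0 \<Longrightarrow> 0 \<le> \<theta> \<sigma> r \<and> \<theta> \<sigma> r \<le> 1"
    "\<And>\<sigma> r. \<sigma> > 0 \<Longrightarrow> r < \<sigma> \<Longrightarrow> \<theta> \<sigma> r = 0" "\<And>\<sigma> r. \<sigma> > 0 \<Longrightarrow> r > 3 * \<sigma> \<Longrightarrow> \<theta> \<sigma> r = 1"
    "\<And>\<sigma> r. \<sigma> > 0 \<Longrightarrow> \<bar>\<theta>1 \<sigma> r\<bar> \<le> C / \<sigma>" "\<And>\<sigma> r. \<sigma> > 0 \<Longrightarrow> r < \<sigma> \<or> r > 3 * \<sigma> \<Longrightarrow> \<theta>1 \<sigma> r = 0"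
    "\<And>\<sigma>. \<sigma> > 0 \<Longrightarrow> (\<integral>r. \<theta>1 \<sigma> r \<partial>lborel) = 1"
    by (rule time_cutoff) (rule that, assumption+)
  \<comment> \<open>Cutting the kernel off at small times makes it continuous, so that all
    integrations by parts are legitimate. In its time derivative the part \<open>ka\<close> cancels
    against the space derivatives by the heat equation, and the part \<open>kb\<close>, with the
    derivative on the cutoff, becomes w in the limit.\<close>
  have key: "conv (\<lambda>z. Gam z * \<theta>1 \<sigma> (snd z)) w z = conv (\<lambda>z. Gam z * \<theta> \<sigma> (snd z)) wt z
      - (\<Sum>i\<in>UNIV. conv (\<lambda>z. Gamx i z * \<theta> \<sigma> (snd z)) (wx i) z)" if s: "\<sigma> > 0" for \<sigma>
  proof -
    let ?S = "{z::(real ^ 'n) \<times> real. \<sigma> \<le> snd z}"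
    have S: "closed ?S" "?S \<subseteq> - {0}" "open (- {0::(real ^ 'n) \<times> real})"
      using s by (auto intro!: closed_Collect_le continuous_intros open_Compl closed_singleton)
    have \<theta>c: "continuous_on UNIV (\<lambda>z::(real ^ 'n) \<times> real. \<theta> \<sigma> (snd z))"
      by (rule continuous_on_compose2[OF t(2)[OF s]]) (auto intro!: continuous_intros)
    have \<theta>1c: "continuous_on UNIV (\<lambda>z::(real ^ 'n) \<times> real. \<theta>1 \<sigma> (snd z))"
      by (rule continuous_on_compose2[OF t(3)[OF s]]) (auto intro!: continuous_intros)
    have \<theta>0: "\<theta> \<sigma> (snd z) = 0" if "z \<notin> ?S" for z using that t(6)[OF s] by auto
    have \<theta>10: "\<theta>1 \<sigma> (snd z) = 0" if "z \<notin> ?S" for z using that t(9)[OF s] by auto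
    have d1: "dird e_t (\<lambda>z::(real ^ 'n) \<times> real. \<theta> \<sigma> (snd z)) (\<lambda>z. \<theta>1 \<sigma> (snd z)) UNIV"
      unfolding dird_def e_t_def
    proof
      fix z :: "(real ^ 'n) \<times> real"
      have "((\<lambda>s. \<theta> \<sigma> (snd z + s)) has_real_derivative \<theta>1 \<sigma> (snd z)) (at 0)"
        using t(4)[OF s, of "snd z"] DERIV_shift[of "\<theta> \<sigma>" "\<theta>1 \<sigma> (snd z)" 0 "snd z"] by (simp add: add.commute)
      then show "((\<lambda>s. \<theta> \<sigma> (snd (z + s *\<^sub>R (0, 1)))) has_real_derivative \<theta>1 \<sigma> (snd z)) (at 0)" by simp
    qed
    have d2: "dird (e_x i) (\<lambda>z::(real ^ 'n) \<times> real. \<theta> \<sigma> (snd z)) (\<lambda>z. 0) UNIV" for i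
      unfolding dird_def e_x_def by simp
    define k0 where "k0 = (\<lambda>z::(real ^ 'n) \<times> real. Gam z * \<theta> \<sigma> (snd z))"
    define ka where "ka = (\<lambda>z::(real ^ 'n) \<times> real. Gamt z * \<theta> \<sigma> (snd z))"
    define kb where "kb = (\<lambda>z::(real ^ 'n) \<times> real. Gam z * \<theta>1 \<sigma> (snd z))"
    define ki where "ki = (\<lambda>i. \<lambda>z::(real ^ 'n) \<times> real. Gamx i z * \<theta> \<sigma> (snd z))"
    define kii where "kii = (\<lambda>i. \<lambda>z::(real ^ 'n) \<times> real. Gamxx i z * \<theta> \<sigma> (snd z))"
    have c0: "continuous_on UNIV k0" unfolding k0_def
      by (rule continuous_mult_cutoff[OF hkp_continuous[OF Gam_hkp] \<theta>c S \<theta>0])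
    have ca: "continuous_on UNIV ka" unfolding ka_def
      by (rule continuous_mult_cutoff[OF Gamt_continuous \<theta>c S \<theta>0])
    have cb: "continuous_on UNIV kb" unfolding kb_def
      by (rule continuous_mult_cutoff[OF hkp_continuous[OF Gam_hkp] \<theta>1c S \<theta>10])
    have ci: "continuous_on UNIV (ki i)" for i unfolding ki_def
      by (rule continuous_mult_cutoff[OF hkp_continuous[OF Gamx_hkp] \<theta>c S \<theta>0])
    have cii: "continuous_on UNIV (kii i)" for i unfolding kii_def
      by (rule continuous_mult_cutoff[OF Gamxx_continuous \<theta>c S \<theta>0])
    have dt: "dird e_t k0 (\<lambda>z. ka z + kb z) UNIV" unfolding k0_def ka_def kb_def
      by (rule dird_mult_cutoff[OF Gam_dird_t d1 S(1,2) \<theta>0])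
    have di: "dird (e_x i) (ki i) (kii i) UNIV" for i
    proof -
      have "dird (e_x i) (\<lambda>z. Gamx i z * \<theta> \<sigma> (snd z)) (\<lambda>z. Gamxx i z * \<theta> \<sigma> (snd z) + Gamx i z * 0) UNIV"
        by (rule dird_mult[OF Gamx_dird_x d2])
      then show ?thesis by (simp add: ki_def kii_def)
    qed
    have lc: "continuous_on UNIV (\<lambda>s. k (v + s *\<^sub>R e))" if "continuous_on UNIV k" for k :: "(real ^ 'n) \<times> real \<Rightarrow> real" and v e
      by (rule continuous_on_compose2[OF that]) (auto intro!: continuous_intros)
    have cab: "continuous_on UNIV (\<lambda>z. ka z + kb z)" by (intro continuous_intros ca cb)
    have "conv k0 wt z = conv (\<lambda>z. ka z + kb z) w z"
      by (rule fun_cong[OF conv_swap[OF locint_continuousI[OF c0] locint_continuousI[OF cab] dt lc[OF cab] w wt(1,3)]])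
    also have "\<dots> = conv ka w z + conv kb w z"
      unfolding conv_def distrib_right
      by (intro Bochner_Integration.integral_add conv_integrable locint_continuousI ca cb w)
    finally have 1: "conv kb w z = conv k0 wt z - conv ka w z" by simp
    have 2: "conv (ki i) (wx i) z = conv (kii i) w z" for i
      by (rule fun_cong[OF conv_swap[OF locint_continuousI[OF ci] locint_continuousI[OF cii] di lc[OF cii] w wx(1,3)]])
    have "ka v * w (z - v) = (\<Sum>i\<in>UNIV. kii i v * w (z - v))" for v
      by (simp add: ka_def kii_def Gamt_eq sum_distrib_right)
    then have "conv ka w z = (\<integral>v. (\<Sum>i\<in>UNIV. kii i v * w (z - v)) \<partial>lborel)" unfolding conv_def by simp
    also have "\<dots> = (\<Sum>i\<in>UNIV. conv (kii i) w z)"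
      unfolding conv_def by (intro Bochner_Integration.integral_sum conv_integrable locint_continuousI cii w)
    finally have "conv ka w z = (\<Sum>i\<in>UNIV. conv (kii i) w z)" .
    then show ?thesis using 1 2 by (simp add: k0_def kb_def ki_def)
  qed
  define \<sigma> where "\<sigma> j = inverse (real (Suc j))" for j
  have \<sigma>: "\<sigma> j > 0" for j by (simp add: \<sigma>_def)
  have \<sigma>0: "\<sigma> \<longlonglongrightarrow> 0" unfolding \<sigma>_def by (rule LIMSEQ_inverse_real_of_nat)
  have \<sigma>3: "(\<lambda>j. 3 * \<sigma> j) \<longlonglongrightarrow> 0" by (rule tendsto_mult_right_zero[OF \<sigma>0])
  have "(\<lambda>j. conv (\<lambda>z. Gam z * \<theta> (\<sigma> j) (snd z)) wt z - (\<Sum>i\<in>UNIV. conv (\<lambda>z. Gamx i z * \<theta> (\<sigma> j) (snd z)) (wx i) z))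
      \<longlonglongrightarrow> conv Gam wt z - (\<Sum>i\<in>UNIV. conv (Gamx i) (wx i) z)"
    by (intro tendsto_diff tendsto_sum conv_cutoff_lim[where \<theta>="\<lambda>j. \<theta> (\<sigma> j)" and s="\<lambda>j. 3 * \<sigma> j"]
        Gam_locint Gamx_locint Gam_past wt(1) wx(1) t(2,5,7) \<sigma> \<sigma>3)
  then have l1: "(\<lambda>j. conv (\<lambda>z. Gam z * \<theta>1 (\<sigma> j) (snd z)) w z) \<longlonglongrightarrow> conv Gam wt z - (\<Sum>i\<in>UNIV. conv (Gamx i) (wx i) z)"
    by (simp only: key[OF \<sigma>])
  have "(\<lambda>j. conv (\<lambda>z. Gam z * \<theta>1 (\<sigma> j) (snd z)) w z) \<longlonglongrightarrow> w z"
  proof (rule LIMSEQ_I)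
    fix r :: real assume r: "r > 0"
    define e where "e = r / (4 * C)"
    have e: "e > 0" "3 * C * e < r" using r t(1) by (auto simp: e_def)
    obtain \<sigma>0' where s0: "\<sigma>0' > 0"
      "\<And>\<sigma> \<tau> C. 0 < \<sigma> \<Longrightarrow> \<sigma> < \<sigma>0' \<Longrightarrow> continuous_on UNIV \<tau> \<Longrightarrow> (\<And>r. \<bar>\<tau> r\<bar> \<le> C / \<sigma>) \<Longrightarrow>
      (\<And>r. r < \<sigma> \<or> r > 3 * \<sigma> \<Longrightarrow> \<tau> r = 0) \<Longrightarrow> (\<integral>r. \<tau> r \<partial>lborel) = 1 \<Longrightarrow>
      \<bar>conv (\<lambda>z. Gam z * \<tau> (snd z)) w z - w z\<bar> \<le> 3 * C * e"
      using conv_approx_identity[OF w e(1)] by blast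
    from order_tendstoD(2)[OF \<sigma>0 s0(1)] obtain J where J: "\<And>j. j \<ge> J \<Longrightarrow> \<sigma> j < \<sigma>0'"
      by (auto simp: eventually_sequentially)
    show "\<exists>no. \<forall>j\<ge>no. norm (conv (\<lambda>z. Gam z * \<theta>1 (\<sigma> j) (snd z)) w z - w z) < r"
    proof (intro exI[of _ J] allI impI)
      fix j assume "j \<ge> J"
      then have "\<bar>conv (\<lambda>z. Gam z * \<theta>1 (\<sigma> j) (snd z)) w z - w z\<bar> \<le> 3 * C * e"
        by (intro s0(2)[of "\<sigma> j"] J \<sigma> t(3,8,9,10))
      then show "norm (conv (\<lambda>z. Gam z * \<theta>1 (\<sigma> j) (snd z)) w z - w z) < r" using e by simp
    qed
  qed
  from LIMSEQ_unique[OF this l1] show ?thesis .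
qed

section \<open>Regularity of the heat potential\<close>

text \<open>Integral over the past window of length h, without division by h. Its time derivative is
  the plain difference f z - f (z - h e_t), for merely continuous f.\<close>

definition tavg :: "real \<Rightarrow> ((real ^ 'n::finite) \<times> real \<Rightarrow> real) \<Rightarrow> (real ^ 'n) \<times> real \<Rightarrow> real" where
  "tavg h f z = (\<integral>\<tau>. indicator {0..h} \<tau> * f (z - \<tau> *\<^sub>R e_t) \<partial>lborel)"

context
  fixes f :: "(real ^ 'n::finite) \<times> real \<Rightarrow> real"
  assumes f: "bdsupp f" and fc: "continuous_on UNIV f"
begin

lemma bdsupp_bound: obtains B R where "0 \<le> B" "\<And>w. \<bar>f w\<bar> \<le> B" "\<And>w. norm w > R \<Longrightarrow> f w = 0"
proof -
  obtain B R where B: "0 \<le> B" "\<And>x. \<bar>f x\<bar> \<le> B * indicator (cball 0 R) x" using f by (auto simp: bdsupp_def)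
  have "\<bar>f x\<bar> \<le> B" for x using B(2)[of x] B(1) by (cases "x \<in> cball 0 R") auto
  moreover have "f w = 0" if "norm w > R" for w using B(2)[of w] that by (simp add: indicator_def)
  ultimately show thesis using that B(1) by blast
qed

lemma line_continuous: "continuous_on UNIV (\<lambda>\<tau>. f (z - \<tau> *\<^sub>R e))"
  by (rule continuous_on_compose2[OF fc]) (auto intro!: continuous_intros)

lemma tavg_integrand_measurable: "(\<lambda>\<tau>. indicator {0..h} \<tau> * f (z - \<tau> *\<^sub>R e)) \<in> borel_measurable lborel"
  unfolding measurable_lborel2
  by (intro borel_measurable_times borel_measurable_indicator borel_measurable_continuous_onI line_continuous borel_closed closed_atLeastAtMost)

lemma tavg_integrable: "integrable lborel (\<lambda>\<tau>. indicator {0..h} \<tau> * f (z - \<tau> *\<^sub>R e))"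
proof -
  obtain B R where B: "0 \<le> B" "\<And>w. \<bar>f w\<bar> \<le> B" by (rule bdsupp_bound) (rule that, assumption+)
  show ?thesis
    by (rule Bochner_Integration.integrable_bound[OF integrable_Icc_indicator[of B 0 h] tavg_integrand_measurable])
       (use B in \<open>auto simp: indicator_def\<close>)
qed

lemma tavg_continuous: "continuous_on UNIV (tavg h f)"
  unfolding continuous_on_eq_continuous_at[OF open_UNIV]
proof
  fix z
  obtain B R where B: "0 \<le> B" "\<And>w. \<bar>f w\<bar> \<le> B" by (rule bdsupp_bound) (rule that, assumption+)
  have "((\<lambda>y. \<integral>\<tau>. indicator {0..h} \<tau> * f (y - \<tau> *\<^sub>R e_t) \<partial>lborel)
      \<longlongrightarrow> (\<integral>\<tau>. indicator {0..h} \<tau> * f (z - \<tau> *\<^sub>R e_t) \<partial>lborel)) (at z within UNIV)"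
  proof (rule tendsto_integral_at[OF integrable_Icc_indicator[of B 0 h] tavg_integrand_measurable tavg_integrand_measurable])
    show "AE \<tau> in lborel. ((\<lambda>y. indicator {0..h} \<tau> * f (y - \<tau> *\<^sub>R e_t)) \<longlongrightarrow> indicator {0..h} \<tau> * f (z - \<tau> *\<^sub>R e_t)) (at z within UNIV)"
    proof (intro AE_I2 tendsto_mult_left)
      fix \<tau> :: real
      have "isCont f (z - \<tau> *\<^sub>R e_t)" by (rule isCont_UNIV[OF fc])
      moreover have "((\<lambda>y. y - \<tau> *\<^sub>R e_t) \<longlongrightarrow> z - \<tau> *\<^sub>R e_t) (at z)" by (intro tendsto_intros)
      ultimately show "((\<lambda>y. f (y - \<tau> *\<^sub>R e_t)) \<longlongrightarrow> f (z - \<tau> *\<^sub>R e_t)) (at z)" by (rule isCont_tendsto_compose)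
    qed
    show "AE \<tau> in lborel. \<bar>indicator {0..h} \<tau> * f (y - \<tau> *\<^sub>R e_t)\<bar> \<le> B * indicator {0..h} \<tau>" for y
      using B by (intro AE_I2) (auto simp: indicator_def)
  qed
  then show "isCont (tavg h f) z" by (simp add: isCont_def tavg_def[abs_def])
qed

lemma tavg_bdsupp: "bdsupp (tavg h f)"
proof -
  obtain B R where B: "0 \<le> B" "\<And>w. \<bar>f w\<bar> \<le> B" "\<And>w. norm w > R \<Longrightarrow> f w = 0" by (rule bdsupp_bound) (rule that, assumption+)
  show ?thesis
  proof (rule bdsupp_continuousI[OF tavg_continuous, of "R + \<bar>h\<bar>"])
    fix z :: "(real ^ 'n) \<times> real" assume z: "norm z > R + \<bar>h\<bar>"
    have "indicator {0..h} \<tau> * f (z - \<tau> *\<^sub>R e_t) = 0" for \<tau>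
    proof (cases "\<tau> \<in> {0..h}")
      case True
      have "norm (\<tau> *\<^sub>R e_t :: (real ^ 'n) \<times> real) \<le> \<bar>h\<bar>" using True by (simp add: e_t_def norm_Pair)
      then have "norm (z - \<tau> *\<^sub>R e_t) > R" using z norm_triangle_ineq2[of z "\<tau> *\<^sub>R e_t"] by linarith
      then show ?thesis using B(3) by simp
    qed simp
    then show "tavg h f z = 0" unfolding tavg_def by (simp only: Bochner_Integration.integral_zero)
  qed
qed

lemma tavg_dird_t:
  assumes h: "0 \<le> h"
  shows "dird e_t (tavg h f) (\<lambda>z. f z - f (z - h *\<^sub>R e_t)) UNIV"
  unfolding dird_def
proof
  fix z
  define g where "g s = f (z + s *\<^sub>R e_t)" for s
  have gc: "continuous_on A g" for A unfolding g_def
    by (rule continuous_on_compose2[OF fc]) (auto intro!: continuous_intros)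
  \<comment> \<open>The interval is wide enough that for |s| < 1 and 0 \<le> \<tau> \<le> h all
    points s - \<tau> are interior, where the antiderivative has a two-sided derivative.\<close>
  obtain G where G: "\<And>x. x \<in> {-h-2..2} \<Longrightarrow> (G has_vector_derivative g x) (at x within {-h-2..2})"
    using antiderivative_continuous[OF gc] by blast
  have G': "DERIV G x :> g x" if "-h-2 < x" "x < 2" for x
  proof -
    have "(G has_vector_derivative g x) (at x within {-h-2..2})" using that by (intro G) auto
    then show ?thesis using that at_within_interior[of x "{-h-2..2}"] by (simp add: has_real_derivative_iff_has_vector_derivative)
  qed
  have eq: "tavg h f (z + s *\<^sub>R e_t) = G s - G (s - h)" if s: "\<bar>s\<bar> < 1" for s
  proof -
    have "(\<integral>\<tau>. g (s - \<tau>) * indicator {0..h} \<tau> \<partial>lborel) = (- G (s - h)) - (- G (s - 0))"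
    proof (rule integral_FTC_Icc_real[OF h])
      fix \<tau> assume t: "0 \<le> \<tau>" "\<tau> \<le> h"
      have "DERIV (\<lambda>\<tau>. G (s - \<tau>)) \<tau> :> g (s - \<tau>) * (- 1)"
        by (rule DERIV_chain2[OF G']) (use s t in \<open>auto intro!: derivative_eq_intros\<close>)
      then show "DERIV (\<lambda>\<tau>. - G (s - \<tau>)) \<tau> :> g (s - \<tau>)" by (auto intro!: derivative_eq_intros)
      have "continuous_on UNIV (\<lambda>\<tau>. g (s - \<tau>))"
        by (rule continuous_on_compose2[OF gc[of UNIV]]) (auto intro!: continuous_intros)
      then show "isCont (\<lambda>\<tau>. g (s - \<tau>)) \<tau>" by (simp add: continuous_on_eq_continuous_at)
    qed
    moreover have "g (s - \<tau>) * indicator {0..h} \<tau> = indicator {0..h} \<tau> * f (z + s *\<^sub>R e_t - \<tau> *\<^sub>R e_t)" for \<tau>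
      by (simp add: g_def algebra_simps)
    ultimately show ?thesis unfolding tavg_def by simp
  qed
  have "((\<lambda>s. G s - G (s - h)) has_real_derivative g 0 - g (0 - h) * 1) (at 0)"
    by (intro DERIV_diff DERIV_chain2[OF G'] G') (use h in \<open>auto intro!: derivative_eq_intros\<close>)
  moreover have "\<forall>\<^sub>F s in nhds (0::real). tavg h f (z + s *\<^sub>R e_t) = G s - G (s - h)"
    using eventually_nhds_in_open[of "{-1<..<1}" "0::real"] by (auto elim!: eventually_mono intro!: eq)
  ultimately have "((\<lambda>s. tavg h f (z + s *\<^sub>R e_t)) has_real_derivative g 0 - g (0 - h) * 1) (at 0)"
    by (rule iffD2[OF DERIV_cong_ev[OF refl _ refl], rotated])
  then show "((\<lambda>s. tavg h f (z + s *\<^sub>R e_t)) has_real_derivative f z - f (z - h *\<^sub>R e_t)) (at 0)"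
    by (simp add: g_def)
qed

lemma shift_continuous: "continuous_on UNIV (\<lambda>z. f (z - a))"
  by (rule continuous_on_compose2[OF fc]) (auto intro!: continuous_intros)

lemma shift_bdsupp: "bdsupp (\<lambda>z. f (z - a))"
proof -
  have c: "continuous_on UNIV (\<lambda>z. f (z - a))" by (rule shift_continuous)
  obtain B R where B: "0 \<le> B" "\<And>w. \<bar>f w\<bar> \<le> B" "\<And>w. norm w > R \<Longrightarrow> f w = 0" by (rule bdsupp_bound) (rule that, assumption+)
  show "bdsupp (\<lambda>z. f (z - a))"
  proof (rule bdsupp_continuousI[OF c, of "R + norm a"])
    fix w :: "(real ^ 'n) \<times> real" assume "norm w > R + norm a"
    then show "f (w - a) = 0" using norm_triangle_ineq2[of w a] by (intro B(3)) linarith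
  qed
qed

end

lemma diff_bdsupp:
  assumes "bdsupp f" "bdsupp g" "continuous_on UNIV f" "continuous_on UNIV g"
  shows "bdsupp (\<lambda>z::(real ^ 'n::finite) \<times> real. f z - g z)"
proof -
  obtain B R where B: "0 \<le> B" "\<And>w. \<bar>f w\<bar> \<le> B" "\<And>w. norm w > R \<Longrightarrow> f w = 0" by (rule bdsupp_bound[OF assms(1,3)]) (rule that, assumption+)
  obtain B' R' where B': "0 \<le> B'" "\<And>w. \<bar>g w\<bar> \<le> B'" "\<And>w. norm w > R' \<Longrightarrow> g w = 0" by (rule bdsupp_bound[OF assms(2,4)]) (rule that, assumption+)
  show ?thesis
    by (rule bdsupp_continuousI[of _ "max R R'"]) (use assms B(3) B'(3) in \<open>auto intro!: continuous_intros\<close>)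
qed

lemma tavg_dird_x:
  assumes f: "bdsupp f" "continuous_on UNIV f" and fx: "bdsupp fx" "continuous_on UNIV fx" and d: "dird e f fx UNIV"
  shows "dird e (tavg h f) (tavg h fx) UNIV"
  unfolding dird_def
proof
  fix z
  obtain B R where B: "0 \<le> B" "\<And>w. \<bar>fx w\<bar> \<le> B" by (rule bdsupp_bound[OF fx]) (rule that, assumption+)
  have "((\<lambda>s. \<integral>\<tau>. indicator {0..h} \<tau> * f (z + s *\<^sub>R e - \<tau> *\<^sub>R e_t) \<partial>lborel) has_real_derivative
     (\<integral>\<tau>. indicator {0..h} \<tau> * fx (z + 0 *\<^sub>R e - \<tau> *\<^sub>R e_t) \<partial>lborel)) (at 0)"
  proof (rule DERIV_integral[where f'="\<lambda>s \<tau>. indicator {0..h} \<tau> * fx (z + s *\<^sub>R e - \<tau> *\<^sub>R e_t)", OF zero_less_one integrable_Icc_indicator[of B 0 h]])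
    fix s :: real
    show "integrable lborel (\<lambda>\<tau>. indicator {0..h} \<tau> * f (z + s *\<^sub>R e - \<tau> *\<^sub>R e_t))" by (rule tavg_integrable[OF f])
    fix \<tau> :: real
    have "((\<lambda>s. f ((z - \<tau> *\<^sub>R e_t) + s *\<^sub>R e)) has_real_derivative fx ((z - \<tau> *\<^sub>R e_t) + s *\<^sub>R e)) (at s)"
      by (rule dird_line[OF d]) simp
    then show "((\<lambda>s. indicator {0..h} \<tau> * f (z + s *\<^sub>R e - \<tau> *\<^sub>R e_t)) has_real_derivative
        indicator {0..h} \<tau> * fx (z + s *\<^sub>R e - \<tau> *\<^sub>R e_t)) (at s)"
      by (intro DERIV_cmult) (simp add: algebra_simps)
    show "\<bar>indicator {0..h} \<tau> * fx (z + s *\<^sub>R e - \<tau> *\<^sub>R e_t)\<bar> \<le> B * indicator {0..h} \<tau>"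
      using B by (auto simp: indicator_def)
  qed
  then show "((\<lambda>s. tavg h f (z + s *\<^sub>R e)) has_real_derivative tavg h fx z) (at 0)" by (simp add: tavg_def)
qed

text \<open>The heat potential of \<open>f\<close> is written through time averages of \<open>f\<close>, which are differentiable in time,
  by applying Duhamel's formula to the averages.\<close>

lemma heat_potential_dird_t:
  fixes f :: "(real ^ 'n::finite) \<times> real \<Rightarrow> real"
  assumes f: "bdsupp f" "continuous_on UNIV f"
    and fx: "\<And>i. bdsupp (fx i)" "\<And>i. continuous_on UNIV (fx i)" "\<And>i. dird (e_x i) f (fx i) UNIV"
  obtains Vt where "continuous_on UNIV Vt" "dird e_t (conv Gam f) Vt {z. snd z < T}"
proof -
  obtain B R where B: "0 \<le> B" "\<And>w. \<bar>f w\<bar> \<le> B" "\<And>w. norm w > R \<Longrightarrow> f w = 0" by (rule bdsupp_bound[OF f]) (rule that, assumption+)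
  \<comment> \<open>The window is so long that the shifted density is supported at times \<ge> h - R
    \<ge> T. By causality of the kernel its potential vanishes at times < T, so there the potential
    of the difference \<open>D f\<close> is that of \<open>f\<close>.\<close>
  define h where "h = max 0 (T + R)"
  have h: "0 \<le> h" by (simp add: h_def)
  define D where "D g z = g z - g (z - h *\<^sub>R e_t)" for g :: "(real ^ 'n) \<times> real \<Rightarrow> real" and z
  have Dc: "continuous_on UNIV (D g)" and Db: "bdsupp (D g)" if "bdsupp g" "continuous_on UNIV g" for g
    unfolding D_def
    by (intro continuous_on_diff diff_bdsupp that shift_continuous[OF that] shift_bdsupp[OF that])+
  have Dd: "dird e_t (tavg h g) (D g) UNIV" if "bdsupp g" "continuous_on UNIV g" for g
    unfolding D_def by (rule tavg_dird_t[OF that h])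
  define V' where "V' z = tavg h f z + (\<Sum>i\<in>UNIV. conv (Gamx i) (tavg h (fx i)) z)" for z
  define Vt where "Vt z = D f z + (\<Sum>i\<in>UNIV. conv (Gamx i) (D (fx i)) z)" for z
  have V: "conv Gam f z = V' z" if z: "snd z < T" for z
  proof -
    have "tavg h f z = conv Gam (D f) z - (\<Sum>i\<in>UNIV. conv (Gamx i) (tavg h (fx i)) z)"
      by (rule duhamel[OF tavg_bdsupp[OF f] tavg_continuous[OF f] Db[OF f] Dc[OF f] Dd[OF f]
         tavg_bdsupp[OF fx(1,2)] tavg_continuous[OF fx(1,2)] tavg_dird_x[OF f fx]])
    moreover have "conv Gam (D f) z = conv Gam f z - conv Gam (\<lambda>z. f (z - h *\<^sub>R e_t)) z"
      unfolding conv_def D_def right_diff_distrib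
      by (rule Bochner_Integration.integral_diff[OF conv_integrable[OF Gam_locint f(1)] conv_integrable[OF Gam_locint shift_bdsupp[OF f]]])
    moreover have "conv Gam (\<lambda>z. f (z - h *\<^sub>R e_t)) z = 0"
    proof -
      have "Gam w * f (z - w - h *\<^sub>R e_t) = 0" for w
      proof (cases "snd w \<le> 0")
        case False
        have "snd (z - w - h *\<^sub>R e_t) = snd z - snd w - h" by (simp add: e_t_def)
        also have "\<dots> < - R" using False z unfolding h_def by auto
        finally have "snd (z - w - h *\<^sub>R e_t) < - R" .
        moreover have "\<bar>snd p\<bar> \<le> norm p" for p :: "(real ^ 'n) \<times> real"
          by (metis norm_snd_le prod.collapse real_norm_def)
        from this[of "z - w - h *\<^sub>R e_t"] have "\<bar>snd (z - w - h *\<^sub>R e_t)\<bar> \<le> norm (z - w - h *\<^sub>R e_t)" .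
        ultimately have "norm (z - w - h *\<^sub>R e_t) > R" by linarith
        then show ?thesis using B(3) by simp
      qed (simp add: Gam_past)
      then show ?thesis unfolding conv_def by (simp only: Bochner_Integration.integral_zero)
    qed
    ultimately show ?thesis unfolding V'_def by simp
  qed
  have "dird e_t V' Vt UNIV"
    unfolding V'_def[abs_def] Vt_def[abs_def]
    by (rule dird_add[OF Dd[OF f] dird_sum[OF conv_dird[OF Gamx_locint tavg_bdsupp[OF fx(1,2)] Db[OF fx(1,2)] Dd[OF fx(1,2)]]]])
  then have V't: "dird e_t V' Vt {z. snd z < T}" by (rule dird_subset) simp
  have o: "open {z::(real ^ 'n) \<times> real. snd z < T}" by (intro open_Collect_less continuous_intros)
  have "dird e_t (conv Gam f) Vt {z. snd z < T}"
    by (rule dird_cong[OF V't o]) (simp_all add: V)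
  moreover have "continuous_on UNIV Vt"
    unfolding Vt_def[abs_def]
    by (intro continuous_on_add continuous_on_sum Dc f conv_continuous' Gamx_locint Db fx)
  ultimately show thesis using that by blast
qed

section \<open>A representation formula across the singular set\<close>

text \<open>The class of densities such as u^p \<psi>: singular on K, but integrable, and bounded
  away from K. Boundedness away from K is what lets the kernel singularity at a point off K be
  handled.\<close>

definition mild :: "'a::euclidean_space set \<Rightarrow> ('a \<Rightarrow> real) \<Rightarrow> bool" where
  "mild K f \<longleftrightarrow> f \<in> borel_measurable borel \<and> integrable lborel f \<and> (\<exists>R. \<forall>w. norm w > R \<longrightarrow> f w = 0) \<and>
     (\<forall>\<delta>>0. \<exists>B. 0 \<le> B \<and> (\<forall>w. \<delta> \<le> infdist w K \<longrightarrow> \<bar>f w\<bar> \<le> B))"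

lemma mild_measurable: "mild K f \<Longrightarrow> f \<in> borel_measurable borel" by (simp add: mild_def)

lemma mild_mult_bounded:
  assumes f: "mild K f" and g: "g \<in> borel_measurable borel" and b: "\<And>w. \<bar>g w\<bar> \<le> B"
  shows "mild K (\<lambda>w. f w * g w)"
  unfolding mild_def
proof (intro conjI allI impI)
  have fm: "f \<in> borel_measurable borel" and fi: "integrable lborel f" using f by (auto simp: mild_def)
  show m: "(\<lambda>w. f w * g w) \<in> borel_measurable borel" by (intro borel_measurable_times fm g)
  have B: "0 \<le> B" using b abs_ge_zero order_trans by blast
  have le: "\<bar>f w * g w\<bar> \<le> B * \<bar>f w\<bar>" for w
    using mult_left_mono[OF b[of w] abs_ge_zero[of "f w"]] by (simp add: abs_mult mult.commute)
  show "integrable lborel (\<lambda>w. f w * g w)"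
  proof (rule Bochner_Integration.integrable_bound)
    show "integrable lborel (\<lambda>w. B * \<bar>f w\<bar>)" by (intro integrable_mult_right integrable_abs fi)
    show "AE w in lborel. norm (f w * g w) \<le> norm (B * \<bar>f w\<bar>)" using le B by (intro AE_I2) simp
  qed (use m in \<open>simp add: measurable_lborel2\<close>)
  show "\<exists>R. \<forall>w. norm w > R \<longrightarrow> f w * g w = 0" using f unfolding mild_def by force
  fix \<delta> :: real assume "\<delta> > 0"
  then obtain B' where B': "0 \<le> B'" "\<And>w. \<delta> \<le> infdist w K \<Longrightarrow> \<bar>f w\<bar> \<le> B'" using f unfolding mild_def by blast
  have "\<bar>f w * g w\<bar> \<le> B * B'" if "\<delta> \<le> infdist w K" for w
    using le[of w] mult_left_mono[OF B'(2)[OF that] B] by linarith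
  then show "\<exists>B. 0 \<le> B \<and> (\<forall>w. \<delta> \<le> infdist w K \<longrightarrow> \<bar>f w * g w\<bar> \<le> B)"
    using B B'(1) by (intro exI[of _ "B * B'"]) auto
qed

lemma mild_add:
  assumes f: "mild K f" and g: "mild K g"
  shows "mild K (\<lambda>w. f w + g w)"
  unfolding mild_def
proof (intro conjI allI impI)
  show "(\<lambda>w. f w + g w) \<in> borel_measurable borel"
    using f g by (intro borel_measurable_add) (auto simp: mild_def)
  show "integrable lborel (\<lambda>w. f w + g w)"
    using f g by (intro Bochner_Integration.integrable_add) (auto simp: mild_def)
  obtain R R' where "\<And>w. norm w > R \<Longrightarrow> f w = 0" "\<And>w. norm w > R' \<Longrightarrow> g w = 0"
    using f g unfolding mild_def by blast
  then show "\<exists>R. \<forall>w. norm w > R \<longrightarrow> f w + g w = 0" by (intro exI[of _ "max R R'"]) auto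
  fix \<delta> :: real assume d: "\<delta> > 0"
  obtain B where B: "0 \<le> B" "\<And>w. \<delta> \<le> infdist w K \<Longrightarrow> \<bar>f w\<bar> \<le> B" using f d unfolding mild_def by blast
  obtain B' where B': "0 \<le> B'" "\<And>w. \<delta> \<le> infdist w K \<Longrightarrow> \<bar>g w\<bar> \<le> B'" using g d unfolding mild_def by blast
  have "\<bar>f w + g w\<bar> \<le> B + B'" if "\<delta> \<le> infdist w K" for w
    using B(2)[OF that] B'(2)[OF that] by linarith
  then show "\<exists>B. 0 \<le> B \<and> (\<forall>w. \<delta> \<le> infdist w K \<longrightarrow> \<bar>f w + g w\<bar> \<le> B)"
    using B(1) B'(1) by (intro exI[of _ "B + B'"]) auto
qed

text \<open>The singularities of the two factors lie apart. Within half the distance from z to K the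
  density is bounded and the kernel integrable; farther from z the kernel is bounded on the relevant
  annulus and the density integrable.\<close>

lemma mild_integrable:
  fixes k f :: "'a::euclidean_space \<Rightarrow> real"
  assumes k: "locint k" "continuous_on (- {0}) k" and f: "mild K f" and z: "0 < infdist z K"
  shows "integrable lborel (\<lambda>w. k (z - w) * f w)"
proof -
  let ?d = "infdist z K / 2"
  have km: "k \<in> borel_measurable borel" and fm: "f \<in> borel_measurable borel" and fi: "integrable lborel f"
    using k f by (auto simp: locint_def mild_def)
  obtain R where R: "\<And>w. norm w > R \<Longrightarrow> f w = 0" using f by (auto simp: mild_def)
  obtain B where B: "0 \<le> B" "\<And>w. ?d \<le> infdist w K \<Longrightarrow> \<bar>f w\<bar> \<le> B"
    using f z unfolding mild_def by (meson half_gt_zero)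
  obtain C where C: "0 \<le> C" "\<And>x. ?d \<le> norm x \<Longrightarrow> norm x \<le> norm z + R \<Longrightarrow> \<bar>k x\<bar> \<le> C"
    using annulus_bounded[OF k(2), of ?d "norm z + R"] z by auto
  let ?g = "\<lambda>x. indicator (cball 0 ?d) x * k x"
  have gi: "integrable lborel ?g" using k(1) by (simp add: locint_def)
  have gm: "?g \<in> borel_measurable borel"
    by (intro borel_measurable_times borel_measurable_indicator km borel_closed closed_cball)
  have dom: "integrable lborel (\<lambda>w. B * \<bar>?g (z - w)\<bar> + C * \<bar>f w\<bar>)"
    using gi by (intro Bochner_Integration.integrable_add integrable_mult_right integrable_abs fi)
      (simp add: integrable_reflect[OF gm, of z])
  have rm: "(\<lambda>w. k (z - w)) \<in> borel_measurable borel"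
    by (rule measurable_compose[OF _ km]) (intro borel_measurable_continuous_onI continuous_intros)
  show ?thesis
  proof (rule Bochner_Integration.integrable_bound[OF dom])
    show "(\<lambda>w. k (z - w) * f w) \<in> borel_measurable lborel"
      unfolding measurable_lborel2 by (intro borel_measurable_times rm fm)
    show "AE w in lborel. norm (k (z - w) * f w) \<le> norm (B * \<bar>?g (z - w)\<bar> + C * \<bar>f w\<bar>)"
    proof (intro AE_I2)
      fix w
      have "\<bar>k (z - w) * f w\<bar> \<le> B * \<bar>?g (z - w)\<bar> + C * \<bar>f w\<bar>"
      proof (cases "norm (z - w) \<le> ?d")
        case True
        have "infdist z K \<le> infdist w K + dist z w" by (rule infdist_triangle)
        then have "?d \<le> infdist w K" using True by (simp add: dist_norm)
        then have "\<bar>k (z - w)\<bar> * \<bar>f w\<bar> \<le> \<bar>k (z - w)\<bar> * B" by (intro mult_left_mono B(2)) auto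
        moreover have "0 \<le> C * \<bar>f w\<bar>" using C(1) by simp
        ultimately show ?thesis using True by (simp add: abs_mult mult.commute)
      next
        case False
        show ?thesis
        proof (cases "norm w > R")
          case True
          then show ?thesis using R B(1) C(1) by simp
        next
          case F2: False
          have "norm (z - w) \<le> norm z + R" using F2 norm_triangle_ineq4[of z w] by linarith
          then have "\<bar>k (z - w)\<bar> \<le> C" using C(2)[of "z - w"] False by simp
          then have "\<bar>k (z - w)\<bar> * \<bar>f w\<bar> \<le> C * \<bar>f w\<bar>" by (intro mult_right_mono) auto
          moreover have "0 \<le> B * \<bar>?g (z - w)\<bar>" using B(1) by simp
          ultimately show ?thesis by (simp add: abs_mult)
        qed
      qed
      then show "norm (k (z - w) * f w) \<le> norm (B * \<bar>?g (z - w)\<bar> + C * \<bar>f w\<bar>)" by simp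
    qed
  qed
qed

lemma conv_mild_lim:
  fixes k f :: "'a::euclidean_space \<Rightarrow> real"
  assumes k: "locint k" "continuous_on (- {0}) k" and f: "mild K f" and z: "0 < infdist z K"
    and \<eta>: "\<And>j. continuous_on UNIV (\<eta> j)" "\<And>j w. 0 \<le> \<eta> j w \<and> \<eta> j w \<le> (1::real)"
    and lim: "\<And>w. 0 < infdist w K \<Longrightarrow> \<forall>\<^sub>F j in sequentially. \<eta> j w = 1"
    and N: "K \<in> null_sets lborel" "closed K" "K \<noteq> {}"
  shows "(\<lambda>j::nat. conv k (\<lambda>w. f w * \<eta> j w) z) \<longlonglongrightarrow> conv k f z"
proof -
  have km: "k \<in> borel_measurable borel" and fm: "f \<in> borel_measurable borel" using k f by (auto simp: locint_def mild_def)
  have \<eta>m: "\<eta> j \<in> borel_measurable borel" for j by (rule borel_measurable_continuous_onI[OF \<eta>(1)])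
  have fm2: "(\<lambda>w. f w * \<eta> j w) \<in> borel_measurable borel" for j by (intro borel_measurable_times fm \<eta>m)
  have rm: "(\<lambda>w. k (z - w)) \<in> borel_measurable borel"
    by (rule measurable_compose[OF _ km]) (intro borel_measurable_continuous_onI continuous_intros)
  show ?thesis unfolding conv_alt[OF km fm] conv_alt[OF km fm2]
  proof (rule integral_dominated_convergence)
    show "integrable lborel (\<lambda>w. \<bar>k (z - w) * f w\<bar>)" by (intro integrable_abs mild_integrable[OF k f z])
    show "(\<lambda>w. k (z - w) * f w) \<in> borel_measurable lborel" "(\<lambda>w. k (z - w) * (f w * \<eta> j w)) \<in> borel_measurable lborel" for j
      unfolding measurable_lborel2 by (intro borel_measurable_times rm fm \<eta>m)+
    show "AE w in lborel. (\<lambda>j. k (z - w) * (f w * \<eta> j w)) \<longlonglongrightarrow> k (z - w) * f w"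
      using AE_not_in[OF N(1)]
    proof eventually_elim
      case (elim w)
      then have "0 < infdist w K" using infdist_pos_not_in_closed[OF N(2,3)] by blast
      from lim[OF this] have "\<forall>\<^sub>F j in sequentially. k (z - w) * f w = k (z - w) * (f w * \<eta> j w)"
        by eventually_elim simp
      then show ?case by (rule Lim_transform_eventually[OF tendsto_const])
    qed
    show "AE w in lborel. norm (k (z - w) * (f w * \<eta> j w)) \<le> \<bar>k (z - w) * f w\<bar>" for j
    proof (intro AE_I2)
      fix w
      have "norm (k (z - w) * (f w * \<eta> j w)) = \<bar>k (z - w) * f w\<bar> * \<eta> j w" using \<eta>(2)[of j w] by (simp add: abs_mult)
      also have "\<dots> \<le> \<bar>k (z - w) * f w\<bar> * 1" using \<eta>(2)[of j w] by (intro mult_left_mono) auto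
      finally show "norm (k (z - w) * (f w * \<eta> j w)) \<le> \<bar>k (z - w) * f w\<bar>" by simp
    qed
  qed
qed

text \<open>A density living in the tube of radius 3 \<epsilon> \<le> 1 is seen from z at distance
  at least half of that to K, where the kernel is bounded; the rest is the volume of the tube. The
  constant may depend on z but not on the density, \<epsilon> or \<open>M\<close>.\<close>

lemma conv_tube_bound:
  fixes k :: "'a::euclidean_space \<Rightarrow> real"
  assumes k: "continuous_on (- {0}) k" "k \<in> borel_measurable borel" and K: "compact K" "K \<noteq> {}" and z: "0 < infdist z K"
    and cov: "cov d K" "d \<le> DIM('a)"
  obtains C where "0 \<le> C" "\<And>f \<epsilon> M. f \<in> borel_measurable borel \<Longrightarrow> 0 < \<epsilon> \<Longrightarrow> 3 * \<epsilon> \<le> 1 \<Longrightarrow> 6 * \<epsilon> \<le> infdist z K \<Longrightarrow>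
    0 \<le> M \<Longrightarrow> (\<And>w. \<bar>f w\<bar> \<le> M) \<Longrightarrow> (\<And>w. infdist w K > 3 * \<epsilon> \<Longrightarrow> f w = 0) \<Longrightarrow>
    \<bar>conv k f z\<bar> \<le> C * M * \<epsilon> ^ (DIM('a) - d)"
proof -
  let ?e = "DIM('a) - d"
  obtain V where V: "0 \<le> V" "\<And>\<epsilon>. 0 < \<epsilon> \<Longrightarrow> \<epsilon> \<le> 1 \<Longrightarrow>
    emeasure lborel {z. infdist z K \<le> \<epsilon>} \<le> ennreal (V * \<epsilon> ^ ?e)" using tube_volume[OF cov K(2)] by blast
  obtain R where R: "\<And>w. w \<in> K \<Longrightarrow> norm w \<le> R" using compact_imp_bounded[OF K(1)] bounded_iff by blast
  obtain C where C: "0 \<le> C" "\<And>x. infdist z K / 2 \<le> norm x \<Longrightarrow> norm x \<le> norm z + (R + 2) \<Longrightarrow> \<bar>k x\<bar> \<le> C"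
    using annulus_bounded[OF k(1), of "infdist z K / 2" "norm z + (R + 2)"] z by auto
  show thesis
  proof (rule that[of "C * V * 3 ^ ?e"])
    show "0 \<le> C * V * 3 ^ ?e" using C V by simp
    fix f and \<epsilon> M :: real
    assume fm: "f \<in> borel_measurable borel" and e: "0 < \<epsilon>" "3 * \<epsilon> \<le> 1" "6 * \<epsilon> \<le> infdist z K"
      and M: "0 \<le> M" "\<And>w. \<bar>f w\<bar> \<le> M" and 0: "\<And>w. infdist w K > 3 * \<epsilon> \<Longrightarrow> f w = 0"
    define T where "T = {w. infdist w K \<le> 3 * \<epsilon>}"
    have Tc: "closed T" unfolding T_def by (intro closed_Collect_le continuous_intros)
    have Te: "emeasure lborel T \<le> ennreal (V * (3 * \<epsilon>) ^ ?e)" unfolding T_def by (rule V(2)) (use e in auto)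
    then have Tf: "emeasure lborel T < \<infinity>" by (rule le_less_trans) simp
    have Tm: "measure lborel T \<le> V * (3 * \<epsilon>) ^ ?e"
      unfolding measure_def using enn2real_mono[OF Te] V(1) e by simp
    have rm: "(\<lambda>w. k (z - w)) \<in> borel_measurable borel"
      by (rule measurable_compose[OF _ k(2)]) (intro borel_measurable_continuous_onI continuous_intros)
    have b: "\<bar>k (z - w) * f w\<bar> \<le> C * M * indicator T w" for w
    proof (cases "w \<in> T")
      case True
      then have w: "infdist w K \<le> 3 * \<epsilon>" by (simp add: T_def)
      have "infdist z K \<le> infdist w K + dist z w" by (rule infdist_triangle)
      then have 1: "infdist z K / 2 \<le> norm (z - w)" using w e by (simp add: dist_norm)
      have "infdist w K < 2" using w e by linarith
      then obtain a where a: "a \<in> K" "dist w a < 2"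
        using K(2) cINF_less_iff[of K "dist w" 2] by (auto simp: infdist_notempty)
      have "norm w \<le> norm a + dist w a" using norm_triangle_ineq[of a "w - a"] by (simp add: dist_norm)
      then have "norm (z - w) \<le> norm z + (R + 2)" using R[OF a(1)] a(2) norm_triangle_ineq4[of z w] by linarith
      from C(2)[OF 1 this] have "\<bar>k (z - w)\<bar> * \<bar>f w\<bar> \<le> C * M" using M C(1) by (intro mult_mono) auto
      then show ?thesis using True by (simp add: abs_mult)
    next
      case False
      then show ?thesis using 0[of w] by (simp add: T_def)
    qed
    have i1: "integrable lborel (\<lambda>w. C * M * indicator T w)"
      by (intro integrable_mult_right integrable_real_indicator Tf) (simp add: borel_closed[OF Tc])
    have i2: "integrable lborel (\<lambda>w. k (z - w) * f w)"
    proof (rule Bochner_Integration.integrable_bound[OF i1])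
      show "(\<lambda>w. k (z - w) * f w) \<in> borel_measurable lborel"
        unfolding measurable_lborel2 by (intro borel_measurable_times rm fm)
      show "AE w in lborel. norm (k (z - w) * f w) \<le> norm (C * M * indicator T w)"
        using b by (intro AE_I2) (metis abs_ge_self order_trans real_norm_def)
    qed
    have "\<bar>conv k f z\<bar> \<le> (\<integral>w. \<bar>k (z - w) * f w\<bar> \<partial>lborel)"
      unfolding conv_alt[OF k(2) fm] using integral_norm_bound[of lborel "\<lambda>w. k (z - w) * f w"] by simp
    also have "\<dots> \<le> (\<integral>w. C * M * indicator T w \<partial>lborel)"
      by (intro integral_mono integrable_abs i1 i2 b)
    also have "\<dots> = C * M * measure lborel T" by simp
    also have "\<dots> \<le> C * M * (V * (3 * \<epsilon>) ^ ?e)" using C(1) M(1) Tm by (intro mult_left_mono) auto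
    also have "\<dots> = C * V * 3 ^ ?e * M * \<epsilon> ^ ?e" by (simp add: power_mult_distrib mult_ac)
    finally show "\<bar>conv k f z\<bar> \<le> C * V * 3 ^ ?e * M * \<epsilon> ^ ?e" .
  qed
qed

lemma conv_add:
  assumes "integrable lborel (\<lambda>w. k (z - w) * f w)" "integrable lborel (\<lambda>w. k (z - w) * g w)"
    and "k \<in> borel_measurable borel" "f \<in> borel_measurable borel" "g \<in> borel_measurable borel"
  shows "conv k (\<lambda>w. f w + g w) z = conv k f z + conv k g z"
  using assms by (simp add: conv_alt borel_measurable_add distrib_left)

section \<open>Cutoffs, singular solutions and their growth\<close>

locale cutoff_function =
  fixes \<psi> :: "(real ^ 'n::finite) \<times> real \<Rightarrow> real" and \<psi>t and \<psi>x \<psi>xx :: "'n \<Rightarrow> (real ^ 'n) \<times> real \<Rightarrow> real" and C :: "((real ^ 'n) \<times> real) set"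
  assumes \<psi>c: "continuous_on UNIV \<psi>" "continuous_on UNIV \<psi>t" "\<And>i. continuous_on UNIV (\<psi>x i)" "\<And>i. continuous_on UNIV (\<psi>xx i)"
    and \<psi>d: "dird e_t \<psi> \<psi>t UNIV" "\<And>i. dird (e_x i) \<psi> (\<psi>x i) UNIV" "\<And>i. dird (e_x i) (\<psi>x i) (\<psi>xx i) UNIV"
    and C: "compact C" and \<psi>0: "\<And>w. w \<notin> C \<Longrightarrow> \<psi> w = 0" and \<psi>01: "\<And>w. 0 \<le> \<psi> w" "\<And>w. \<psi> w \<le> 1"
begin

lemma derivs_0:
  assumes "open P" "\<And>w. w \<in> P \<Longrightarrow> \<psi> w = c" "w \<in> P"
  shows "\<psi>t w = 0" "\<psi>x i w = 0" "\<psi>xx i w = 0"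
proof -
  show "\<psi>t w = 0" by (rule dird_locally_const[OF \<psi>d(1) assms(1) _ assms(2,3)]) auto
  have x: "\<psi>x i w = 0" if "w \<in> P" for w by (rule dird_locally_const[OF \<psi>d(2) assms(1) _ assms(2) that]) auto
  show "\<psi>x i w = 0" by (rule x[OF assms(3)])
  show "\<psi>xx i w = 0" by (rule dird_locally_const[OF \<psi>d(3) assms(1) _ x assms(3)]) auto
qed

lemma off_C: "w \<notin> C \<Longrightarrow> \<psi>t w = 0" "w \<notin> C \<Longrightarrow> \<psi>x i w = 0" "w \<notin> C \<Longrightarrow> \<psi>xx i w = 0"
  using derivs_0[of "- C" 0 w] \<psi>0 compact_imp_closed[OF C] by auto

end

lemma bounded_cutoff:
  assumes c: "continuous_on UNIV (g :: 'a::euclidean_space \<Rightarrow> real)" and C: "compact C" and 0: "\<And>w. w \<notin> C \<Longrightarrow> g w = 0"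
  obtains B where "0 \<le> B" "\<And>w. \<bar>g w\<bar> \<le> B"
proof -
  have "compact (g ` C)" by (intro compact_continuous_image continuous_on_subset[OF c] C) auto
  then obtain B where B: "\<And>w. w \<in> C \<Longrightarrow> \<bar>g w\<bar> \<le> B" by (metis compact_imp_bounded bounded_iff imageI real_norm_def)
  have "\<bar>g w\<bar> \<le> max B 0" for w using B[of w] 0[of w] by (cases "w \<in> C") auto
  then show thesis by (intro that[of "max B 0"]) auto
qed

text \<open>The local situation with the moving geometry removed: K is a compact set with covering
  dimension m + 1, and the growth condition uses the distance in space-time. Setting u to 0 off Q -
  K makes it globally measurable, while its derivatives may be arbitrary there.\<close>

locale singular_solution =
  fixes K Q :: "((real ^ 'n::finite) \<times> real) set" and u ut :: "(real ^ 'n) \<times> real \<Rightarrow> real"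
    and ux uxx :: "'n \<Rightarrow> (real ^ 'n) \<times> real \<Rightarrow> real" and m :: nat and p :: real
  assumes K: "compact K" "K \<noteq> {}" "cov (Suc m) K" and nm: "CARD('n) \<ge> m + 3" and Q: "open Q"
    and u0: "\<And>z. z \<notin> Q - K \<Longrightarrow> u z = 0" and unn: "\<And>z. 0 \<le> u z"
    and uc: "continuous_on (Q - K) u" "continuous_on (Q - K) ut" "\<And>i. continuous_on (Q - K) (ux i)" "\<And>i. continuous_on (Q - K) (uxx i)"
    and ud: "dird e_t u ut (Q - K)" "\<And>i. dird (e_x i) u (ux i) (Q - K)" "\<And>i. dird (e_x i) (ux i) (uxx i) (Q - K)"
    and pde: "\<And>z. z \<in> Q - K \<Longrightarrow> ut z - (\<Sum>i\<in>UNIV. uxx i z) = - (u z powr p)"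
    and growth: "\<And>e. e > 0 \<Longrightarrow> \<exists>\<delta>>0. \<forall>z\<in>Q - K. infdist z K < \<delta> \<longrightarrow> infdist z K ^ (CARD('n) - m - 2) * u z \<le> e"
    and p: "1 < p" "p < real (CARD('n) - m) / real (CARD('n) - m - 2)"
begin

lemma codim: "CARD('n) - m = (CARD('n) - m - 2) + 2" "1 \<le> (CARD('n) - m - 2)" using nm by auto

lemma Kcl: "closed K" by (rule compact_imp_closed[OF K(1)])

lemma Knull: "K \<in> null_sets lborel"
  by (rule cov_null_sets[OF K(3) _ Kcl]) (use nm in simp)

lemma Gopen: "open (Q - K)" using Q Kcl by (rule open_Diff)

lemma inf_pos: "z \<notin> K \<Longrightarrow> 0 < infdist z K" using infdist_pos_not_in_closed[OF Kcl K(2)] by blast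

lemma um: "u \<in> borel_measurable borel"
proof -
  have "(\<lambda>x. indicator (Q - K) x *\<^sub>R u x) \<in> borel_measurable borel"
    by (rule borel_measurable_continuous_on_indicator[OF _ uc(1)]) (rule borel_open[OF Gopen])
  also have "(\<lambda>x. indicator (Q - K) x *\<^sub>R u x) = u"
    using u0 by (auto simp: fun_eq_iff indicator_def)
  finally show ?thesis .
qed

lemma u_bounded_away:
  assumes C: "compact C" "C \<subseteq> Q" and d: "\<delta> > 0"
  obtains B where "0 \<le> B" "\<And>w. w \<in> C \<Longrightarrow> \<delta> \<le> infdist w K \<Longrightarrow> u w \<le> B"
proof -
  let ?D = "C \<inter> {w. \<delta> \<le> infdist w K}"
  have "closed {w. \<delta> \<le> infdist w K}" by (intro closed_Collect_le continuous_intros)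
  then have D: "compact ?D" using C(1) by (rule compact_Int_closed[rotated])
  have "?D \<subseteq> Q - K" using C(2) d by auto
  then have "compact (u ` ?D)" by (intro compact_continuous_image D continuous_on_subset[OF uc(1)])
  then obtain B where "\<And>w. w \<in> ?D \<Longrightarrow> \<bar>u w\<bar> \<le> B" by (metis compact_imp_bounded bounded_iff imageI real_norm_def)
  then show thesis by (intro that[of "max B 0"]) (force simp: max_def)+
qed

text \<open>K has codimension (n+1) - (m+1) = n - m in space-time, so u^q \<le> d^(-(n-m-2)q) near K
  is integrable under the stated bound on q. The cases used are q = 1 and q = p.\<close>

lemma u_mild:
  assumes C: "compact C" "C \<subseteq> Q" and q: "1 \<le> q" "real (CARD('n) - m - 2) * q < real (CARD('n) - m)"
  shows "mild K (\<lambda>w. indicator C w * u w powr q)"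
  unfolding mild_def
proof (intro conjI allI impI)
  have qm: "(\<lambda>w. u w powr q) \<in> borel_measurable borel" by (intro powr_real_measurable um borel_measurable_const)
  show m: "(\<lambda>w. indicator C w * u w powr q) \<in> borel_measurable borel"
    by (intro borel_measurable_times borel_measurable_indicator qm borel_closed compact_imp_closed C)
  obtain R where R: "\<And>w. w \<in> C \<Longrightarrow> norm w \<le> R" using compact_imp_bounded[OF C(1)] bounded_iff by blast
  show "\<exists>R. \<forall>w. norm w > R \<longrightarrow> indicator C w * u w powr q = 0"
    using R by (intro exI[of _ R]) (force simp: indicator_def)
  show "\<exists>B. 0 \<le> B \<and> (\<forall>w. \<delta> \<le> infdist w K \<longrightarrow> \<bar>indicator C w * u w powr q\<bar> \<le> B)" if d: "\<delta> > 0" for \<delta>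
  proof -
    obtain B where B: "0 \<le> B" "\<And>w. w \<in> C \<Longrightarrow> \<delta> \<le> infdist w K \<Longrightarrow> u w \<le> B" using u_bounded_away[OF C d] by blast
    have "\<bar>indicator C w * u w powr q\<bar> \<le> B powr q" if "\<delta> \<le> infdist w K" for w
      using B(2)[of w] that unn[of w] q by (cases "w \<in> C") (auto intro!: powr_mono2)
    then show ?thesis by (intro exI[of _ "B powr q"]) auto
  qed
  obtain \<delta> where d: "\<delta> > 0" "\<And>z. z \<in> Q - K \<Longrightarrow> infdist z K < \<delta> \<Longrightarrow> infdist z K ^ (CARD('n) - m - 2) * u z \<le> 1"
    using growth[of 1] by auto
  obtain B where B: "0 \<le> B" "\<And>w. w \<in> C \<Longrightarrow> \<delta> \<le> infdist w K \<Longrightarrow> u w \<le> B" using u_bounded_away[OF C d(1)] by blast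
  let ?dom = "\<lambda>w. B powr q * indicator (cball 0 R) w + indicator (cball 0 R) w * infdist w K powr (- (real (CARD('n) - m - 2) * q))"
  have dom: "integrable lborel ?dom"
  proof (intro Bochner_Integration.integrable_add integrable_cball_indicator integrable_infdist_powr[OF K(3) _ K(2)])
    show "Suc m < DIM((real ^ 'n) \<times> real)" using nm by simp
    show "0 \<le> real (CARD('n) - m - 2) * q" using q by simp
    show "real (CARD('n) - m - 2) * q < real (DIM((real ^ 'n) \<times> real) - Suc m)" using q(2) nm by simp
  qed
  show "integrable lborel (\<lambda>w. indicator C w * u w powr q)"
  proof (rule Bochner_Integration.integrable_bound[OF dom])
    show "(\<lambda>w. indicator C w * u w powr q) \<in> borel_measurable lborel" using m by (simp only: measurable_lborel2)
    show "AE w in lborel. norm (indicator C w * u w powr q) \<le> norm (?dom w)"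
    proof (intro AE_I2)
      fix w
      have nn: "0 \<le> ?dom w" by simp
      have "indicator C w * u w powr q \<le> ?dom w"
      proof (cases "w \<in> C \<and> w \<notin> K")
        case True
        then have w: "w \<in> C" "w \<in> Q - K" "w \<in> cball 0 R" using C(2) R by auto
        show ?thesis
        proof (cases "infdist w K < \<delta>")
          case d1: True
          have i: "0 < infdist w K" using inf_pos True by blast
          have "infdist w K ^ (CARD('n) - m - 2) * u w \<le> 1" using d(2)[OF w(2) d1] .
          then have "u w \<le> inverse (infdist w K ^ (CARD('n) - m - 2))" using i by (simp add: field_simps)
          also have "\<dots> = infdist w K powr (- real (CARD('n) - m - 2))" using i by (simp add: powr_minus powr_realpow)
          finally have "u w powr q \<le> (infdist w K powr (- real (CARD('n) - m - 2))) powr q" using unn q by (intro powr_mono2) auto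
          also have "\<dots> = infdist w K powr (- (real (CARD('n) - m - 2) * q))" by (simp add: powr_powr)
          finally have "u w powr q \<le> infdist w K powr (- (real (CARD('n) - m - 2) * q))" .
          then show ?thesis using w by (simp add: add_increasing)
        next
          case False
          then have "u w powr q \<le> B powr q" using B(2)[OF w(1)] unn q by (intro powr_mono2) auto
          then show ?thesis using w by (simp add: add_increasing2)
        qed
      next
        case False
        then have "indicator C w * u w powr q = 0" using u0[of w] by (auto simp: indicator_def)
        with nn show ?thesis by (simp only:)
      qed
      then show "norm (indicator C w * u w powr q) \<le> norm (?dom w)" using nn by simp
    qed
  qed
qed

lemma p_sub: "real (CARD('n) - m - 2) * p < real (CARD('n) - m)"
  using p(2) codim by (simp add: field_simps)

end

locale singular_cutoff = singular_solution K Q u ut ux uxx m p + cutoff_function \<psi> \<psi>t \<psi>x \<psi>xx C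
  for K Q :: "((real ^ 'n::finite) \<times> real) set" and u ut ux uxx m p \<psi> \<psi>t \<psi>x \<psi>xx C +
  assumes CQ: "C \<subseteq> Q"
begin

text \<open>Expanding the heat operator on u \<psi> gives -u^p \<psi> + u (\<psi>_t -
  \<Delta>\<psi>) - 2 \<nabla>u \<cdot> \<nabla>\<psi>. Writing the last term as -2 div(u
  \<nabla>\<psi>) + 2 u \<Delta>\<psi> flips the sign of the Laplacian in \<open>F2\<close> and
  leaves a divergence, whose derivative moves to the kernel: these are the terms with
  \<open>H\<close> in \<open>S\<close>.\<close>

definition F1 where "F1 w = u w powr p * \<psi> w"
definition F2 where "F2 w = u w * (\<psi>t w + (\<Sum>i\<in>UNIV. \<psi>xx i w))"
definition H where "H i w = u w * \<psi>x i w"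
definition S where "S z = conv Gam F2 z - 2 * (\<Sum>i\<in>UNIV. conv (Gamx i) (H i) z)"

lemma mild_u_times:
  assumes "continuous_on UNIV g" "\<And>w. w \<notin> C \<Longrightarrow> g w = 0"
  shows "mild K (\<lambda>w. u w * g w)" "mild K (\<lambda>w. u w powr p * g w)"
proof -
  obtain B where B: "\<And>w. \<bar>g w\<bar> \<le> B" using bounded_cutoff[OF assms(1) C assms(2)] by blast
  have gm: "g \<in> borel_measurable borel" by (rule borel_measurable_continuous_onI[OF assms(1)])
  have "mild K (\<lambda>w. indicator C w * u w powr 1)" by (rule u_mild[OF C CQ]) (use codim in auto)
  from mild_mult_bounded[OF this gm B] have 1: "mild K (\<lambda>w. (indicator C w * u w powr 1) * g w)" .
  have "(indicator C w * u w powr 1) * g w = u w * g w" for w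
    using assms(2)[of w] unn[of w] by (cases "w \<in> C") (auto simp: powr_one)
  then have "(\<lambda>w. (indicator C w * u w powr 1) * g w) = (\<lambda>w. u w * g w)" by (rule ext)
  with 1 show "mild K (\<lambda>w. u w * g w)" by (simp only:)
  have "mild K (\<lambda>w. indicator C w * u w powr p)" by (rule u_mild[OF C CQ]) (use p(1) p_sub in auto)
  from mild_mult_bounded[OF this gm B] have 2: "mild K (\<lambda>w. (indicator C w * u w powr p) * g w)" .
  have "(indicator C w * u w powr p) * g w = u w powr p * g w" for w
    using assms(2)[of w] by (cases "w \<in> C") auto
  then have "(\<lambda>w. (indicator C w * u w powr p) * g w) = (\<lambda>w. u w powr p * g w)" by (rule ext)
  with 2 show "mild K (\<lambda>w. u w powr p * g w)" by (simp only:)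
qed

lemma F1_mild: "mild K F1" unfolding F1_def[abs_def] by (rule mild_u_times(2)[OF \<psi>c(1) \<psi>0])

lemma F2_mild: "mild K F2" unfolding F2_def[abs_def]
proof (rule mild_u_times(1))
  show "continuous_on UNIV (\<lambda>w. \<psi>t w + (\<Sum>i\<in>UNIV. \<psi>xx i w))" by (intro continuous_intros \<psi>c)
qed (simp add: off_C)

lemma H_mild: "mild K (H i)" unfolding H_def[abs_def] by (rule mild_u_times(1)[OF \<psi>c(3) off_C(2)])

text \<open>No derivative of \<open>u\<close> survives, so the growth condition on \<open>u\<close> alone suffices to let \<open>\<zeta>\<close> approach a cutoff
  that does not vanish on \<open>K\<close>.\<close>

lemma duhamel_cutoff:
  assumes z: "cutoff_function \<zeta> \<zeta>t \<zeta>x \<zeta>xx D" and D: "D \<subseteq> Q - K"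
  shows "u z * \<zeta> z = conv Gam (\<lambda>w. - (u w powr p * \<zeta> w) + u w * (\<zeta>t w + (\<Sum>i\<in>UNIV. \<zeta>xx i w))) z
     - 2 * (\<Sum>i\<in>UNIV. conv (Gamx i) (\<lambda>w. u w * \<zeta>x i w) z)"
proof -
  interpret Z: cutoff_function \<zeta> \<zeta>t \<zeta>x \<zeta>xx D by (rule z)
  have Dcl: "closed D" by (rule compact_imp_closed[OF Z.C])
  obtain R where R: "\<And>w. w \<in> D \<Longrightarrow> norm w \<le> R" using compact_imp_bounded[OF Z.C] bounded_iff by blast
  have cm: "continuous_on UNIV (\<lambda>w. a w * b w)" "bdsupp (\<lambda>w. a w * b w)"
    if a: "continuous_on (Q - K) a" and b: "continuous_on UNIV b" "\<And>w. w \<notin> D \<Longrightarrow> b w = 0" for a b :: "(real ^ 'n) \<times> real \<Rightarrow> real"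
  proof -
    show c: "continuous_on UNIV (\<lambda>w. a w * b w)" by (rule continuous_mult_cutoff[OF a b(1) Dcl D Gopen b(2)])
    show "bdsupp (\<lambda>w. a w * b w)"
      by (rule bdsupp_continuousI[OF c, of R]) (use R b(2) in force)
  qed
  have bsum: "bdsupp (\<lambda>w. a w + b w)" if "continuous_on UNIV (\<lambda>w. a w + b w)" "\<And>w. w \<notin> D \<Longrightarrow> a w = 0" "\<And>w. w \<notin> D \<Longrightarrow> b w = 0"
    for a b :: "(real ^ 'n) \<times> real \<Rightarrow> real"
  proof (rule bdsupp_continuousI[OF that(1), of R])
    fix w :: "(real ^ 'n) \<times> real" assume "norm w > R"
    then have "w \<notin> D" using R[of w] by auto
    then show "a w + b w = 0" using that(2,3) by simp
  qed
  have bdiff: "bdsupp (\<lambda>w. a w - b w)" if "continuous_on UNIV (\<lambda>w. a w - b w)" "\<And>w. w \<notin> D \<Longrightarrow> a w = 0" "\<And>w. w \<notin> D \<Longrightarrow> b w = 0"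
    for a b :: "(real ^ 'n) \<times> real \<Rightarrow> real"
  proof (rule bdsupp_continuousI[OF that(1), of R])
    fix w :: "(real ^ 'n) \<times> real" assume "norm w > R"
    then have "w \<notin> D" using R[of w] by auto
    then show "a w - b w = 0" using that(2,3) by simp
  qed
  note zz = Z.\<psi>0 Z.off_C
  define wt where "wt w = ut w * \<zeta> w + u w * \<zeta>t w" for w
  define wx where "wx i w = ux i w * \<zeta> w + u w * \<zeta>x i w" for i w
  \<comment> \<open>The gradient is split as wx = g + 2 u \<zeta>x. In the divergence of g the
    products of first derivatives cancel, leaving \<zeta> \<Delta>u - u \<Delta>\<zeta>, so the
    equation for u can be inserted.\<close>
  define g where "g i w = ux i w * \<zeta> w - u w * \<zeta>x i w" for i w
  define g' where "g' i w = uxx i w * \<zeta> w - u w * \<zeta>xx i w" for i w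
  have cwt: "continuous_on UNIV wt" unfolding wt_def[abs_def]
    by (intro continuous_on_add cm(1) uc Z.\<psi>c zz)
  have cwx: "continuous_on UNIV (wx i)" for i unfolding wx_def[abs_def]
    by (intro continuous_on_add cm(1) uc Z.\<psi>c zz)
  have cg: "continuous_on UNIV (g i)" for i unfolding g_def[abs_def]
    by (intro continuous_on_diff cm(1) uc Z.\<psi>c zz)
  have cg': "continuous_on UNIV (g' i)" for i unfolding g'_def[abs_def]
    by (intro continuous_on_diff cm(1) uc Z.\<psi>c zz)
  have bwt: "bdsupp wt" unfolding wt_def[abs_def] by (rule bsum[OF cwt[unfolded wt_def[abs_def]]]) (simp_all add: zz)
  have bwx: "bdsupp (wx i)" for i unfolding wx_def[abs_def] by (rule bsum[OF cwx[unfolded wx_def[abs_def]]]) (simp_all add: zz)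
  have bg: "bdsupp (g i)" for i unfolding g_def[abs_def] by (rule bdiff[OF cg[unfolded g_def[abs_def]]]) (simp_all add: zz)
  have bg': "bdsupp (g' i)" for i unfolding g'_def[abs_def] by (rule bdiff[OF cg'[unfolded g'_def[abs_def]]]) (simp_all add: zz)
  have dwt: "dird e_t (\<lambda>w. u w * \<zeta> w) wt UNIV" unfolding wt_def[abs_def]
    by (rule dird_mult_cutoff[OF ud(1) Z.\<psi>d(1) Dcl D Z.\<psi>0])
  have dwx: "dird (e_x i) (\<lambda>w. u w * \<zeta> w) (wx i) UNIV" for i unfolding wx_def[abs_def]
    by (rule dird_mult_cutoff[OF ud(2) Z.\<psi>d(2) Dcl D Z.\<psi>0])
  have dg: "dird (e_x i) (g i) (g' i) UNIV" for i
  proof -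
    have "dird (e_x i) (g i) (\<lambda>w. (uxx i w * \<zeta> w + ux i w * \<zeta>x i w) - (ux i w * \<zeta>x i w + u w * \<zeta>xx i w)) UNIV"
      unfolding g_def[abs_def]
      by (rule dird_diff[OF dird_mult_cutoff[OF ud(3) Z.\<psi>d(2) Dcl D Z.\<psi>0] dird_mult_cutoff[OF ud(2) Z.\<psi>d(3) Dcl D Z.off_C(2)]])
    moreover have "(\<lambda>w. (uxx i w * \<zeta> w + ux i w * \<zeta>x i w) - (ux i w * \<zeta>x i w + u w * \<zeta>xx i w)) = g' i"
      unfolding g'_def[abs_def] by (simp add: fun_eq_iff)
    ultimately show ?thesis by simp
  qed
  have uz: "bdsupp (\<lambda>w. u w * \<zeta> w)" "continuous_on UNIV (\<lambda>w. u w * \<zeta> w)"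
    by (rule cm(2)[OF uc(1) Z.\<psi>c(1) Z.\<psi>0] cm(1)[OF uc(1) Z.\<psi>c(1) Z.\<psi>0], assumption)+
  have uzx: "bdsupp (\<lambda>w. u w * \<zeta>x i w)" for i by (intro cm(2) uc Z.\<psi>c zz)
  have "u z * \<zeta> z = conv Gam wt z - (\<Sum>i\<in>UNIV. conv (Gamx i) (wx i) z)"
    by (rule duhamel[OF uz bwt cwt dwt bwx cwx dwx])
  also have "conv (Gamx i) (wx i) z = conv Gam (g' i) z + 2 * conv (Gamx i) (\<lambda>w. u w * \<zeta>x i w) z" for i
  proof -
    have "conv (Gamx i) (wx i) z = (\<integral>w. Gamx i w * g i (z - w) + 2 * (Gamx i w * (u (z - w) * \<zeta>x i (z - w))) \<partial>lborel)"
      unfolding conv_def by (intro Bochner_Integration.integral_cong refl) (simp add: wx_def g_def algebra_simps)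
    also have "\<dots> = conv (Gamx i) (g i) z + 2 * conv (Gamx i) (\<lambda>w. u w * \<zeta>x i w) z"
      unfolding conv_def using conv_integrable[OF Gamx_locint bg] conv_integrable[OF Gamx_locint uzx]
      by (subst Bochner_Integration.integral_add) (auto intro!: integrable_mult_right)
    also have "conv (Gamx i) (g i) = conv Gam (g' i)"
      by (rule conv_swap[symmetric, OF Gam_locint Gamx_locint Gam_dird_x hkp_line_continuous[OF Gamx_hkp] bg cg bg' dg])
    finally show ?thesis .
  qed
  then have "conv Gam wt z - (\<Sum>i\<in>UNIV. conv (Gamx i) (wx i) z)
     = (conv Gam wt z - (\<Sum>i\<in>UNIV. conv Gam (g' i) z)) - 2 * (\<Sum>i\<in>UNIV. conv (Gamx i) (\<lambda>w. u w * \<zeta>x i w) z)"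
    by (simp add: sum.distrib sum_distrib_left)
  also have "conv Gam wt z - (\<Sum>i\<in>UNIV. conv Gam (g' i) z) = (\<integral>w. Gam w * wt (z - w) - (\<Sum>i\<in>UNIV. Gam w * g' i (z - w)) \<partial>lborel)"
    unfolding conv_def
    by (subst Bochner_Integration.integral_diff, intro conv_integrable Gam_locint bwt,
        intro Bochner_Integration.integrable_sum conv_integrable Gam_locint bg',
        subst Bochner_Integration.integral_sum, intro conv_integrable Gam_locint bg', rule refl)
  also have "\<dots> = conv Gam (\<lambda>w. - (u w powr p * \<zeta> w) + u w * (\<zeta>t w + (\<Sum>i\<in>UNIV. \<zeta>xx i w))) z"
    unfolding conv_def
  proof (intro Bochner_Integration.integral_cong refl)
    fix w
    let ?y = "z - w"
    have "wt ?y - (\<Sum>i\<in>UNIV. g' i ?y) = (ut ?y - (\<Sum>i\<in>UNIV. uxx i ?y)) * \<zeta> ?y + u ?y * (\<zeta>t ?y + (\<Sum>i\<in>UNIV. \<zeta>xx i ?y))"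
      by (simp add: wt_def g'_def sum_subtractf sum_distrib_left sum_distrib_right algebra_simps)
    also have "(ut ?y - (\<Sum>i\<in>UNIV. uxx i ?y)) * \<zeta> ?y = - (u ?y powr p * \<zeta> ?y)"
      using pde[of ?y] D Z.\<psi>0[of ?y] by (cases "?y \<in> D") auto
    finally have "wt ?y - (\<Sum>i\<in>UNIV. g' i ?y) = - (u ?y powr p * \<zeta> ?y) + u ?y * (\<zeta>t ?y + (\<Sum>i\<in>UNIV. \<zeta>xx i ?y))" .
    from arg_cong[OF this, of "\<lambda>x. Gam w * x"]
    show "Gam w * wt ?y - (\<Sum>i\<in>UNIV. Gam w * g' i ?y) = Gam w * (- (u ?y powr p * \<zeta> ?y) + u ?y * (\<zeta>t ?y + (\<Sum>i\<in>UNIV. \<zeta>xx i ?y)))"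
      by (simp only: right_diff_distrib sum_distrib_left)
  qed
  finally show ?thesis .
qed

lemma error_lim:
  assumes k: "locint k" "continuous_on (- {0}) k" and z: "z \<notin> K"
    and e: "\<And>j. 0 < \<epsilon> j" "\<And>j. 3 * \<epsilon> j \<le> 1" "\<epsilon> \<longlonglongrightarrow> 0"
    and gm: "\<And>j. g j \<in> borel_measurable borel" and c: "0 \<le> c" and gb: "\<And>j w. \<bar>g j w\<bar> \<le> c / (\<epsilon> j)\<^sup>2"
    and g0: "\<And>j w. w \<notin> C \<or> infdist w K < \<epsilon> j \<or> infdist w K > 3 * \<epsilon> j \<Longrightarrow> g j w = 0"
  shows "(\<lambda>j::nat. conv k (\<lambda>w. u w * g j w) z) \<longlonglongrightarrow> 0"
proof (rule LIMSEQ_I)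
  fix r :: real assume r: "r > 0"
  have km: "k \<in> borel_measurable borel" by (rule locint_measurable[OF k(1)])
  have zp: "0 < infdist z K" by (rule inf_pos[OF z])
  have Sm: "Suc m \<le> DIM((real ^ 'n) \<times> real)" using nm by simp
  obtain A where A: "0 \<le> A" "\<And>f \<epsilon> M. f \<in> borel_measurable borel \<Longrightarrow> 0 < \<epsilon> \<Longrightarrow> 3 * \<epsilon> \<le> 1 \<Longrightarrow> 6 * \<epsilon> \<le> infdist z K \<Longrightarrow>
    0 \<le> M \<Longrightarrow> (\<And>w. \<bar>f w\<bar> \<le> M) \<Longrightarrow> (\<And>w. infdist w K > 3 * \<epsilon> \<Longrightarrow> f w = 0) \<Longrightarrow>
    \<bar>conv k f z\<bar> \<le> A * M * \<epsilon> ^ (DIM((real ^ 'n) \<times> real) - Suc m)"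
    using conv_tube_bound[OF k(2) km K(1,2) zp K(3) Sm] by blast
  have dim: "DIM((real ^ 'n) \<times> real) - Suc m = (CARD('n) - m - 2) + 2" using nm by simp
  \<comment> \<open>\<open>growth\<close> is used at this level so that the tube estimate A * c * e'
    falls below r; adding 1 guards against A * c = 0.\<close>
  define e' where "e' = r / (2 * (A * c + 1))"
  have Ac: "A * c + 1 > 0" using A(1) c by (simp add: add_nonneg_pos)
  have e': "e' > 0" "A * (c * e') < r"
  proof -
    show e0: "e' > 0" using r Ac by (simp add: e'_def)
    have "A * (c * e') \<le> (A * c + 1) * e'" using e0 by (simp add: algebra_simps)
    also have "\<dots> = r / 2"
    proof -
      have "X * (r / (2 * X)) = r / 2" if "X > 0" for X :: real using that by simp
      from this[OF Ac] show ?thesis by (simp only: e'_def)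
    qed
    finally show "A * (c * e') < r" using r by simp
  qed
  obtain \<delta> where d: "\<delta> > 0" "\<And>z. z \<in> Q - K \<Longrightarrow> infdist z K < \<delta> \<Longrightarrow> infdist z K ^ (CARD('n) - m - 2) * u z \<le> e'"
    using growth[OF e'(1)] by blast
  have "min (\<delta> / 4) (infdist z K / 6) > 0" using d(1) zp by simp
  from order_tendstoD(2)[OF e(3) this] obtain J where J: "\<And>j. j \<ge> J \<Longrightarrow> \<epsilon> j < min (\<delta> / 4) (infdist z K / 6)"
    by (auto simp: eventually_sequentially)
  show "\<exists>no. \<forall>j\<ge>no. norm (conv k (\<lambda>w. u w * g j w) z - 0) < r"
  proof (intro exI[of _ J] allI impI)
    fix j assume "j \<ge> J"
    then have j: "4 * \<epsilon> j < \<delta>" "6 * \<epsilon> j \<le> infdist z K" using J[of j] by auto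
    let ?k = "CARD('n) - m - 2"
    have ej: "\<epsilon> j > 0" by (rule e(1))
    \<comment> \<open>On the support of \<open>g j\<close> the distance to K lies between \<epsilon>
      and 3 \<epsilon>. The upper end lets the growth condition apply; the lower end converts it
      into u \<le> e' / \<epsilon>^(n-m-2).\<close>
    have b: "\<bar>u w * g j w\<bar> \<le> e' / \<epsilon> j ^ ?k * (c / (\<epsilon> j)\<^sup>2)" for w
    proof (cases "w \<notin> C \<or> infdist w K < \<epsilon> j \<or> infdist w K > 3 * \<epsilon> j")
      case True
      then have "g j w = 0" by (rule g0)
      then show ?thesis using e'(1) ej c by simp
    next
      case False
      then have w: "w \<in> C" "\<epsilon> j \<le> infdist w K" "infdist w K \<le> 3 * \<epsilon> j" by auto
      then have "w \<in> Q - K" using CQ ej by (auto simp: infdist_zero)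
      moreover have "infdist w K < \<delta>" using w(3) j(1) ej by linarith
      ultimately have "infdist w K ^ ?k * u w \<le> e'" by (rule d(2))
      moreover have "\<epsilon> j ^ ?k * u w \<le> infdist w K ^ ?k * u w"
        using w(2) ej unn by (intro mult_right_mono power_mono) auto
      ultimately have "\<epsilon> j ^ ?k * u w \<le> e'" by linarith
      then have "u w \<le> e' / \<epsilon> j ^ ?k" using ej by (simp add: field_simps)
      then have "u w * \<bar>g j w\<bar> \<le> e' / \<epsilon> j ^ ?k * (c / (\<epsilon> j)\<^sup>2)"
        using gb[of j w] e'(1) ej by (intro mult_mono) auto
      then show ?thesis using unn[of w] by (simp add: abs_mult)
    qed
    have "\<bar>conv k (\<lambda>w. u w * g j w) z\<bar> \<le> A * (e' / \<epsilon> j ^ ?k * (c / (\<epsilon> j)\<^sup>2)) * \<epsilon> j ^ (DIM((real ^ 'n) \<times> real) - Suc m)"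
    proof (rule A(2)[OF _ ej e(2) j(2) _ b])
      show "(\<lambda>w. u w * g j w) \<in> borel_measurable borel" by (intro borel_measurable_times um gm)
      show "0 \<le> e' / \<epsilon> j ^ ?k * (c / (\<epsilon> j)\<^sup>2)" using e'(1) ej c by simp
      show "u w * g j w = 0" if "infdist w K > 3 * \<epsilon> j" for w using g0[of w j] that by simp
    qed
    also have "\<dots> = A * (c * e') * ((1 / \<epsilon> j ^ ?k) * (1 / (\<epsilon> j)\<^sup>2) * (\<epsilon> j ^ ?k * (\<epsilon> j)\<^sup>2))"
      unfolding dim power_add by (simp only: times_divide_eq_left times_divide_eq_right mult_ac mult_1)
    also have "(1 / \<epsilon> j ^ ?k) * (1 / (\<epsilon> j)\<^sup>2) * (\<epsilon> j ^ ?k * (\<epsilon> j)\<^sup>2) = 1" using ej by simp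
    finally show "norm (conv k (\<lambda>w. u w * g j w) z - 0) < r" using e'(2) by simp
  qed
qed

lemma representation:
  assumes z: "z \<notin> K"
  shows "u z * \<psi> z = - conv Gam F1 z + S z"
proof -
  obtain A :: real where A: "A > 0" "\<And>(S::((real ^ 'n) \<times> real) set) \<epsilon>. S \<noteq> {} \<Longrightarrow> \<epsilon> > 0 \<Longrightarrow>
      \<exists>\<eta> \<eta>1 \<eta>2. cutoff_data A S \<epsilon> \<eta> \<eta>1 \<eta>2"
    by (rule cutoff_exists) (rule that, assumption+)
  \<comment> \<open>The factor 1/3 keeps the outer radius 3 \<epsilon> at most 1, as the tube
    estimate requires.\<close>
  define \<epsilon> where "\<epsilon> j = inverse (real (Suc j)) * (1 / 3)" for j
  have e0: "0 < \<epsilon> j" for j by (simp add: \<epsilon>_def)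
  have e1: "3 * \<epsilon> j \<le> 1" for j
  proof -
    have "inverse (real (Suc j)) \<le> 1" by (rule inverse_le_1_iff[THEN iffD2]) simp
    then show ?thesis by (simp add: \<epsilon>_def)
  qed
  have elim: "\<epsilon> \<longlonglongrightarrow> 0" unfolding \<epsilon>_def by (rule tendsto_mult_left_zero[OF LIMSEQ_inverse_real_of_nat])
  obtain E E1 E2 where E: "\<And>j. cutoff_data A K (\<epsilon> j) (E j) (E1 j) (E2 j)"
    using A(2)[OF K(2) e0] by metis
  have Ec: "continuous_on UNIV (E j)" "continuous_on UNIV (E1 j v)" "continuous_on UNIV (E2 j v' v)"
    and Ed: "dird v (E j) (E1 j v) UNIV" "dird v' (E1 j v) (E2 j v' v) UNIV"
    and E01: "0 \<le> E j y \<and> E j y \<le> 1" and Ein: "infdist y K < \<epsilon> j \<Longrightarrow> E j y = 0" and Eout: "infdist y K > 3 * \<epsilon> j \<Longrightarrow> E j y = 1"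
    and Eb: "\<bar>E1 j v y\<bar> \<le> A * norm v / \<epsilon> j" "\<bar>E2 j v' v y\<bar> \<le> A * norm v' * norm v / (\<epsilon> j)\<^sup>2" for j v v' y
    using E[of j] unfolding cutoff_data_def by (simp_all del: split_paired_All)
  have Eloc: "E1 j v y = 0 \<and> E2 j v' v y = 0" if y: "infdist y K < \<epsilon> j \<or> infdist y K > 3 * \<epsilon> j" for j v v' y
  proof -
    have "\<exists>P c. open P \<and> y \<in> P \<and> (\<forall>w\<in>P. E j w = c)"
    proof (cases "infdist y K < \<epsilon> j")
      case True
      have "open {w. infdist w K < \<epsilon> j}" by (intro open_Collect_less continuous_intros)
      then show ?thesis using True Ein by (intro exI[of _ "{w. infdist w K < \<epsilon> j}"] exI[of _ 0]) auto
    next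
      case False
      have "open {w. 3 * \<epsilon> j < infdist w K}" by (intro open_Collect_less continuous_intros)
      then show ?thesis using False y Eout by (intro exI[of _ "{w. 3 * \<epsilon> j < infdist w K}"] exI[of _ 1]) auto
    qed
    then obtain P c where P: "open P" "y \<in> P" "\<And>w. w \<in> P \<Longrightarrow> E j w = c" by blast
    have 1: "E1 j v w = 0" if "w \<in> P" for w v by (rule dird_locally_const[OF Ed(1) P(1) _ P(3) that]) auto
    have "E2 j v' v y = 0" by (rule dird_locally_const[OF Ed(2) P(1) _ 1 P(2)]) auto
    then show ?thesis using 1 P(2) by blast
  qed
  have nt: "norm (e_t :: (real ^ 'n) \<times> real) = 1" by (simp add: e_t_def norm_Pair)
  have nx: "norm (e_x i :: (real ^ 'n) \<times> real) = 1" for i by (simp add: e_x_def norm_Pair)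
  \<comment> \<open>\<open>g\<close> and \<open>gi\<close> collect the terms of the derivatives of
    \<psi> E in which E is differentiated; the remaining ones reproduce \<open>F2\<close> and
    \<open>H\<close> multiplied by E.\<close>
  define g where "g j w = \<psi> w * E1 j e_t w + (\<Sum>i\<in>UNIV. 2 * (\<psi>x i w * E1 j (e_x i) w) + \<psi> w * E2 j (e_x i) (e_x i) w)" for j w
  define gi where "gi i j w = \<psi> w * E1 j (e_x i) w" for i j w
  have gc: "continuous_on UNIV (g j)" "continuous_on UNIV (gi i j)" for j i
    unfolding g_def[abs_def] gi_def[abs_def] by (intro continuous_intros \<psi>c Ec)+
  have g0: "g j w = 0" "gi i j w = 0" if "w \<notin> C \<or> infdist w K < \<epsilon> j \<or> infdist w K > 3 * \<epsilon> j" for j w i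
    using that \<psi>0[of w] off_C[of w] Eloc[of w j] unfolding g_def gi_def by (cases "w \<in> C"; simp)+
  obtain Bx where Bx: "\<And>i. 0 \<le> Bx i" "\<And>i w. \<bar>\<psi>x i w\<bar> \<le> Bx i"
  proof -
    have "\<exists>B. 0 \<le> B \<and> (\<forall>w. \<bar>\<psi>x i w\<bar> \<le> B)" for i
      by (rule bounded_cutoff[OF \<psi>c(3)[of i] C off_C(2)]) blast+
    then have "\<exists>Bx. \<forall>i. 0 \<le> Bx i \<and> (\<forall>w. \<bar>\<psi>x i w\<bar> \<le> Bx i)" by metis
    then show ?thesis using that by blast
  qed
  define c where "c = A + (\<Sum>i\<in>UNIV. 2 * (Bx i * A) + A)"
  have c: "A \<le> c" "0 \<le> c" unfolding c_def using A(1) Bx(1) by (auto intro!: sum_nonneg add_nonneg_nonneg)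
  \<comment> \<open>Since \<epsilon> \<le> 1, first derivatives of E, in time as well as in space,
    obey the same \<epsilon>^-2 bound as second ones, so one estimate serves all error
    terms.\<close>
  have inv: "A / \<epsilon> j \<le> A / (\<epsilon> j)\<^sup>2" for j
  proof -
    have "(\<epsilon> j)\<^sup>2 \<le> \<epsilon> j" using e0[of j] e1[of j] by (simp add: power2_eq_square mult_left_le)
    then show ?thesis using e0[of j] A(1) by (intro divide_left_mono) auto
  qed
  have E1b: "\<bar>E1 j e_t w\<bar> \<le> A / (\<epsilon> j)\<^sup>2" "\<bar>E1 j (e_x i) w\<bar> \<le> A / (\<epsilon> j)\<^sup>2" "\<bar>E2 j (e_x i) (e_x i) w\<bar> \<le> A / (\<epsilon> j)\<^sup>2" for i j w
    using Eb(1)[of j e_t w] Eb(1)[of j "e_x i" w] Eb(2)[of j "e_x i" "e_x i" w] inv[of j] by (simp_all add: nt nx)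
  have \<psi>E: "\<bar>\<psi> w * y\<bar> \<le> b" if "\<bar>y\<bar> \<le> b" for w y b
    using that \<psi>01[of w] mult_mono[of "\<psi> w" 1 "\<bar>y\<bar>" b] by (simp add: abs_mult)
  have gb: "\<bar>g j w\<bar> \<le> c / (\<epsilon> j)\<^sup>2" for j w
  proof -
    have "\<bar>g j w\<bar> \<le> \<bar>\<psi> w * E1 j e_t w\<bar> + (\<Sum>i\<in>UNIV. \<bar>2 * (\<psi>x i w * E1 j (e_x i) w) + \<psi> w * E2 j (e_x i) (e_x i) w\<bar>)"
      unfolding g_def by (rule order_trans[OF abs_triangle_ineq]) (intro add_left_mono sum_abs)
    also have "\<dots> \<le> A / (\<epsilon> j)\<^sup>2 + (\<Sum>i\<in>UNIV. 2 * (Bx i * (A / (\<epsilon> j)\<^sup>2)) + A / (\<epsilon> j)\<^sup>2)"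
    proof (intro add_mono sum_mono \<psi>E E1b(1))
      fix i
      have "\<bar>\<psi>x i w * E1 j (e_x i) w\<bar> \<le> Bx i * (A / (\<epsilon> j)\<^sup>2)"
        unfolding abs_mult using Bx E1b(2) by (intro mult_mono) auto
      moreover have "\<bar>\<psi> w * E2 j (e_x i) (e_x i) w\<bar> \<le> A / (\<epsilon> j)\<^sup>2" by (rule \<psi>E[OF E1b(3)])
      ultimately show "\<bar>2 * (\<psi>x i w * E1 j (e_x i) w) + \<psi> w * E2 j (e_x i) (e_x i) w\<bar> \<le> 2 * (Bx i * (A / (\<epsilon> j)\<^sup>2)) + A / (\<epsilon> j)\<^sup>2"
        by linarith
    qed
    also have "\<dots> = c / (\<epsilon> j)\<^sup>2" unfolding c_def add_divide_distrib sum_divide_distrib by simp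
    finally show ?thesis .
  qed
  have gib: "\<bar>gi i j w\<bar> \<le> c / (\<epsilon> j)\<^sup>2" for i j w
  proof -
    have "\<bar>gi i j w\<bar> \<le> A / (\<epsilon> j)\<^sup>2" unfolding gi_def by (rule \<psi>E[OF E1b(2)])
    also have "\<dots> \<le> c / (\<epsilon> j)\<^sup>2" using c by (intro divide_right_mono) auto
    finally show ?thesis .
  qed
  have gm: "g j \<in> borel_measurable borel" "gi i j \<in> borel_measurable borel" for i j
    by (rule borel_measurable_continuous_onI, rule gc)+
  have Gk: "locint Gam" "continuous_on (- {0}) Gam" by (rule Gam_locint, rule hkp_continuous[OF Gam_hkp])
  have Gxk: "locint (Gamx i)" "continuous_on (- {0}) (Gamx i)" for i by (rule Gamx_locint, rule hkp_continuous[OF Gamx_hkp])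
  have zp: "0 < infdist z K" by (rule inf_pos[OF z])
  have F12: "mild K (\<lambda>w. - 1 * F1 w + F2 w)"
  proof (intro mild_add F2_mild)
    have "mild K (\<lambda>w. F1 w * (- 1))" by (rule mild_mult_bounded[OF F1_mild borel_measurable_const, of _ 1]) simp
    then show "mild K (\<lambda>w. - 1 * F1 w)" by (simp add: mult.commute)
  qed
  have mE: "mild K (\<lambda>w. f w * E j w)" if "mild K f" for f j
  proof (rule mild_mult_bounded[OF that borel_measurable_continuous_onI[OF Ec(1)], of _ 1])
    show "\<bar>E j w\<bar> \<le> 1" for w using E01[of j w] by linarith
  qed
  have key: "u z * (\<psi> z * E j z) = (conv Gam (\<lambda>w. (- 1 * F1 w + F2 w) * E j w) z + conv Gam (\<lambda>w. u w * g j w) z)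
     - 2 * (\<Sum>i\<in>UNIV. conv (Gamx i) (\<lambda>w. H i w * E j w) z + conv (Gamx i) (\<lambda>w. u w * gi i j w) z)" for j
  proof -
    define \<zeta> where "\<zeta> w = \<psi> w * E j w" for w
    define \<zeta>t where "\<zeta>t w = \<psi>t w * E j w + \<psi> w * E1 j e_t w" for w
    define \<zeta>x where "\<zeta>x i w = \<psi>x i w * E j w + \<psi> w * E1 j (e_x i) w" for i w
    define \<zeta>xx where "\<zeta>xx i w = (\<psi>xx i w * E j w + \<psi>x i w * E1 j (e_x i) w) + (\<psi>x i w * E1 j (e_x i) w + \<psi> w * E2 j (e_x i) (e_x i) w)" for i w
    let ?D = "C \<inter> {w. \<epsilon> j \<le> infdist w K}"
    have cl: "closed {w. \<epsilon> j \<le> infdist w K}" by (intro closed_Collect_le continuous_intros)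
    have hx1: "(\<lambda>w. u w * \<zeta>x i w) = (\<lambda>w. H i w * E j w + u w * gi i j w)" for i
      by (rule ext) (simp add: \<zeta>x_def gi_def H_def algebra_simps)
    have hx2: "conv (Gamx i) (\<lambda>w. H i w * E j w + u w * gi i j w) z
      = conv (Gamx i) (\<lambda>w. H i w * E j w) z + conv (Gamx i) (\<lambda>w. u w * gi i j w) z" for i
      by (rule conv_add[OF mild_integrable[OF Gxk mE[OF H_mild] zp] mild_integrable[OF Gxk mild_u_times(1)[OF gc(2) g0(2)] zp]
           locint_measurable[OF Gxk(1)] mild_measurable[OF mE[OF H_mild]] mild_measurable[OF mild_u_times(1)[OF gc(2) g0(2)]]]) auto
    have "cutoff_function \<zeta> \<zeta>t \<zeta>x \<zeta>xx ?D"
    proof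
      show "continuous_on UNIV \<zeta>" "continuous_on UNIV \<zeta>t" "continuous_on UNIV (\<zeta>x i)" "continuous_on UNIV (\<zeta>xx i)" for i
        unfolding \<zeta>_def[abs_def] \<zeta>t_def[abs_def] \<zeta>x_def[abs_def] \<zeta>xx_def[abs_def] by (intro continuous_intros \<psi>c Ec)+
      show "dird e_t \<zeta> \<zeta>t UNIV" unfolding \<zeta>_def[abs_def] \<zeta>t_def[abs_def] by (rule dird_mult[OF \<psi>d(1) Ed(1)])
      show "dird (e_x i) \<zeta> (\<zeta>x i) UNIV" for i unfolding \<zeta>_def[abs_def] \<zeta>x_def[abs_def] by (rule dird_mult[OF \<psi>d(2) Ed(1)])
      show "dird (e_x i) (\<zeta>x i) (\<zeta>xx i) UNIV" for i unfolding \<zeta>x_def[abs_def] \<zeta>xx_def[abs_def]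
        by (rule dird_add[OF dird_mult[OF \<psi>d(3) Ed(1)] dird_mult[OF \<psi>d(2) Ed(2)]])
      show "compact ?D" by (rule compact_Int_closed[OF C cl])
      show "\<zeta> w = 0" if "w \<notin> ?D" for w using that \<psi>0[of w] Ein[of w j] by (auto simp: \<zeta>_def not_le)
      show "0 \<le> \<zeta> w" for w using \<psi>01[of w] E01[of j w] by (simp add: \<zeta>_def)
      show "\<zeta> w \<le> 1" for w using \<psi>01[of w] E01[of j w] by (simp add: \<zeta>_def mult_le_one)
    qed
    moreover have "?D \<subseteq> Q - K" using CQ e0[of j] by auto
    ultimately have "u z * \<zeta> z = conv Gam (\<lambda>w. - (u w powr p * \<zeta> w) + u w * (\<zeta>t w + (\<Sum>i\<in>UNIV. \<zeta>xx i w))) z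
       - 2 * (\<Sum>i\<in>UNIV. conv (Gamx i) (\<lambda>w. u w * \<zeta>x i w) z)" by (rule duhamel_cutoff)
    also have "(\<lambda>w. - (u w powr p * \<zeta> w) + u w * (\<zeta>t w + (\<Sum>i\<in>UNIV. \<zeta>xx i w))) = (\<lambda>w. (- 1 * F1 w + F2 w) * E j w + u w * g j w)"
      by (rule ext) (simp add: \<zeta>_def \<zeta>t_def \<zeta>xx_def g_def F1_def F2_def sum.distrib sum_distrib_left sum_distrib_right algebra_simps)
    also have "conv Gam (\<lambda>w. (- 1 * F1 w + F2 w) * E j w + u w * g j w) z
      = conv Gam (\<lambda>w. (- 1 * F1 w + F2 w) * E j w) z + conv Gam (\<lambda>w. u w * g j w) z"
      by (rule conv_add[OF mild_integrable[OF Gk mE[OF F12] zp] mild_integrable[OF Gk mild_u_times(1)[OF gc(1) g0(1)] zp]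
           locint_measurable[OF Gk(1)] mild_measurable[OF mE[OF F12]] mild_measurable[OF mild_u_times(1)[OF gc(1) g0(1)]]]) auto
    finally show ?thesis unfolding hx1 hx2 by (simp only: \<zeta>_def)
  qed
  have Eev: "\<forall>\<^sub>F j in sequentially. E j w = 1" if "0 < infdist w K" for w
  proof -
    have "0 < infdist w K / 3" using that by simp
    from order_tendstoD(2)[OF elim this] show ?thesis
      by eventually_elim (rule Eout, simp)
  qed
  have lim: "(\<lambda>j. (conv Gam (\<lambda>w. (- 1 * F1 w + F2 w) * E j w) z + conv Gam (\<lambda>w. u w * g j w) z)
     - 2 * (\<Sum>i\<in>UNIV. conv (Gamx i) (\<lambda>w. H i w * E j w) z + conv (Gamx i) (\<lambda>w. u w * gi i j w) z))
    \<longlonglongrightarrow> (conv Gam (\<lambda>w. - 1 * F1 w + F2 w) z + 0) - 2 * (\<Sum>i\<in>UNIV. conv (Gamx i) (H i) z + 0)"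
    by (intro tendsto_diff tendsto_add tendsto_mult_left tendsto_sum
        conv_mild_lim[OF Gk F12 zp Ec(1) E01 Eev Knull Kcl K(2)] conv_mild_lim[OF Gxk H_mild zp Ec(1) E01 Eev Knull Kcl K(2)]
        error_lim[OF Gk z e0 e1 elim gm(1) c(2) gb g0(1)] error_lim[OF Gxk z e0 e1 elim gm(2) c(2) gib g0(2)])
  have "\<forall>\<^sub>F j in sequentially. u z * \<psi> z = u z * (\<psi> z * E j z)"
    using Eev[OF zp] by eventually_elim simp
  from Lim_transform_eventually[OF tendsto_const this]
  have "(\<lambda>j. u z * (\<psi> z * E j z)) \<longlonglongrightarrow> u z * \<psi> z" .
  from LIMSEQ_unique[OF this lim[folded key]]
  have "u z * \<psi> z = conv Gam (\<lambda>w. - 1 * F1 w + F2 w) z - 2 * (\<Sum>i\<in>UNIV. conv (Gamx i) (H i) z)" by simp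
  also have "conv Gam (\<lambda>w. - 1 * F1 w + F2 w) z = conv Gam (\<lambda>w. - 1 * F1 w) z + conv Gam F2 z"
  proof (rule conv_add)
    have m: "mild K (\<lambda>w. F1 w * (- 1))" by (rule mild_mult_bounded[OF F1_mild borel_measurable_const, of _ 1]) simp
    then have m: "mild K (\<lambda>w. - 1 * F1 w)" by (simp add: mult.commute)
    show "integrable lborel (\<lambda>w. Gam (z - w) * (- 1 * F1 w))" by (rule mild_integrable[OF Gk m zp])
    show "integrable lborel (\<lambda>w. Gam (z - w) * F2 w)" by (rule mild_integrable[OF Gk F2_mild zp])
    show "(\<lambda>w. - 1 * F1 w) \<in> borel_measurable borel" by (rule mild_measurable[OF m])
  qed (rule locint_measurable[OF Gk(1)], rule mild_measurable[OF F2_mild])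
  also have "conv Gam (\<lambda>w. - 1 * F1 w) z = - conv Gam F1 z" unfolding conv_def by simp
  finally show ?thesis by (simp add: S_def)
qed

end

section \<open>Local regularity\<close>

text \<open>The content of \<open>C21_on\<close> with the derivatives as witnesses, so that sums of
  potentials can be treated termwise before anything is said about \<open>pd\<close>.\<close>

definition reg :: "((real ^ 'n::finite) \<times> real \<Rightarrow> real) \<Rightarrow> ((real ^ 'n) \<times> real) set \<Rightarrow> bool" where
  "reg v P \<longleftrightarrow> continuous_on P v \<and> (\<exists>vt. dird e_t v vt P \<and> continuous_on P vt) \<and>
     (\<exists>vx vxx. \<forall>i. dird (e_x i) v (vx i) P \<and> continuous_on P (vx i) \<and>
        (\<forall>j. dird (e_x j) (vx i) (vxx j i) P \<and> continuous_on P (vxx j i)))"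

lemma regI:
  assumes "continuous_on P v" "dird e_t v vt P" "continuous_on P vt"
    "\<And>i. dird (e_x i) v (vx i) P" "\<And>i. continuous_on P (vx i)"
    "\<And>i j. dird (e_x j) (vx i) (vxx j i) P" "\<And>i j. continuous_on P (vxx j i)"
  shows "reg v P"
  unfolding reg_def using assms by blast

lemma reg_add:
  assumes f: "reg f P" and g: "reg g P"
  shows "reg (\<lambda>z. f z + g z) P"
proof -
  obtain ft fx fxx where F: "continuous_on P f" "dird e_t f ft P" "continuous_on P ft" "\<And>i. dird (e_x i) f (fx i) P"
    "\<And>i. continuous_on P (fx i)" "\<And>i j. dird (e_x j) (fx i) (fxx j i) P" "\<And>i j. continuous_on P (fxx j i)"
    using f unfolding reg_def by blast
  obtain gt gx gxx where G: "continuous_on P g" "dird e_t g gt P" "continuous_on P gt" "\<And>i. dird (e_x i) g (gx i) P"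
    "\<And>i. continuous_on P (gx i)" "\<And>i j. dird (e_x j) (gx i) (gxx j i) P" "\<And>i j. continuous_on P (gxx j i)"
    using g unfolding reg_def by blast
  show ?thesis
    by (rule regI[where vt="\<lambda>z. ft z + gt z" and vx="\<lambda>i z. fx i z + gx i z" and vxx="\<lambda>j i z. fxx j i z + gxx j i z"])
       (intro continuous_on_add dird_add F G)+
qed

lemma reg_cmult:
  assumes f: "reg f P"
  shows "reg (\<lambda>z. c * f z) P"
proof -
  obtain ft fx fxx where F: "continuous_on P f" "dird e_t f ft P" "continuous_on P ft" "\<And>i. dird (e_x i) f (fx i) P"
    "\<And>i. continuous_on P (fx i)" "\<And>i j. dird (e_x j) (fx i) (fxx j i) P" "\<And>i j. continuous_on P (fxx j i)"
    using f unfolding reg_def by blast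
  show ?thesis
    by (rule regI[where vt="\<lambda>z. c * ft z" and vx="\<lambda>i z. c * fx i z" and vxx="\<lambda>j i z. c * fxx j i z"])
       (intro continuous_on_mult_left dird_cmult F)+
qed

lemma reg_const: "reg (\<lambda>z. c) P"
  by (rule regI[where vt="\<lambda>z. 0" and vx="\<lambda>i z. 0" and vxx="\<lambda>j i z. 0"]) (intro continuous_on_const dird_const)+

lemma reg_sum: "finite A \<Longrightarrow> (\<And>i. i \<in> A \<Longrightarrow> reg (f i) P) \<Longrightarrow> reg (\<lambda>z. \<Sum>i\<in>A. f i z) P"
  by (induction A rule: finite_induct) (auto intro: reg_const reg_add)

lemma reg_C21_on: "open P \<Longrightarrow> reg v P \<Longrightarrow> C21_on P v"
  unfolding reg_def by (auto intro!: C21_onI)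

text \<open>Where the density vanishes, every derivative may fall on the kernel, and the result
  stays in \<open>hkp\<close>. This holds however singular the density is elsewhere, as long as it
  is integrable.\<close>

lemma hkp_off_reg:
  fixes k :: "(real ^ 'n::finite) \<times> real \<Rightarrow> real"
  assumes k: "k \<in> hkp" and g: "offsupp g P"
  shows "reg (conv k g) P"
proof -
  have c: "continuous_on P (conv f g)" if "f \<in> hkp" for f
    by (rule conv_off_continuous[OF hkp_measurable[OF that] hkp_continuous[OF that] g])
  have d: "dird e (conv f g) (conv f' g) P" if f: "f \<in> hkp" and f': "f' \<in> hkp" and d: "dird e f f' (- {0})" for e f f'
    by (rule conv_off_dird[OF hkp_measurable[OF f'] hkp_continuous[OF f'] g hkp_measurable[OF f] hkp_continuous[OF f]
          offsupp_integrable[OF hkp_measurable[OF f] hkp_continuous[OF f] g] d])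
  obtain kt where kt: "kt \<in> hkp" "dird e_t k kt (- {0})" using hkp_dird_t[OF k] by blast
  \<comment> \<open>A derivative in direction i inside \<open>hkp\<close> is chosen as a function of
    the kernel, so that it can be iterated for mixed second derivatives.\<close>
  define D where "D i f = (SOME f'. f' \<in> hkp \<and> dird (e_x i) f f' UNIV)" for i :: 'n and f
  have D: "D i f \<in> hkp \<and> dird (e_x i) f (D i f) UNIV" if "f \<in> hkp" for i f
    using someI_ex[of "\<lambda>f'. f' \<in> hkp \<and> dird (e_x i) f f' UNIV"] hkp_dird_x[OF that, of i] unfolding D_def by blast
  have D1: "D i f \<in> hkp" and D2: "dird (e_x i) f (D i f) (- {0})" if "f \<in> hkp" for i f
    using D[OF that] by (auto intro: dird_subset)
  show ?thesis
    by (rule regI[where vt="conv kt g" and vx="\<lambda>i. conv (D i k) g" and vxx="\<lambda>j i. conv (D j (D i k)) g"])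
       (intro c d k kt D1 D2)+
qed

text \<open>The power with exponent p > 1 is continuously differentiable down to 0, so zeros of the
  solution do not obstruct differentiating the nonlinearity once.\<close>

lemma DERIV_max_powr:
  assumes p: "1 < p"
  shows "DERIV (\<lambda>x::real. max 0 x powr p) x :> p * max 0 x powr (p - 1)"
proof -
  consider "x > 0" | "x < 0" | "x = 0" by linarith
  then show ?thesis
  proof cases
    case 1
    have "\<forall>\<^sub>F y in nhds x. y \<in> {0<..}" using 1 by (intro eventually_nhds_in_open) auto
    then have "\<forall>\<^sub>F y in nhds x. max 0 y powr p = y powr p" by eventually_elim simp
    moreover have "DERIV (\<lambda>y. y powr p) x :> p * max 0 x powr (p - 1)"
      using has_real_derivative_powr[OF 1, of p] 1 by simp
    ultimately show ?thesis by (rule iffD2[OF DERIV_cong_ev[OF refl _ refl]])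
  next
    case 2
    have "\<forall>\<^sub>F y in nhds x. y \<in> {..<0}" using 2 by (intro eventually_nhds_in_open) auto
    then have "\<forall>\<^sub>F y in nhds x. max 0 y powr p = 0" by eventually_elim simp
    moreover have "DERIV (\<lambda>y. 0) x :> p * max 0 x powr (p - 1)" using 2 by simp
    ultimately show ?thesis by (rule iffD2[OF DERIV_cong_ev[OF refl _ refl]])
  next
    case 3
    have "(\<lambda>h::real. max 0 h powr p / h) \<midarrow>0\<rightarrow> 0"
    proof (rule Lim_null_comparison)
      show "\<forall>\<^sub>F h::real in at 0. norm (max 0 h powr p / h) \<le> \<bar>h\<bar> powr (p - 1)"
      proof (intro always_eventually allI)
        fix h :: real
        show "norm (max 0 h powr p / h) \<le> \<bar>h\<bar> powr (p - 1)"
        proof (cases "h > 0")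
          case True
          then have "h powr p / h = h powr (p - 1)" by (simp add: powr_diff)
          then show ?thesis using True by simp
        next
          case False
          then have "max 0 h powr p / h = 0" by simp
          then show ?thesis by (metis norm_zero powr_ge_zero)
        qed
      qed
      have "((\<lambda>h::real. \<bar>h\<bar> powr (p - 1)) \<longlongrightarrow> \<bar>0\<bar> powr (p - 1)) (at 0)"
        by (rule tendsto_powr'[OF tendsto_rabs[OF tendsto_ident_at] tendsto_const]) (use p in auto)
      then show "((\<lambda>h::real. \<bar>h\<bar> powr (p - 1)) \<longlongrightarrow> 0) (at 0)" by simp
    qed
    then show ?thesis using 3 p by (simp add: DERIV_def)
  qed
qed

lemma continuous_max_powr:
  assumes "continuous_on A f" "0 < q"
  shows "continuous_on A (\<lambda>x. max 0 (f x) powr q :: real)"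
  using assms by (intro continuous_on_powr' continuous_intros) auto

lemma point_cutoff:
  fixes z0 :: "(real ^ 'n::finite) \<times> real"
  assumes r: "r > 0"
  obtains \<psi> \<psi>t \<psi>x \<psi>xx where "cutoff_function \<psi> \<psi>t \<psi>x \<psi>xx (cball z0 (3 * r))" "\<And>w. w \<in> ball z0 r \<Longrightarrow> \<psi> w = 1"
proof -
  obtain A :: real where A: "A > 0" "\<And>(S::((real ^ 'n) \<times> real) set) \<epsilon>. S \<noteq> {} \<Longrightarrow> \<epsilon> > 0 \<Longrightarrow>
      \<exists>\<eta> \<eta>1 \<eta>2. cutoff_data A S \<epsilon> \<eta> \<eta>1 \<eta>2"
    by (rule cutoff_exists) (rule that, assumption+)
  obtain \<eta> \<eta>1 \<eta>2 where E: "continuous_on UNIV \<eta>" "\<And>v. continuous_on UNIV (\<eta>1 v)" "\<And>v' v. continuous_on UNIV (\<eta>2 v' v)"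
    "\<And>v. dird v \<eta> (\<eta>1 v) UNIV" "\<And>v' v. dird v' (\<eta>1 v) (\<eta>2 v' v) UNIV" "\<And>z. 0 \<le> \<eta> z \<and> \<eta> z \<le> 1"
    "\<And>z. infdist z {z0} < r \<Longrightarrow> \<eta> z = 0" "\<And>z. infdist z {z0} > 3 * r \<Longrightarrow> \<eta> z = 1"
    using A(2)[of "{z0}", OF _ r] unfolding cutoff_data_def by blast
  have d: "dird v (\<lambda>z. 1 - \<eta> z) (\<lambda>z. 0 - \<eta>1 v z) UNIV" for v by (rule dird_diff[OF dird_const E(4)])
  have d2: "dird v (\<lambda>z. 0 - \<eta>1 v z) (\<lambda>z. 0 - \<eta>2 v v z) UNIV" for v by (rule dird_diff[OF dird_const E(5)])
  show thesis
  proof (rule that[of "\<lambda>z. 1 - \<eta> z" "\<lambda>z. 0 - \<eta>1 e_t z" "\<lambda>i z. 0 - \<eta>1 (e_x i) z" "\<lambda>i z. 0 - \<eta>2 (e_x i) (e_x i) z"])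
    show "cutoff_function (\<lambda>z. 1 - \<eta> z) (\<lambda>z. 0 - \<eta>1 e_t z) (\<lambda>i z. 0 - \<eta>1 (e_x i) z) (\<lambda>i z. 0 - \<eta>2 (e_x i) (e_x i) z) (cball z0 (3 * r))"
    proof
      show "1 - \<eta> w = 0" if "w \<notin> cball z0 (3 * r)" for w using that E(8)[of w] by (simp add: dist_commute)
      show "0 \<le> 1 - \<eta> w" "1 - \<eta> w \<le> 1" for w using E(6)[of w] by auto
    qed (intro continuous_intros E d d2 compact_cball)+
    show "1 - \<eta> w = 1" if "w \<in> ball z0 r" for w using that E(7)[of w] by (simp add: dist_commute)
  qed
qed

section \<open>Bootstrapping the representation near a point\<close>

context singular_cutoff
begin

lemma mild_offsupp:
  assumes "mild K f" "open P" "\<And>w. w \<in> P \<Longrightarrow> f w = 0"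
  shows "offsupp f P"
  using assms by (auto simp: mild_def offsupp_def)

lemma S_reg:
  assumes P: "open P" "\<And>w. w \<in> P \<Longrightarrow> \<psi> w = 1"
  shows "reg S P"
proof -
  have "F2 w = 0" "H i w = 0" if "w \<in> P" for i w
    using derivs_0[OF P that] by (simp_all add: F2_def H_def)
  then have o: "offsupp F2 P" "offsupp (H i) P" for i
    by (auto intro!: mild_offsupp F2_mild H_mild P(1))
  have "reg (\<lambda>z. conv Gam F2 z + (- 2) * (\<Sum>i\<in>UNIV. conv (Gamx i) (H i) z)) P"
    by (intro reg_add reg_cmult reg_sum hkp_off_reg[OF Gam_hkp] hkp_off_reg[OF Gamx_hkp] o) simp
  moreover have "(\<lambda>z. conv Gam F2 z + (- 2) * (\<Sum>i\<in>UNIV. conv (Gamx i) (H i) z)) = S" by (auto simp: S_def)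
  ultimately show ?thesis by simp
qed

lemma F1_nonneg: "0 \<le> F1 w" by (simp add: F1_def \<psi>01)

lemma u_le_S:
  assumes "w \<notin> K" "\<psi> w = 1"
  shows "u w \<le> S w"
proof -
  have "0 \<le> conv Gam F1 w" unfolding conv_def
    by (intro Bochner_Integration.integral_nonneg mult_nonneg_nonneg Gam_nonneg F1_nonneg)
  then show ?thesis using representation[OF assms(1)] assms(2) by simp
qed

lemma F1_isCont:
  assumes "z \<notin> K"
  shows "isCont F1 z"
proof (cases "z \<in> Q")
  case True
  have "continuous_on (Q - K) F1" unfolding F1_def[abs_def]
  proof (intro continuous_on_mult continuous_on_powr' uc continuous_on_const continuous_on_subset[OF \<psi>c(1)] ballI)
    show "0 \<le> u x \<and> (u x = 0 \<longrightarrow> 0 < p)" for x using unn p by simp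
  qed auto
  then show ?thesis using continuous_on_eq_continuous_at[OF Gopen] True assms by blast
next
  case False
  then have z: "z \<in> - C" using CQ by auto
  have "continuous_on (- C) F1"
    by (rule continuous_on_eq[OF continuous_on_const[of _ 0]]) (simp add: F1_def \<psi>0)
  then show ?thesis using continuous_on_eq_continuous_at[OF open_Compl[OF compact_imp_closed[OF C]]] z by blast
qed

end

context singular_solution
begin

lemma open_subset_K: "open X \<Longrightarrow> X \<subseteq> K \<Longrightarrow> X = {}"
proof (rule ccontr)
  assume O: "open X" "X \<subseteq> K" "X \<noteq> {}"
  have "negligible K" using Knull by (simp add: negligible_iff_null_sets null_sets_completionI)
  then have "negligible X" by (rule negligible_subset[OF _ O(2)])
  then show False using open_not_negligible[OF O(1,3)] by simp
qed

theorem local_extension: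
  assumes z0: "z0 \<in> Q"
  shows "\<exists>U v. open U \<and> z0 \<in> U \<and> U \<subseteq> Q \<and> reg v U \<and> (\<forall>z\<in>U - K. v z = u z)"
proof -
  obtain R where R: "R > 0" "ball z0 R \<subseteq> Q" using Q z0 openE by blast
  \<comment> \<open>The quotient 4 gives 3 r2 < r1 and 3 r3 < r2: each smaller cutoff is supported
    where the preceding one equals 1, hence where the regularity gained with that one is
    available.\<close>
  define r1 where "r1 = R / 4"
  define r2 where "r2 = r1 / 4"
  define r3 where "r3 = r2 / 4"
  have r: "r1 > 0" "r2 > 0" "r3 > 0" using R by (auto simp: r1_def r2_def r3_def)
  have sub1: "cball z0 (3 * r1) \<subseteq> ball z0 R" "cball z0 (3 * r2) \<subseteq> ball z0 r1" "cball z0 (3 * r3) \<subseteq> ball z0 r2"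
    using r R by (auto simp: r1_def r2_def r3_def)
  have sub3: "ball z0 r1 \<subseteq> cball z0 (3 * r1)" "ball z0 r2 \<subseteq> cball z0 (3 * r2)" "ball z0 r3 \<subseteq> cball z0 (3 * r3)"
    using r by auto
  have sub: "cball z0 (3 * r1) \<subseteq> Q" "cball z0 (3 * r2) \<subseteq> Q" "cball z0 (3 * r3) \<subseteq> Q" "ball z0 r3 \<subseteq> Q"
    using sub1 sub3 R(2) by (meson order_trans)+
  have G: "locint (Gam :: (real ^ 'n) \<times> real \<Rightarrow> real)" "\<And>i. locint (Gamx i :: (real ^ 'n) \<times> real \<Rightarrow> real)"
    by (rule Gam_locint, rule Gamx_locint)

  \<comment> \<open>The widest cutoff yields boundedness: off K, u lies below the corresponding
    \<open>S\<close>, which is continuous where the cutoff is 1.\<close>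
  obtain \<psi> \<psi>t \<psi>x \<psi>xx where c1: "cutoff_function \<psi> \<psi>t \<psi>x \<psi>xx (cball z0 (3 * r1))" "\<And>w. w \<in> ball z0 r1 \<Longrightarrow> \<psi> w = 1"
    using point_cutoff[OF r(1)] by blast
  interpret A: singular_cutoff K Q u ut ux uxx m p \<psi> \<psi>t \<psi>x \<psi>xx "cball z0 (3 * r1)"
    by (intro singular_cutoff.intro singular_cutoff_axioms.intro singular_solution_axioms c1(1) sub(1))
  have "continuous_on (ball z0 r1) A.S" using A.S_reg[OF open_ball c1(2)] by (simp add: reg_def)
  then have "compact (A.S ` cball z0 (3 * r2))"
    by (intro compact_continuous_image) (auto intro: continuous_on_subset[OF _ sub1(2)])
  then obtain B0 where B0: "\<And>w. w \<in> cball z0 (3 * r2) \<Longrightarrow> \<bar>A.S w\<bar> \<le> B0"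
    by (metis compact_imp_bounded bounded_iff imageI real_norm_def)
  have uB: "u w \<le> B0" if w: "w \<in> cball z0 (3 * r2)" for w
  proof (cases "w \<in> K")
    case True
    then have "u w = 0" using u0 by auto
    then show ?thesis using B0[OF w] by linarith
  next
    case False
    have "\<psi> w = 1" using c1(2) sub1(2) w by blast
    from A.u_le_S[OF False this] show ?thesis using B0[OF w] by linarith
  qed

  \<comment> \<open>With the middle cutoff the density u^p \<psi>' is bounded with bounded support,
    so the locally integrable gradient kernel produces continuous space derivatives of its
    potential.\<close>
  obtain \<psi>' \<psi>t' \<psi>x' \<psi>xx' where c2: "cutoff_function \<psi>' \<psi>t' \<psi>x' \<psi>xx' (cball z0 (3 * r2))" "\<And>w. w \<in> ball z0 r2 \<Longrightarrow> \<psi>' w = 1"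
    using point_cutoff[OF r(2)] by blast
  interpret B: singular_cutoff K Q u ut ux uxx m p \<psi>' \<psi>t' \<psi>x' \<psi>xx' "cball z0 (3 * r2)"
    by (intro singular_cutoff.intro singular_cutoff_axioms.intro singular_solution_axioms c2(1) sub(2))
  have fB: "bdsupp B.F1"
  proof (rule bdsuppI[where B="B0 powr p" and R="norm z0 + 3 * r2"])
    show "B.F1 \<in> borel_measurable borel" by (rule mild_measurable[OF B.F1_mild])
    fix w
    show "\<bar>B.F1 w\<bar> \<le> B0 powr p"
    proof (cases "w \<in> cball z0 (3 * r2)")
      case True
      have "u w powr p \<le> B0 powr p" using uB[OF True] unn p by (intro powr_mono2) auto
      moreover have "B.F1 w \<le> u w powr p * 1" unfolding B.F1_def using B.\<psi>01 by (intro mult_left_mono) auto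
      ultimately show ?thesis using B.F1_nonneg[of w] by simp
    qed (simp add: B.F1_def B.\<psi>0)
    show "B.F1 w = 0" if "norm w > norm z0 + 3 * r2"
    proof -
      have "w \<notin> cball z0 (3 * r2)" using that norm_triangle_ineq2[of w z0] by (auto simp: dist_norm norm_minus_commute)
      then show ?thesis by (simp add: B.F1_def B.\<psi>0)
    qed
  qed
  have VBc: "continuous_on UNIV (conv k B.F1)" if "locint k" for k
    by (rule conv_continuous[OF that fB Knull B.F1_isCont])
  have VBd: "dird (e_x i) (conv Gam B.F1) (conv (Gamx i) B.F1) UNIV" for i
    by (rule conv_dird_kernel[OF G Gam_dird_x hkp_line_continuous[OF Gamx_hkp] fB VBc[OF G(2)]])
  obtain Sx where Sx: "\<And>i. dird (e_x i) B.S (Sx i) (ball z0 r2)" "\<And>i. continuous_on (ball z0 r2) (Sx i)"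
    and Sc: "continuous_on (ball z0 r2) B.S"
    using B.S_reg[OF open_ball c2(2)] unfolding reg_def by blast
  \<comment> \<open>The right-hand side of the representation, now taken as a function on the whole
    ball, including K. It equals u off K.\<close>
  define v2 where "v2 z = B.S z - conv Gam B.F1 z" for z
  define v2x where "v2x i z = Sx i z - conv (Gamx i) B.F1 z" for i z
  have v2c: "continuous_on (ball z0 r2) v2" "\<And>i. continuous_on (ball z0 r2) (v2x i)"
    unfolding v2_def[abs_def] v2x_def[abs_def]
    by (intro continuous_on_diff Sc Sx continuous_on_subset[OF VBc] G subset_UNIV)+
  have v2d: "dird (e_x i) v2 (v2x i) (ball z0 r2)" for i
    unfolding v2_def[abs_def] v2x_def[abs_def] by (intro dird_diff Sx dird_subset[OF VBd] subset_UNIV)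
  have v2u: "v2 w = u w" if "w \<in> ball z0 r2 - K" for w
    using B.representation[of w] c2(2)[of w] that by (simp add: v2_def)

  \<comment> \<open>At points of K nothing is known about the sign of \<open>v2\<close>, hence the
    positive part; off K it changes nothing because u \<ge> 0. Then \<open>f\<close> below is a
    version of the innermost nonlinear term with continuous space derivatives everywhere.\<close>
  define \<phi> where "\<phi> x = max 0 x powr p" for x :: real
  define \<phi>' where "\<phi>' x = p * max 0 x powr (p - 1)" for x :: real
  have \<phi>d: "DERIV \<phi> x :> \<phi>' x" for x unfolding \<phi>_def[abs_def] \<phi>'_def using p by (intro DERIV_max_powr)
  obtain \<xi> \<xi>t \<xi>x \<xi>xx where c3: "cutoff_function \<xi> \<xi>t \<xi>x \<xi>xx (cball z0 (3 * r3))" "\<And>w. w \<in> ball z0 r3 \<Longrightarrow> \<xi> w = 1"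
    using point_cutoff[OF r(3)] by blast
  interpret D: singular_cutoff K Q u ut ux uxx m p \<xi> \<xi>t \<xi>x \<xi>xx "cball z0 (3 * r3)"
    by (intro singular_cutoff.intro singular_cutoff_axioms.intro singular_solution_axioms c3(1) sub(3))
  define f where "f w = \<phi> (v2 w) * \<xi> w" for w
  define fx where "fx i w = (\<phi>' (v2 w) * v2x i w) * \<xi> w + \<phi> (v2 w) * \<xi>x i w" for i w
  have \<phi>c: "continuous_on (ball z0 r2) (\<lambda>w. \<phi> (v2 w))" "continuous_on (ball z0 r2) (\<lambda>w. \<phi>' (v2 w) * v2x i w)" for i
    unfolding \<phi>_def \<phi>'_def using p by (intro continuous_intros continuous_max_powr v2c; simp)+
  have fc: "continuous_on UNIV f" unfolding f_def[abs_def]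
    by (rule continuous_mult_cutoff[OF \<phi>c(1) D.\<psi>c(1) closed_cball sub1(3) open_ball D.\<psi>0])
  have fxc: "continuous_on UNIV (fx i)" for i unfolding fx_def[abs_def]
    by (rule continuous_on_add[OF continuous_mult_cutoff[OF \<phi>c(2) D.\<psi>c(1) closed_cball sub1(3) open_ball D.\<psi>0]
          continuous_mult_cutoff[OF \<phi>c(1) D.\<psi>c(3) closed_cball sub1(3) open_ball D.off_C(2)]])
  have fd: "dird (e_x i) f (fx i) UNIV" for i unfolding f_def[abs_def] fx_def[abs_def]
    by (rule dird_mult_cutoff[OF dird_chain[OF v2d \<phi>d] D.\<psi>d(2) closed_cball sub1(3) D.\<psi>0])
  have far: "w \<notin> cball z0 (3 * r3)" if "norm w > norm z0 + 3 * r3" for w :: "(real ^ 'n) \<times> real"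
    using that norm_triangle_ineq2[of w z0] by (auto simp: dist_norm norm_minus_commute)
  have fb: "bdsupp f"
    by (rule bdsupp_continuousI[OF fc, of "norm z0 + 3 * r3"]) (use far in \<open>simp add: f_def D.\<psi>0\<close>)
  have fxb: "bdsupp (fx i)" for i
    by (rule bdsupp_continuousI[OF fxc, of "norm z0 + 3 * r3"]) (use far in \<open>simp add: fx_def D.\<psi>0 D.off_C\<close>)
  have fF: "f w = D.F1 w" if "w \<notin> K" for w
  proof (cases "w \<in> cball z0 (3 * r3)")
    case True
    then have "v2 w = u w" using sub1(3) that by (intro v2u) blast
    then show ?thesis using unn[of w] by (simp add: f_def D.F1_def \<phi>_def)
  qed (simp add: f_def D.F1_def D.\<psi>0)
  have convF: "conv Gam D.F1 z = conv Gam f z" for z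
  proof -
    have fm: "f \<in> borel_measurable borel" and Fm: "D.F1 \<in> borel_measurable borel" and Gm: "Gam \<in> borel_measurable (borel :: ((real ^ 'n) \<times> real) measure)"
      by (rule bdsupp_measurable[OF fb], rule mild_measurable[OF D.F1_mild], rule locint_measurable[OF G(1)])
    have Gzm: "(\<lambda>w. Gam (z - w)) \<in> borel_measurable borel"
      by (rule measurable_compose[OF _ Gm]) (intro borel_measurable_continuous_onI continuous_intros)
    show ?thesis unfolding conv_alt[OF Gm fm] conv_alt[OF Gm Fm]
    proof (rule integral_cong_AE)
      show "AE w in lborel. Gam (z - w) * D.F1 w = Gam (z - w) * f w"
        using AE_not_in[OF Knull] by eventually_elim (simp add: fF)
    qed (unfold measurable_lborel2, (intro borel_measurable_times Gzm fm Fm)+)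
  qed
  obtain Vt where Vt: "continuous_on UNIV Vt" "dird e_t (conv Gam f) Vt {z. snd z < snd z0 + r3}"
    using heat_potential_dird_t[OF fb fc fxb fxc fd] by blast
  have snd_lt: "ball z0 r3 \<subseteq> {z. snd z < snd z0 + r3}"
  proof
    fix z assume "z \<in> ball z0 r3"
    then have "dist (snd z0) (snd z) < r3" using dist_snd_le[of z0 z] by simp
    then show "z \<in> {z. snd z < snd z0 + r3}" by (auto simp: dist_real_def)
  qed
  \<comment> \<open>In second space derivatives the density takes one derivative and the kernel the
    other, as only the first derivatives of the kernel are locally integrable.\<close>
  have "reg (conv Gam f) (ball z0 r3)"
  proof (rule regI[where vt=Vt and vx="\<lambda>i. conv Gam (fx i)" and vxx="\<lambda>j i. conv (Gamx j) (fx i)"])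
    show "continuous_on (ball z0 r3) (conv Gam f)" by (rule continuous_on_subset[OF conv_continuous'[OF G(1) fb fc]]) simp
    show "dird e_t (conv Gam f) Vt (ball z0 r3)" by (rule dird_subset[OF Vt(2) snd_lt])
    show "continuous_on (ball z0 r3) Vt" by (rule continuous_on_subset[OF Vt(1)]) simp
    show "dird (e_x i) (conv Gam f) (conv Gam (fx i)) (ball z0 r3)" for i
      by (rule dird_subset[OF conv_dird[OF G(1) fb fxb fd]]) simp
    show "continuous_on (ball z0 r3) (conv Gam (fx i))" for i
      by (rule continuous_on_subset[OF conv_continuous'[OF G(1) fxb fxc]]) simp
    show "continuous_on (ball z0 r3) (conv (Gamx j) (fx i))" for i j
      by (rule continuous_on_subset[OF conv_continuous'[OF G(2) fxb fxc]]) simp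
    show "dird (e_x j) (conv Gam (fx i)) (conv (Gamx j) (fx i)) (ball z0 r3)" for i j
      by (rule dird_subset[OF conv_dird_kernel[OF G Gam_dird_x hkp_line_continuous[OF Gamx_hkp] fxb conv_continuous'[OF G(2) fxb fxc]]]) simp
  qed
  then have "reg (\<lambda>z. D.S z + (- 1) * conv Gam f z) (ball z0 r3)"
    by (intro reg_add reg_cmult D.S_reg open_ball c3(2))
  moreover have "D.S z + (- 1) * conv Gam f z = u z" if "z \<in> ball z0 r3 - K" for z
    using D.representation[of z] c3(2)[of z] that by (simp add: convF)
  moreover have "ball z0 r3 \<subseteq> Q" by (rule sub(4))
  ultimately show ?thesis using r(3)
    by (intro exI[of _ "ball z0 r3"] exI[of _ "\<lambda>z. D.S z + (- 1) * conv Gam f z"]) auto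
qed

end

section \<open>Geometry of the moving submanifold\<close>

lemma smooth_lipschitz:
  fixes f :: "'a::euclidean_space \<Rightarrow> 'b::real_normed_vector"
  assumes f: "smooth_on U f" and X: "compact X" "convex X" "X \<subseteq> U"
  obtains L where "0 \<le> L" "\<And>x y. x \<in> X \<Longrightarrow> y \<in> X \<Longrightarrow> dist (f x) (f y) \<le> L * dist x y"
proof -
  have "Ck_on (Suc 0) U f" using f by (simp add: smooth_on_def)
  then have d: "\<And>x. x \<in> U \<Longrightarrow> f differentiable (at x)"
    and c: "\<And>v. continuous_on U (\<lambda>x. frechet_derivative f (at x) v)" by auto
  have "\<exists>C. \<forall>x\<in>X. norm (frechet_derivative f (at x) b) \<le> C" for b
  proof -
    have "compact ((\<lambda>x. frechet_derivative f (at x) b) ` X)"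
      by (intro compact_continuous_image continuous_on_subset[OF c] X)
    then show ?thesis by (meson compact_imp_bounded bounded_iff imageI)
  qed
  then obtain C where C: "\<And>b x. x \<in> X \<Longrightarrow> norm (frechet_derivative f (at x) b) \<le> C b" by metis
  define L where "L = (\<Sum>b\<in>Basis. \<bar>C b\<bar>)"
  have L0: "0 \<le> L" by (simp add: L_def sum_nonneg)
  have on: "onorm (frechet_derivative f (at x)) \<le> L" if x: "x \<in> X" for x
  proof (rule onorm_bound[OF L0])
    fix v
    let ?D = "frechet_derivative f (at x)"
    have lin: "linear ?D" using d x X(3) by (intro linear_frechet_derivative) auto
    have "?D v = ?D (\<Sum>b\<in>Basis. (v \<bullet> b) *\<^sub>R b)" by (simp add: euclidean_representation)
    also have "\<dots> = (\<Sum>b\<in>Basis. (v \<bullet> b) *\<^sub>R ?D b)" by (simp add: linear_sum[OF lin] linear_scale[OF lin])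
    finally have "norm (?D v) \<le> (\<Sum>b\<in>Basis. norm ((v \<bullet> b) *\<^sub>R ?D b))" using norm_sum by metis
    also have "\<dots> \<le> (\<Sum>b\<in>Basis. \<bar>C b\<bar> * norm v)"
    proof (intro sum_mono)
      fix b :: 'a assume b: "b \<in> Basis"
      have "norm (?D b) \<le> \<bar>C b\<bar>" using C[OF x, of b] by linarith
      then have "\<bar>v \<bullet> b\<bar> * norm (?D b) \<le> norm v * \<bar>C b\<bar>" using Basis_le_norm[OF b, of v] by (intro mult_mono) auto
      then show "norm ((v \<bullet> b) *\<^sub>R ?D b) \<le> \<bar>C b\<bar> * norm v" by (simp add: mult.commute)
    qed
    also have "\<dots> = L * norm v" by (simp add: L_def sum_distrib_right)
    finally show "norm (?D v) \<le> L * norm v" .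
  qed
  show thesis
  proof (rule that[OF L0])
    fix x y assume "x \<in> X" "y \<in> X"
    then have "norm (f x - f y) \<le> L * norm (x - y)"
    proof (intro differentiable_bound[OF X(2) _ on])
      fix z assume "z \<in> X"
      then have "f differentiable (at z)" using d X(3) by auto
      then show "(f has_derivative frechet_derivative f (at z)) (at z within X)"
        using frechet_derivative_works has_derivative_at_withinI by blast
    qed
    then show "dist (f x) (f y) \<le> L * dist x y" by (simp add: dist_norm)
  qed
qed

text \<open>Near each point the inverse chart is Lipschitz on a closed ball and maps a piece of an
  m-dimensional coordinate slice onto a set containing the submanifold locally. Finitely many such
  pieces suffice by compactness.\<close>

lemma cov_submanifold:
  fixes M0 :: "(real ^ 'n::finite) set"
  assumes M: "compact M0" and m: "embedded_submanifold m M0"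
  shows "cov m M0"
proof -
  have "\<exists>N A. open N \<and> q \<in> N \<and> cov m A \<and> N \<inter> M0 \<subseteq> A" if q: "q \<in> M0" for q
  proof -
    from bspec[OF m[unfolded embedded_submanifold_def] q] obtain U V and \<phi> :: "real ^ 'n \<Rightarrow> real ^ 'n" and Ks :: "'n set"
      where "open U \<and> q \<in> U \<and> open V \<and> diffeomorphism_between U V \<phi> \<and> card Ks = m \<and>
        \<phi> ` (U \<inter> M0) = V \<inter> {y. \<forall>i. i \<notin> Ks \<longrightarrow> y $ i = 0}" by (elim exE) (rule that, assumption)
    then have h: "open U" "q \<in> U" "open V" "diffeomorphism_between U V \<phi>" "card Ks = m"
      "\<phi> ` (U \<inter> M0) = V \<inter> {y. \<forall>i. i \<notin> Ks \<longrightarrow> y $ i = 0}" by blast+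
    obtain g where g: "smooth_on V g" "homeomorphism U V \<phi> g" using h(4) unfolding diffeomorphism_between_def by blast
    have \<phi>c: "continuous_on U \<phi>" and \<phi>V: "\<phi> ` U = V" and g\<phi>: "\<And>x. x \<in> U \<Longrightarrow> g (\<phi> x) = x"
      using g(2) unfolding homeomorphism_def by auto
    have "\<phi> q \<in> V" using \<phi>V h(2) by auto
    then obtain r where r: "r > 0" "cball (\<phi> q) r \<subseteq> V" using h(3) open_contains_cball by blast
    obtain L where L: "0 \<le> L" "\<And>x y. x \<in> cball (\<phi> q) r \<Longrightarrow> y \<in> cball (\<phi> q) r \<Longrightarrow> dist (g x) (g y) \<le> L * dist x y"
    proof (rule smooth_lipschitz[where X="cball (\<phi> q) r" and f=g and U=V])
      show "cball (\<phi> q) r \<subseteq> V" by (rule r(2))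
    qed (use g(1) that in auto)
    let ?B = "{y. \<forall>i. i \<notin> Ks \<longrightarrow> y $ i = 0} \<inter> cball (\<phi> q) r"
    have "?B \<subseteq> {y. (\<forall>i. i \<notin> Ks \<longrightarrow> y $ i = 0) \<and> (\<forall>i. \<bar>y $ i\<bar> \<le> norm (\<phi> q) + r)}"
    proof
      fix y assume y: "y \<in> ?B"
      have "norm y \<le> norm (\<phi> q) + r"
        using y norm_triangle_ineq2[of y "\<phi> q"] by (simp add: dist_norm norm_minus_commute)
      then have "\<bar>y $ i\<bar> \<le> norm (\<phi> q) + r" for i using component_le_norm_cart[of y i] by linarith
      then show "y \<in> {y. (\<forall>i. i \<notin> Ks \<longrightarrow> y $ i = 0) \<and> (\<forall>i. \<bar>y $ i\<bar> \<le> norm (\<phi> q) + r)}" using y by blast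
    qed
    then have "cov m ?B"
      by (rule cov_subset[OF cov_slice[where K=Ks and r="norm (\<phi> q) + r", unfolded h(5)]])
    then have c: "cov m (g ` ?B)" by (rule cov_lipschitz_image) (use L(2) in auto)
    let ?N = "U \<inter> \<phi> -` ball (\<phi> q) r"
    have "open ?N" using \<phi>c h(1) by (intro continuous_open_preimage) auto
    moreover have "q \<in> ?N" using h(2) r by simp
    moreover have "?N \<inter> M0 \<subseteq> g ` ?B"
    proof
      fix x assume x: "x \<in> ?N \<inter> M0"
      then have "\<phi> x \<in> \<phi> ` (U \<inter> M0)" by blast
      then have "\<phi> x \<in> V \<inter> {y. \<forall>i. i \<notin> Ks \<longrightarrow> y $ i = 0}" unfolding h(6) .
      moreover have "\<phi> x \<in> cball (\<phi> q) r" using x by simp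
      ultimately have b: "\<phi> x \<in> ?B" by blast
      have "g (\<phi> x) = x" using g\<phi> x by blast
      then show "x \<in> g ` ?B" by (rule image_eqI[OF sym b])
    qed
    ultimately show ?thesis using c by blast
  qed
  then have "\<forall>q\<in>M0. \<exists>NA. open (fst NA) \<and> q \<in> fst NA \<and> cov m (snd NA) \<and> fst NA \<inter> M0 \<subseteq> snd NA" by fastforce
  from bchoice[OF this] obtain NA' where NA': "\<forall>q\<in>M0. open (fst (NA' q)) \<and> q \<in> fst (NA' q) \<and> cov m (snd (NA' q)) \<and>
      fst (NA' q) \<inter> M0 \<subseteq> snd (NA' q)" by (elim exE) (rule that, assumption)
  define N where "N q = fst (NA' q)" for q
  define A where "A q = snd (NA' q)" for q
  have NA: "open (N q) \<and> q \<in> N q \<and> cov m (A q) \<and> N q \<inter> M0 \<subseteq> A q" if "q \<in> M0" for q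
    using NA' that unfolding N_def A_def by blast
  have "M0 \<subseteq> (\<Union>q\<in>M0. N q)" using NA by blast
  then obtain T where T: "T \<subseteq> M0" "finite T" "M0 \<subseteq> (\<Union>q\<in>T. N q)"
    using compactE_image[OF M, of M0 N] NA by metis
  have "cov m (\<Union>q\<in>T. A q)" using T NA by (intro cov_UN) auto
  moreover have "M0 \<subseteq> (\<Union>q\<in>T. A q)"
  proof
    fix x assume x: "x \<in> M0"
    then obtain q where "q \<in> T" "x \<in> N q" using T(3) by blast
    then show "x \<in> (\<Union>q\<in>T. A q)" using NA T(1) x by blast
  qed
  ultimately show ?thesis by (rule cov_subset)
qed

section \<open>Locality of the differential operators\<close>

lemma pd_cong:
  assumes "open G" "\<And>z. z \<in> G \<Longrightarrow> f z = g z" "z \<in> G"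
  shows "pd e f z = pd e g z"
proof -
  have "\<forall>\<^sub>F s in nhds (0::real). f (z + s *\<^sub>R e) = g (z + s *\<^sub>R e)"
    using eventually_line[OF assms(1,3), of e] by eventually_elim (rule assms(2))
  then have "\<forall>\<^sub>F s in nhds (0::real). s \<in> UNIV \<longrightarrow> f (z + s *\<^sub>R e) = g (z + s *\<^sub>R e)"
    by eventually_elim simp
  then show ?thesis unfolding pd_def by (rule vector_derivative_cong_eq) auto
qed

lemma laplacian_cong:
  assumes "open G" "\<And>z. z \<in> G \<Longrightarrow> f z = g z" "z \<in> G"
  shows "laplacian f z = laplacian g z"
  unfolding laplacian_def
  by (intro sum.cong refl pd_cong[OF assms(1) _ assms(3)]) (rule pd_cong[OF assms(1,2)])

lemma reg_cong:
  assumes "reg f P" "open P" "\<And>z. z \<in> P \<Longrightarrow> f z = g z"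
  shows "reg g P"
proof -
  obtain ft fx fxx where F: "continuous_on P f" "dird e_t f ft P" "continuous_on P ft" "\<And>i. dird (e_x i) f (fx i) P"
    "\<And>i. continuous_on P (fx i)" "\<And>i j. dird (e_x j) (fx i) (fxx j i) P" "\<And>i j. continuous_on P (fxx j i)"
    using assms(1) unfolding reg_def by blast
  show ?thesis
  proof (rule regI[OF _ _ F(3) _ F(5,6,7)])
    show "continuous_on P g" using F(1) by (rule continuous_on_eq) (rule assms(3))
    show "dird e_t g ft P" by (rule dird_cong[OF F(2) assms(2,3) refl])
    show "dird (e_x i) g (fx i) P" for i by (rule dird_cong[OF F(4) assms(2,3) refl])
  qed
qed

lemma C21_on_local:
  assumes "\<And>z. z \<in> S \<Longrightarrow> \<exists>U. open U \<and> z \<in> U \<and> C21_on U v"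
  shows "C21_on S v"
proof -
  have c: "continuous_on S f" if "\<And>U. C21_on U v \<Longrightarrow> continuous_on U f" for f :: "(real ^ 'a) \<times> real \<Rightarrow> real"
  proof (rule continuous_at_imp_continuous_on, rule ballI)
    fix z assume "z \<in> S"
    then obtain U where U: "open U" "z \<in> U" "C21_on U v" using assms by blast
    from that[OF U(3)] show "isCont f z" using continuous_on_eq_continuous_at[OF U(1)] U(2) by blast
  qed
  have cs: "continuous_on S v" "continuous_on S (pd e_t v)" "continuous_on S (pd (e_x i) v)"
    "continuous_on S (pd (e_x i) (pd (e_x j) v))" for i j
    by (rule c, erule C21_onD)+
  have ps: "has_pd e_t v z" "has_pd (e_x i) v z" "has_pd (e_x i) (pd (e_x j) v) z" if zS: "z \<in> S" for z i j
  proof -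
    obtain U where U: "z \<in> U" "C21_on U v" using assms[OF zS] by blast
    show "has_pd e_t v z" "has_pd (e_x i) v z" "has_pd (e_x i) (pd (e_x j) v) z"
      using dird_has_pd[OF C21_onD(2)[OF U(2)] U(1)] dird_has_pd[OF C21_onD(4)[OF U(2)] U(1)]
        dird_has_pd[OF C21_onD(6)[OF U(2)] U(1)] by blast+
  qed
  show ?thesis unfolding C21_on_def by (intro conjI allI ballI cs ps)
qed

text \<open>Reduction to \<open>singular_solution\<close> on a small ball around \<open>z0\<close>.
  The last clause of the conclusion, that the track has empty interior in \<open>U\<close>, is the
  topological form of K being null and is what gluing needs.\<close>

lemma local_extension_moving:
  fixes M0 :: "(real ^ 'n::finite) set" and F F' :: "(real ^ 'n) \<times> real \<Rightarrow> real ^ 'n"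
  assumes nm: "CARD('n) \<ge> m + 3" and p: "1 < p" "p < real (CARD('n) - m) / real (CARD('n) - m - 2)"
    and M0: "compact M0" "M0 \<noteq> {}" "embedded_submanifold m M0" and F: "diffeo_family F I"
    and M: "M = moving F I F' M0" and \<Omega>: "open \<Omega>"
    and u: "nonneg_solution p (\<Omega> \<times> I - track M I) u"
    and lim: "\<And>I'. is_interval I' \<Longrightarrow> bounded I' \<Longrightarrow> closure I' \<subseteq> I \<Longrightarrow>
           lim_to_moving M I' (\<lambda>(x, t). infdist x (M t) ^ (CARD('n) - m - 2) * u (x, t)) 0"
    and z0: "z0 \<in> \<Omega> \<times> I"
  shows "\<exists>U v. open U \<and> z0 \<in> U \<and> U \<subseteq> \<Omega> \<times> I \<and> open (U - track M I) \<and> reg v U \<and>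
     (\<forall>z\<in>U - track M I. v z = u z) \<and> (\<forall>X. open X \<longrightarrow> X \<subseteq> U \<inter> track M I \<longrightarrow> X = {})"
proof -
  have I: "open I" and Fs: "smooth_on (UNIV \<times> I) F" using F by (auto simp: diffeo_family_def)
  obtain r where r: "r > 0" "cball (snd z0) r \<subseteq> I" using I z0 open_contains_cball by (metis mem_Times_iff)
  define a where "a = snd z0 - r"
  define b where "b = snd z0 + r"
  have ab: "{a..b} \<subseteq> I" "a < snd z0" "snd z0 < b" using r by (auto simp: a_def b_def cball_eq_atLeastAtMost)
  have Mt: "M t = (\<lambda>x. F (x, t)) ` M0" if "t \<in> I" for t using that by (simp add: M moving_def)
  obtain R where "\<forall>x\<in>M0. norm x \<le> R" using compact_imp_bounded[OF M0(1)] bounded_iff by blast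
  then have R: "M0 \<subseteq> cball 0 R" by auto
  have X: "compact (cball 0 R \<times> {a..b} :: ((real ^ 'n) \<times> real) set)" "convex (cball 0 R \<times> {a..b} :: ((real ^ 'n) \<times> real) set)"
    "cball 0 R \<times> {a..b} \<subseteq> UNIV \<times> I"
    using ab by (auto intro: compact_Times convex_Times)
  obtain L where L: "0 \<le> L" "\<And>x y. x \<in> cball 0 R \<times> {a..b} \<Longrightarrow> y \<in> cball 0 R \<times> {a..b} \<Longrightarrow> dist (F x) (F y) \<le> L * dist x y"
    using smooth_lipschitz[OF Fs X] by blast
  \<comment> \<open>The track over [a, b] is the image of M0 \<times> [a, b] under this Lipschitz
    map, hence has covering dimension m + 1. The compact time interval is what makes K
    compact.\<close>
  define G where "G = (\<lambda>x. (F x, snd x))"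
  define K where "K = G ` (M0 \<times> {a..b})"
  have GL: "dist (G x) (G y) \<le> (L + 1) * dist x y" if "x \<in> M0 \<times> {a..b}" "y \<in> M0 \<times> {a..b}" for x y
  proof -
    have "dist (G x) (G y) \<le> dist (F x) (F y) + dist (snd x) (snd y)"
      unfolding G_def dist_Pair_Pair by (rule sqrt_sum_squares_le_sum) auto
    also have "\<dots> \<le> L * dist x y + dist x y"
      using that R by (intro add_mono L(2) dist_snd_le) auto
    finally show ?thesis by (simp add: distrib_right)
  qed
  have covK: "cov (Suc m) K" unfolding K_def
    by (rule cov_lipschitz_image[OF cov_Times_Icc[OF cov_submanifold[OF M0(1,3)]] GL])
  have "continuous_on (UNIV \<times> I) F" using Fs unfolding smooth_on_def by (metis Ck_on.simps(1))
  then have "continuous_on (M0 \<times> {a..b}) F" by (rule continuous_on_subset) (use ab in auto)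
  then have "continuous_on (M0 \<times> {a..b}) G" unfolding G_def by (intro continuous_intros)
  then have cK: "compact K" unfolding K_def by (intro compact_continuous_image compact_Times M0 compact_Icc)
  have K_iff: "(x, t) \<in> K \<longleftrightarrow> x \<in> M t" if "t \<in> {a..b}" for x t
  proof -
    have "(x, t) \<in> K \<longleftrightarrow> (\<exists>q\<in>M0. \<exists>s\<in>{a..b}. (x, t) = (F (q, s), s))" unfolding K_def G_def by auto
    also have "\<dots> \<longleftrightarrow> (\<exists>q\<in>M0. x = F (q, t))" using that by auto
    also have "\<dots> \<longleftrightarrow> x \<in> M t" using Mt[of t] subsetD[OF ab(1) that] by auto
    finally show ?thesis .
  qed
  have Kne: "K \<noteq> {}" unfolding K_def using M0(2) ab by auto
  \<comment> \<open>All times occurring in the ball Q lie in [a, b], so inside Q the compact set K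
    and the whole track coincide.\<close>
  have "open (\<Omega> \<times> {a<..<b})" "z0 \<in> \<Omega> \<times> {a<..<b}" using \<Omega> z0 ab by (auto simp: open_Times mem_Times_iff)
  then obtain r0 where r0: "r0 > 0" "ball z0 r0 \<subseteq> \<Omega> \<times> {a<..<b}" using openE by blast
  define Q where "Q = ball z0 r0"
  have "{a<..<b} \<subseteq> I" by (rule order_trans[OF _ ab(1)]) auto
  then have "\<Omega> \<times> {a<..<b} \<subseteq> \<Omega> \<times> I" by blast
  then have Qs: "Q \<subseteq> \<Omega> \<times> I" using r0(2) unfolding Q_def by (rule order_trans[rotated])
  have Qt: "\<And>z. z \<in> Q \<Longrightarrow> snd z \<in> {a..b}"
    using r0(2) unfolding Q_def by fastforce
  have QT: "z \<in> track M I \<longleftrightarrow> z \<in> K" if "z \<in> Q" for z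
    using K_iff[OF Qt[OF that], of "fst z"] Qt[OF that] ab(1) by (cases z) (auto simp: track_def)
  have QK: "Q - K \<subseteq> \<Omega> \<times> I - track M I" using Qs QT by blast
  have oQK: "open (Q - K)" unfolding Q_def using cK by (intro open_Diff compact_imp_closed) auto
  have C21: "C21_on (\<Omega> \<times> I - track M I) u" and unn: "\<And>z. z \<in> \<Omega> \<times> I - track M I \<Longrightarrow> 0 \<le> u z"
    and upde: "\<And>z. z \<in> \<Omega> \<times> I - track M I \<Longrightarrow> pd e_t u z - laplacian u z = - (u z powr p)"
    using u by (auto simp: nonneg_solution_def)
  note D = C21_onD[OF C21]
  \<comment> \<open>Values of u on and outside the singular track are unconstrained; the extension
    by 0 supplies the normalisation of the locale.\<close>
  define u' where "u' z = (if z \<in> Q - K then u z else 0)" for z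
  have du: "dird e u' f' (Q - K)" if "dird e u f' (\<Omega> \<times> I - track M I)" for e f'
    by (rule dird_cong[OF dird_subset[OF that QK] oQK]) (auto simp: u'_def)
  interpret singular_solution K Q u' "pd e_t u" "\<lambda>i. pd (e_x i) u" "\<lambda>i. pd (e_x i) (pd (e_x i) u)" m p
  proof
    show "compact K" "K \<noteq> {}" "cov (Suc m) K" by fact+
    show "open Q" by (simp add: Q_def)
    show "continuous_on (Q - K) u'"
      using continuous_on_subset[OF D(1) QK] by (rule continuous_on_eq) (simp add: u'_def)
    show "0 \<le> u' z" for z using unn QK by (auto simp: u'_def)
    show "pd e_t u z - (\<Sum>i\<in>UNIV. pd (e_x i) (pd (e_x i) u) z) = - (u' z powr p)" if "z \<in> Q - K" for z
      using upde[of z] QK that by (auto simp: u'_def laplacian_def)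
    fix e :: real assume e: "e > 0"
    have "lim_to_moving M {a..b} (\<lambda>(x, t). infdist x (M t) ^ (CARD('n) - m - 2) * u (x, t)) 0"
      by (rule lim) (use ab in \<open>auto simp: is_interval_cc\<close>)
    then obtain \<delta> where \<delta>: "\<delta> > 0" "\<And>t x. t \<in> {a..b} \<Longrightarrow> x \<in> tube (M t) \<delta> - M t \<Longrightarrow>
        \<bar>infdist x (M t) ^ (CARD('n) - m - 2) * u (x, t)\<bar> \<le> e"
      using e unfolding lim_to_moving_def by fastforce
    show "\<exists>\<delta>>0. \<forall>z\<in>Q - K. infdist z K < \<delta> \<longrightarrow> infdist z K ^ (CARD('n) - m - 2) * u' z \<le> e"
    \<comment> \<open>A point of K nearest up to this tolerance sits at another time s. Following
      its trajectory from s to t costs at most L |t - s|, so M t is reached within (1 + L) \<delta>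
      / (L + 1) = \<delta>.\<close>
    proof (intro exI[of _ "\<delta> / (L + 1)"] conjI ballI impI)
      show "0 < \<delta> / (L + 1)" using \<delta>(1) L(1) by simp
      fix z assume z: "z \<in> Q - K" and dz: "infdist z K < \<delta> / (L + 1)"
      obtain x t where xt: "z = (x, t)" by (cases z)
      have t: "t \<in> {a..b}" using Qt[of z] z xt by auto
      have tI: "t \<in> I" using t ab by auto
      have xM: "x \<notin> M t" using K_iff[OF t, of x] z xt by auto
      have Mne: "M t \<noteq> {}" using Mt[OF tI] M0(2) by auto
      obtain y where y: "y \<in> K" "dist z y < \<delta> / (L + 1)"
        using dz Kne cINF_less_iff[of K "dist z" "\<delta> / (L + 1)"] by (auto simp: infdist_notempty)
      then obtain q s where qs: "q \<in> M0" "s \<in> {a..b}" "y = (F (q, s), s)" unfolding K_def G_def by auto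
      have d1: "dist x (F (q, s)) < \<delta> / (L + 1)" "dist t s < \<delta> / (L + 1)"
        using y(2) dist_fst_le[of z y] dist_snd_le[of z y] by (auto simp: xt qs)
      have "dist (F (q, s)) (F (q, t)) \<le> L * dist (q, s) (q, t)"
        by (rule L(2)) (use R qs t in auto)
      also have "\<dots> = L * dist t s" by (simp add: dist_Pair_Pair dist_commute)
      also have "\<dots> \<le> L * (\<delta> / (L + 1))" using d1(2) L(1) by (intro mult_left_mono) auto
      finally have "dist x (F (q, t)) < \<delta> / (L + 1) + L * (\<delta> / (L + 1))"
        using d1(1) dist_triangle[of x "F (q, t)" "F (q, s)"] by linarith
      also have "\<dots> = (1 + L) * (\<delta> / (L + 1))" by (simp only: distrib_right mult_1)
      also have "\<dots> = \<delta>"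
      proof -
        have "X * (\<delta> / X) = \<delta>" if "X > 0" for X using that by simp
        from this[of "L + 1"] show ?thesis using L(1) by (simp add: add.commute)
      qed
      finally have "infdist x (M t) < \<delta>"
        using infdist_le[of "F (q, t)" "M t" x] Mt[OF tI] qs(1) by (metis image_eqI le_less_trans)
      then have "\<bar>infdist x (M t) ^ (CARD('n) - m - 2) * u (x, t)\<bar> \<le> e"
        using xM by (intro \<delta>(2)[OF t]) (auto simp: tube_def)
      \<comment> \<open>The converse comparison: points of M t at the same time t belong to K, so
        passing to the space-time distance only decreases the weight in front of u \<ge> 0.\<close>
      moreover have "infdist z K \<le> infdist x (M t)"
        unfolding infdist_notempty[OF Mne]
      proof (rule cINF_greatest[OF Mne])
        fix y assume "y \<in> M t"
        then have "(y, t) \<in> K" using K_iff[OF t] by blast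
        then have "infdist z K \<le> dist z (y, t)" by (rule infdist_le)
        then show "infdist z K \<le> dist x y" by (simp add: xt dist_Pair_Pair)
      qed
      then have "infdist z K ^ (CARD('n) - m - 2) * u z \<le> infdist x (M t) ^ (CARD('n) - m - 2) * u z"
        using unn[of z] z QK by (intro mult_right_mono power_mono infdist_nonneg) auto
      ultimately have "infdist z K ^ (CARD('n) - m - 2) * u z \<le> e" unfolding xt by linarith
      then show "infdist z K ^ (CARD('n) - m - 2) * u' z \<le> e" using z by (simp add: u'_def)
    qed
  next
    show "u' z = 0" if "z \<notin> Q - K" for z using that unfolding u'_def by (simp only: if_False)
  qed (rule nm p du D(2,4) dird_subset[OF D(6) QK] continuous_on_subset[OF D(3) QK] continuous_on_subset[OF D(5) QK] continuous_on_subset[OF D(7) QK])+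
  have "z0 \<in> Q" using r0(1) by (simp add: Q_def)
  from local_extension[OF this] obtain U v where U: "open U" "z0 \<in> U" "U \<subseteq> Q" "reg v U" "\<And>z. z \<in> U - K \<Longrightarrow> v z = u' z"
    by blast
  have UT: "U - track M I = U - K" "U \<inter> track M I = U \<inter> K" using U(3) QT by blast+
  show ?thesis
  proof (intro exI[of _ U] exI[of _ v] conjI ballI allI impI)
    show "open (U - track M I)" unfolding UT using U(1) Kcl by (rule open_Diff)
    show "v z = u z" if "z \<in> U - track M I" for z using U(3) U(5)[of z] that unfolding UT by (auto simp: u'_def)
    show "X = {}" if "open X" "X \<subseteq> U \<inter> track M I" for X using open_subset_K[OF that(1)] that(2) unfolding UT by blast
  qed (use U Qs in auto)
qed

text \<open>Two local extensions agree with u off T, and T has empty interior in each neighbourhood,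
  so by continuity they agree on overlaps. The same density argument transports the sign and the
  equation to T.\<close>

lemma glue_extensions:
  fixes u :: "(real ^ 'n::finite) \<times> real \<Rightarrow> real"
  assumes S: "open S" and u: "nonneg_solution p (S - T) u" and p: "1 < p"
    and loc: "\<And>z0. z0 \<in> S \<Longrightarrow> \<exists>U v. open U \<and> z0 \<in> U \<and> U \<subseteq> S \<and> open (U - T) \<and> reg v U \<and>
     (\<forall>z\<in>U - T. v z = u z) \<and> (\<forall>X. open X \<longrightarrow> X \<subseteq> U \<inter> T \<longrightarrow> X = {})"
  shows "\<exists>v. (\<forall>z\<in>S - T. v z = u z) \<and> nonneg_solution p S v"
proof -
  obtain U w where Uw: "\<And>z0. z0 \<in> S \<Longrightarrow> open (U z0) \<and> z0 \<in> U z0 \<and> U z0 \<subseteq> S \<and> open (U z0 - T) \<and> reg (w z0) (U z0) \<and>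
     (\<forall>z\<in>U z0 - T. w z0 z = u z) \<and> (\<forall>X. open X \<longrightarrow> X \<subseteq> U z0 \<inter> T \<longrightarrow> X = {})"
    using loc by metis
  have U: "open (U z)" "z \<in> U z" "U z \<subseteq> S" "open (U z - T)" "reg (w z) (U z)" "\<And>y. y \<in> U z - T \<Longrightarrow> w z y = u y"
    and null: "\<And>X. open X \<Longrightarrow> X \<subseteq> U z \<inter> T \<Longrightarrow> X = {}" if "z \<in> S" for z
    using Uw[OF that] by blast+
  have wc: "continuous_on (U z) (w z)" if "z \<in> S" for z using U(5)[OF that] by (simp add: reg_def)
  \<comment> \<open>The set where a continuous function is nonzero is open; if the function vanishes
    off T, that set lies in T and is therefore empty.\<close>
  have agree: "f y = 0" if V: "open V" "y \<in> V" "V \<subseteq> U z" "z \<in> S" and f: "continuous_on V f" "\<And>x. x \<in> V - T \<Longrightarrow> f x = 0"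
    for V y z and f :: "(real ^ 'n) \<times> real \<Rightarrow> real"
  proof (rule ccontr)
    assume y: "f y \<noteq> 0"
    have "open (V \<inter> f -` (- {0}))" by (rule continuous_open_preimage[OF f(1) V(1)]) auto
    moreover have "V \<inter> f -` (- {0}) \<subseteq> U z \<inter> T" using f(2) V(3) by blast
    ultimately have "V \<inter> f -` (- {0}) = {}" by (rule null[OF V(4)])
    then show False using y V(2) by blast
  qed
  \<comment> \<open>At each point the extension attached to that point is evaluated;
    \<open>vw\<close> shows that any other one defined there gives the same value.\<close>
  define v where "v z = w z z" for z
  have vw: "v y = w z y" if z: "z \<in> S" and y: "y \<in> U z" for y z
  proof -
    have yS: "y \<in> S" using U(3)[OF z] y by blast
    have "w y y - w z y = 0"
    proof (rule agree[of "U y \<inter> U z" y z "\<lambda>x. w y x - w z x"])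
      show "continuous_on (U y \<inter> U z) (\<lambda>x. w y x - w z x)"
        by (intro continuous_on_diff continuous_on_subset[OF wc[OF yS]] continuous_on_subset[OF wc[OF z]]) auto
      show "w y x - w z x = 0" if "x \<in> U y \<inter> U z - T" for x using that U(6)[OF yS, of x] U(6)[OF z, of x] by auto
    qed (use U(1)[OF yS] U(1)[OF z] U(2)[OF yS] y z in auto)
    then show ?thesis by (simp add: v_def)
  qed
  have C21: "C21_on S v"
  proof (rule C21_on_local)
    fix z assume z: "z \<in> S"
    have "reg v (U z)" by (rule reg_cong[OF U(5)[OF z] U(1)[OF z]]) (simp add: vw[OF z])
    then show "\<exists>U. open U \<and> z \<in> U \<and> C21_on U v" using U(1,2)[OF z] reg_C21_on by blast
  qed
  have vu: "v z = u z" if "z \<in> S - T" for z using U(6)[of z z] U(2)[of z] that by (auto simp: v_def)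
  have vc: "continuous_on S v" using C21 by (simp add: C21_on_def)
  have nn: "0 \<le> v z" if z: "z \<in> S" for z
  proof -
    have "min 0 (v z) = 0"
    proof (rule agree[OF U(1)[OF z] U(2)[OF z] order_refl z, of "\<lambda>x. min 0 (v x)"])
      show "continuous_on (U z) (\<lambda>x. min 0 (v x))" by (intro continuous_intros continuous_on_subset[OF vc] U(3)[OF z])
      show "min 0 (v x) = 0" if "x \<in> U z - T" for x
        using vu[of x] u U(3)[OF z] that by (auto simp: nonneg_solution_def)
    qed
    then show ?thesis by linarith
  qed
  have pde: "pd e_t v z - laplacian v z = - (v z powr p)" if z: "z \<in> S" for z
  proof -
    \<comment> \<open>The residual of the equation is continuous because v has continuous
      derivatives and is nonnegative with p > 0, and it vanishes off T, where v and u coincide on an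
      open set.\<close>
    have "pd e_t v z - laplacian v z + v z powr p = 0"
    proof (rule agree[OF U(1)[OF z] U(2)[OF z] order_refl z, of "\<lambda>x. pd e_t v x - laplacian v x + v x powr p"])
      have "continuous_on S (\<lambda>x. pd e_t v x - laplacian v x + v x powr p)"
        unfolding laplacian_def
        by (intro continuous_on_add continuous_on_diff continuous_on_sum continuous_on_powr' C21_onD[OF C21] continuous_on_const ballI)
          (use nn p in auto)
      then show "continuous_on (U z) (\<lambda>x. pd e_t v x - laplacian v x + v x powr p)"
        by (rule continuous_on_subset) (rule U(3)[OF z])
      fix x assume x: "x \<in> U z - T"
      have eq: "v y = u y" if "y \<in> U z - T" for y using that U(3)[OF z] by (intro vu) blast
      have "pd e_t v x = pd e_t u x" by (rule pd_cong[OF U(4)[OF z] eq x])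
      moreover have "laplacian v x = laplacian u x" by (rule laplacian_cong[OF U(4)[OF z] eq x])
      moreover have "pd e_t u x - laplacian u x = - (u x powr p)"
        using u x U(3)[OF z] by (auto simp: nonneg_solution_def)
      ultimately show "pd e_t v x - laplacian v x + v x powr p = 0" using eq[OF x] by simp
    qed
    then show ?thesis by simp
  qed
  show ?thesis using vu C21 nn pde by (intro exI[of _ v]) (auto simp: nonneg_solution_def)
qed

theorem proposition3p6:
  fixes m :: nat and p B :: real
    and M0 :: "(real ^ 'n::finite) set" and I J :: "real set"
    and F F' :: "(real ^ 'n) \<times> real \<Rightarrow> real ^ 'n"
    and \<Omega> :: "(real ^ 'n) set" and u :: "(real ^ 'n) \<times> real \<Rightarrow> real"
    and M :: "real \<Rightarrow> (real ^ 'n) set"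
  assumes "m \<ge> 1" and "CARD('n) \<ge> m + 3"
    and "1 < p" and "p < real (CARD('n) - m) / real (CARD('n) - m - 2)"
    and "connected M0" and "compact M0" and "embedded_submanifold m M0"
    and "diffeo_family F I" and "extends_to_family F I F' J"
    and "M = moving F I F' M0"
    and "B > 0" and "B_bounded B F I M0"
    and "open \<Omega>" and "connected \<Omega>"
    and "\<And>t. t \<in> closure I \<Longrightarrow> M t \<subseteq> \<Omega>"
    and "nonneg_solution p (\<Omega> \<times> I - track M I) u"
    and "\<And>I'. is_interval I' \<Longrightarrow> bounded I' \<Longrightarrow> closure I' \<subseteq> I \<Longrightarrow>
           lim_to_moving M I'
             (\<lambda>(x, t). infdist x (M t) ^ (CARD('n) - m - 2) * u (x, t)) 0"
  shows "\<exists>v. (\<forall>z \<in> \<Omega> \<times> I - track M I. v z = u z) \<and> nonneg_solution p (\<Omega> \<times> I) v"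
proof (cases "M0 = {}")
  \<comment> \<open>With an empty track u itself is the extension. The case is separate because
    \<open>infdist\<close> to the empty set is 0 and the cutoffs around K require K to be
    nonempty.\<close>
  case True
  then have "track M I = {}" using assms(10) by (auto simp: track_def moving_def)
  then show ?thesis using assms(16) by auto
next
  case False
  have "open I" using assms(8) by (simp add: diffeo_family_def)
  then have S: "open (\<Omega> \<times> I)" using assms(13) by (intro open_Times)
  show ?thesis
    by (rule glue_extensions[OF S assms(16) assms(3)])
       (rule local_extension_moving[OF assms(2,3,4,6) False assms(7,8,10,13,16,17)])
qed

end
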